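(* Let $G$ be a countable discrete sofic group with sofic approximation $\Sigma=(\sigma_n)_{n\ge1}$, $\sigma_n:G\to\mathrm{Sym}(V_n)$, and let $(\mathcal{X}^G,\mu,S,d_{\mathcal{X}})$ be a metric $G$-process. Suppose there exist $\mu_n\in\mathrm{Prob}(\mathcal{X}^{V_n})$ such that $(\mu_n)_{n\ge1}$ doubly-quenched converges to $\mu$ rel $\Sigma$. Then any complemented factor map of $(\mathcal{X}^G,\mu,S)$ is model-surjective rel $\Sigma$. In particular, any complemented factor map of a Bernoulli shift over $G$ is model-surjective relative to any sofic approximation of $G$.
   Context: Sofic approximations and systems. A sofic approximation to $G$ is a sequence $\Sigma=(\sigma_n)_{n\ge 1}$ of maps $\sigma_n:G\to\mathrm{Sym}(V_n)$, $g\mapsto\sigma_n^g$, where $V_n$ are finite sets with $|V_n|\to\infty$, such that for all $g,h\in G$ the proportion of $v\in V_n$ with $\sigma_n^g(\sigma_n^h(v))=\sigma_n^{gh}(v)$ tends to $1$, and for all $g\neq h$ the proportion of $v\in V_n$ with $\sigma_n^g(v)\ne\sigma_n^h(v)$ tends to $1$. A $G$-system $(X,\mu,T)$ is a standard probability space $(X,\mu)$ with a measurable $\mu$-preserving action $T$ of $G$. A factor map between $G$-systems is a measurable map, equivariant a.e., pushing the first measure to the second; it is an isomorphism if it is invertible modulo null sets. A factor map $\Phi:(X,\mu,T)\to(Y,\nu,S)$ is complemented if there is another factor map $\Psi:(X,\mu,T)\to(Z,\theta,R)$ such that $(\Phi,\Psi):(X,\mu,T)\to(Y\times Z,\nu\times\theta,S\times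 R)$ is an isomorphism. A Bernoulli shift is $(\mathcal{X}^G,\nu^{\times G},S)$ for a standard probability space $(\mathcal{X},\nu)$. Metric $G$-processes. A metric $G$-process $(\mathcal{X}^G,\mu,S,d)$ consists of a standard measurable space $\mathcal{X}$, a compact metric $d$ on $\mathcal{X}$ whose Borel $\sigma$-algebra is that of $\mathcal{X}$, the right-shift action $(S^h x)_g=x_{gh}$ of $G$ on $\mathcal{X}^G$, and an $S$-invariant probability measure $\mu$ on $\mathcal{X}^G$. The weak$^\ast$ topology on $\mathrm{Prob}(\mathcal{X}^G)$ (Borel probability measures) refers to the product topology on $\mathcal{X}^G$ arising from $d$. Models. For $\sigma:G\to\mathrm{Sym}(V)$, $v\in V$, $\mathbf{x}\in\mathcal{X}^V$, put $\Pi^\sigma_v(\mathbf{x})=(x_{\sigma^g(v)})_{g\in G}\in\mathcal{X}^G$ and $P^\sigma_{\mathbf{x}}=\frac1{|V|}\sum_{v\in V}\delta_{\Pi^\sigma_v(\mathbf{x})}$ (empirical distribution). For a weak$^\ast$-neighbourhood $\mathcal{O}$ of $\mu$, $\Omega(\mathcal{O},\sigma_n)=\{\mathbf{x}\in\mathcal{X}^{V_n}:P^{\sigma_n}_{\mathbf{x}}\in\mathcal{O}\}$. Convergence of measures on model spaces. Let $\mu_n\in\mathrm{Prob}(\mathcal{X}^{V_n})$. The sequence $(\mu_n)$ converges locally weak$^\ast$ to $\mu$ if for every weak$^\ast$-neighbourhood $\mathcal{O}$ of $\mu$ the proportion of $v\in V_n$ with $(\Pi^{\sigma_n}_v)_\ast\mu_n\in\mathcal{O}$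 tends to $1$. It quenched-converges to $\mu$ if it converges locally weak$^\ast$ to $\mu$ and also $\mu_n(\Omega(\mathcal{O},\sigma_n))\to1$ for every weak$^\ast$-neighbourhood $\mathcal{O}$ of $\mu$. It doubly-quenched converges to $\mu$ rel $\Sigma$ if $\mu_n\times\mu_n\in\mathrm{Prob}((\mathcal{X}\times\mathcal{X})^{V_n})$ quenched-converges to $\mu\times\mu\in\mathrm{Prob}((\mathcal{X}\times\mathcal{X})^G)$. Model-surjectivity. For a factor map $\Phi:(\mathcal{X}^G,\mu,S)\to(\mathcal{Y}^G,\nu,S)$ between metric $G$-processes, let $\lambda=\int\delta_{(x,\Phi(x))}\,\mu(dx)$ be its graphical joining, a measure on $\mathcal{X}^G\times\mathcal{Y}^G=(\mathcal{X}\times\mathcal{Y})^G$. $\Phi$ is model-surjective rel $\Sigma$ if, whenever $n_1<n_2<\cdots$ and $\mathbf{y}_i\in\mathcal{Y}^{V_{n_i}}$ satisfy $P^{\sigma_{n_i}}_{\mathbf{y}_i}\to\nu$ weak$^\ast$, there are $\mathbf{x}_i\in\mathcal{X}^{V_{n_i}}$ with $P^{\sigma_{n_i}}_{(\mathbf{x}_i,\mathbf{y}_i)}\to\lambda$ weak$^\ast$, for the product topology on $\mathcal{X}^G\times\mathcal{Y}^G$. This is known not to depend on the choice of metrics, and to be invariant under replacing domain and target by isomorphic metric $G$-processes (with the corresponding factor map). Since every $G$-system is isomorphic to the system underlying a metric $G$-process, the notion extends to factor maps between arbitrary $G$-systems. *)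

theory Defs
  imports "HOL-Probability.Probability" "HOL-Algebra.Group" "HOL-Combinatorics.Permutations"
begin

section \<open>Borel probability measures and the weak* topology\<close>

definition borel_of :: "'a topology \<Rightarrow> 'a measure" where
  "borel_of K = sigma (topspace K) {U. openin K U}"

definition Prob :: "'a topology \<Rightarrow> 'a measure set" where
  "Prob K = {m. sets m = sets (borel_of K) \<and> prob_space m}"

text \<open>The coarsest topology on \<^term>\<open>Prob K\<close> making \<open>m \<mapsto> \<integral>f dm\<close> continuous for every continuous
  \<open>f : K \<rightarrow> \<real>\<close>. It is only used for compact \<^term>\<open>K\<close>, so every such \<open>f\<close> is bounded.\<close>

definition weak_star :: "'a topology \<Rightarrow> 'a measure topology" where
  "weak_star K = topology_generated_by
     {{m \<in> Prob K. (\<integral>x. f x \<partial>m) \<in> U} | f U. continuous_map K euclideanreal f \<and> open U}"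

definition standard_borel :: "'a measure \<Rightarrow> bool" where
  "standard_borel M \<longleftrightarrow>
     (\<exists>K. completely_metrizable_space K \<and> second_countable K \<and> sets M = sets (borel_of K))"


section \<open>Systems and factor maps\<close>

definition g_system :: "('g, 'm) monoid_scheme \<Rightarrow> 'x measure \<Rightarrow> ('g \<Rightarrow> 'x \<Rightarrow> 'x) \<Rightarrow> bool" where
  "g_system G M T \<longleftrightarrow> prob_space M \<and> standard_borel M \<and>
     (\<forall>g\<in>carrier G. T g \<in> M \<rightarrow>\<^sub>M M \<and> distr M M (T g) = M) \<and>
     (\<forall>x\<in>space M. T \<one>\<^bsub>G\<^esub> x = x) \<and>
     (\<forall>g\<in>carrier G. \<forall>h\<in>carrier G. \<forall>x\<in>space M. T (g \<otimes>\<^bsub>G\<^esub> h) x = T g (T h x))"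

definition factor_map ::
  "('g, 'm) monoid_scheme \<Rightarrow> 'x measure \<Rightarrow> ('g \<Rightarrow> 'x \<Rightarrow> 'x) \<Rightarrow> 'y measure \<Rightarrow> ('g \<Rightarrow> 'y \<Rightarrow> 'y)
    \<Rightarrow> ('x \<Rightarrow> 'y) \<Rightarrow> bool" where
  "factor_map G M T N S \<Phi> \<longleftrightarrow> \<Phi> \<in> M \<rightarrow>\<^sub>M N \<and> distr M N \<Phi> = N \<and>
     (\<forall>g\<in>carrier G. AE x in M. \<Phi> (T g x) = S g (\<Phi> x))"

definition system_iso ::
  "('g, 'm) monoid_scheme \<Rightarrow> 'x measure \<Rightarrow> ('g \<Rightarrow> 'x \<Rightarrow> 'x) \<Rightarrow> 'y measure \<Rightarrow> ('g \<Rightarrow> 'y \<Rightarrow> 'y)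
    \<Rightarrow> ('x \<Rightarrow> 'y) \<Rightarrow> bool" where
  "system_iso G M T N S \<Phi> \<longleftrightarrow> factor_map G M T N S \<Phi> \<and>
     (\<exists>\<Psi>\<in>N \<rightarrow>\<^sub>M M. (AE x in M. \<Psi> (\<Phi> x) = x) \<and> (AE y in N. \<Phi> (\<Psi> y) = y))"

text \<open>The type \<open>'z\<close> hosts the complementary system. HOL cannot quantify over it inside the
  definition; a theorem assuming \<open>complemented TYPE('z) \<dots>\<close> with \<open>'z\<close> left free covers every
  complement.\<close>

definition complemented ::
  "'z itself \<Rightarrow> ('g, 'm) monoid_scheme \<Rightarrow> 'x measure \<Rightarrow> ('g \<Rightarrow> 'x \<Rightarrow> 'x)
    \<Rightarrow> 'y measure \<Rightarrow> ('g \<Rightarrow> 'y \<Rightarrow> 'y) \<Rightarrow> ('x \<Rightarrow> 'y) \<Rightarrow> bool" where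
  "complemented TYPE('z) G M T N S \<Phi> \<longleftrightarrow>
     (\<exists>(Z :: 'z measure) R \<Psi>. g_system G Z R \<and> factor_map G M T Z R \<Psi> \<and>
        system_iso G M T (N \<Otimes>\<^sub>M Z) (\<lambda>g. map_prod (S g) (R g)) (\<lambda>x. (\<Phi> x, \<Psi> x)))"


section \<open>Shift systems and metric processes\<close>

text \<open>Elements of \<open>X\<^sup>I\<close> are extensional functions on the index set.\<close>

abbreviation configs :: "'i set \<Rightarrow> 'x topology \<Rightarrow> ('i \<Rightarrow> 'x) topology" where
  "configs I X \<equiv> product_topology (\<lambda>_. X) I"

definition right_shift :: "('g, 'm) monoid_scheme \<Rightarrow> 'g \<Rightarrow> ('g \<Rightarrow> 'x) \<Rightarrow> 'g \<Rightarrow> 'x" where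
  "right_shift G h x = (\<lambda>g\<in>carrier G. x (g \<otimes>\<^bsub>G\<^esub> h))"

definition zip_on :: "'i set \<Rightarrow> ('i \<Rightarrow> 'x) \<Rightarrow> ('i \<Rightarrow> 'y) \<Rightarrow> 'i \<Rightarrow> 'x \<times> 'y" where
  "zip_on I x y = (\<lambda>i\<in>I. (x i, y i))"

definition metric_process ::
  "('g, 'm) monoid_scheme \<Rightarrow> 'x metric \<Rightarrow> ('g \<Rightarrow> 'x) measure \<Rightarrow> bool" where
  "metric_process G d \<mu> \<longleftrightarrow> compact_space (mtopology_of d) \<and>
     \<mu> \<in> Prob (configs (carrier G) (mtopology_of d)) \<and>
     (\<forall>h\<in>carrier G. distr \<mu> \<mu> (right_shift G h) = \<mu>)"

definition bernoulli :: "('g, 'm) monoid_scheme \<Rightarrow> 'k measure \<Rightarrow> ('g \<Rightarrow> 'k) measure" where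
  "bernoulli G \<kappa> = PiM (carrier G) (\<lambda>_. \<kappa>)"


section \<open>Sofic approximations and model spaces\<close>

definition sofic_approximation ::
  "('g, 'm) monoid_scheme \<Rightarrow> (nat \<Rightarrow> 'v set) \<Rightarrow> (nat \<Rightarrow> 'g \<Rightarrow> 'v \<Rightarrow> 'v) \<Rightarrow> bool" where
  "sofic_approximation G V \<sigma> \<longleftrightarrow>
     (\<forall>n. finite (V n)) \<and> filterlim (\<lambda>n. card (V n)) at_top sequentially \<and>
     (\<forall>n. \<forall>g\<in>carrier G. \<sigma> n g permutes V n) \<and>
     (\<forall>g\<in>carrier G. \<forall>h\<in>carrier G.
        (\<lambda>n. real (card {v \<in> V n. \<sigma> n g (\<sigma> n h v) = \<sigma> n (g \<otimes>\<^bsub>G\<^esub> h) v}) / real (card (V n)))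
          \<longlonglongrightarrow> 1) \<and>
     (\<forall>g\<in>carrier G. \<forall>h\<in>carrier G. g \<noteq> h \<longrightarrow>
        (\<lambda>n. real (card {v \<in> V n. \<sigma> n g v \<noteq> \<sigma> n h v}) / real (card (V n))) \<longlonglongrightarrow> 1)"

definition pullback ::
  "('g, 'm) monoid_scheme \<Rightarrow> ('g \<Rightarrow> 'v \<Rightarrow> 'v) \<Rightarrow> 'v \<Rightarrow> ('v \<Rightarrow> 'x) \<Rightarrow> 'g \<Rightarrow> 'x" where
  "pullback G s v x = (\<lambda>g\<in>carrier G. x (s g v))"

text \<open>The average of the point masses at the points \<open>pullback G s v x\<close>, as the image of the uniform
  distribution of \<open>v\<close>.\<close>

definition empirical ::
  "('g, 'm) monoid_scheme \<Rightarrow> 'v set \<Rightarrow> ('g \<Rightarrow> 'v \<Rightarrow> 'v) \<Rightarrow> 'x topology \<Rightarrow> ('v \<Rightarrow> 'x)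
    \<Rightarrow> ('g \<Rightarrow> 'x) measure" where
  "empirical G W s X x =
     distr (uniform_count_measure W) (borel_of (configs (carrier G) X)) (\<lambda>v. pullback G s v x)"

definition model_space ::
  "('g, 'm) monoid_scheme \<Rightarrow> 'v set \<Rightarrow> ('g \<Rightarrow> 'v \<Rightarrow> 'v) \<Rightarrow> 'x topology \<Rightarrow> ('g \<Rightarrow> 'x) measure set
    \<Rightarrow> ('v \<Rightarrow> 'x) set" where
  "model_space G W s X \<O> = {x \<in> topspace (configs W X). empirical G W s X x \<in> \<O>}"

text \<open>Below, the neighbourhoods \<open>\<O>\<close> of \<open>\<mu>\<close> are open ones. The conditions are monotone in \<open>\<O>\<close>, so
  this loses nothing, and it keeps the model spaces measurable.\<close>

definition locally_weak_star_converges ::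
  "('g, 'm) monoid_scheme \<Rightarrow> (nat \<Rightarrow> 'v set) \<Rightarrow> (nat \<Rightarrow> 'g \<Rightarrow> 'v \<Rightarrow> 'v) \<Rightarrow> 'x topology
    \<Rightarrow> (nat \<Rightarrow> ('v \<Rightarrow> 'x) measure) \<Rightarrow> ('g \<Rightarrow> 'x) measure \<Rightarrow> bool" where
  "locally_weak_star_converges G V \<sigma> X m \<mu> \<longleftrightarrow>
     (\<forall>\<O>. openin (weak_star (configs (carrier G) X)) \<O> \<and> \<mu> \<in> \<O> \<longrightarrow>
        (\<lambda>n. real (card {v \<in> V n.
                distr (m n) (borel_of (configs (carrier G) X)) (pullback G (\<sigma> n) v) \<in> \<O>})
              / real (card (V n))) \<longlonglongrightarrow> 1)"

definition quenched_converges ::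
  "('g, 'm) monoid_scheme \<Rightarrow> (nat \<Rightarrow> 'v set) \<Rightarrow> (nat \<Rightarrow> 'g \<Rightarrow> 'v \<Rightarrow> 'v) \<Rightarrow> 'x topology
    \<Rightarrow> (nat \<Rightarrow> ('v \<Rightarrow> 'x) measure) \<Rightarrow> ('g \<Rightarrow> 'x) measure \<Rightarrow> bool" where
  "quenched_converges G V \<sigma> X m \<mu> \<longleftrightarrow> locally_weak_star_converges G V \<sigma> X m \<mu> \<and>
     (\<forall>\<O>. openin (weak_star (configs (carrier G) X)) \<O> \<and> \<mu> \<in> \<O> \<longrightarrow>
        (\<lambda>n. measure (m n) (model_space G (V n) (\<sigma> n) X \<O>)) \<longlonglongrightarrow> 1)"

text \<open>\<open>\<mu> \<times> \<nu>\<close>, viewed as a measure on \<open>(X \<times> Y)\<^sup>I\<close>.\<close>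

definition prod_config_measure ::
  "'i set \<Rightarrow> 'x topology \<Rightarrow> 'y topology \<Rightarrow> ('i \<Rightarrow> 'x) measure \<Rightarrow> ('i \<Rightarrow> 'y) measure
    \<Rightarrow> ('i \<Rightarrow> 'x \<times> 'y) measure" where
  "prod_config_measure I X Y \<mu> \<nu> =
     distr (\<mu> \<Otimes>\<^sub>M \<nu>) (borel_of (configs I (prod_topology X Y))) (\<lambda>(x, y). zip_on I x y)"

definition doubly_quenched_converges ::
  "('g, 'm) monoid_scheme \<Rightarrow> (nat \<Rightarrow> 'v set) \<Rightarrow> (nat \<Rightarrow> 'g \<Rightarrow> 'v \<Rightarrow> 'v) \<Rightarrow> 'x topology
    \<Rightarrow> (nat \<Rightarrow> ('v \<Rightarrow> 'x) measure) \<Rightarrow> ('g \<Rightarrow> 'x) measure \<Rightarrow> bool" where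
  "doubly_quenched_converges G V \<sigma> X m \<mu> \<longleftrightarrow>
     quenched_converges G V \<sigma> (prod_topology X X)
       (\<lambda>n. prod_config_measure (V n) X X (m n) (m n))
       (prod_config_measure (carrier G) X X \<mu> \<mu>)"


section \<open>Model-surjectivity\<close>

definition graphical_joining ::
  "('g, 'm) monoid_scheme \<Rightarrow> 'x topology \<Rightarrow> 'y topology \<Rightarrow> ('g \<Rightarrow> 'x) measure
    \<Rightarrow> (('g \<Rightarrow> 'x) \<Rightarrow> ('g \<Rightarrow> 'y)) \<Rightarrow> ('g \<Rightarrow> 'x \<times> 'y) measure" where
  "graphical_joining G X Y \<mu> \<Phi> =
     distr \<mu> (borel_of (configs (carrier G) (prod_topology X Y))) (\<lambda>x. zip_on (carrier G) x (\<Phi> x))"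

definition process_model_surjective ::
  "('g, 'm) monoid_scheme \<Rightarrow> (nat \<Rightarrow> 'v set) \<Rightarrow> (nat \<Rightarrow> 'g \<Rightarrow> 'v \<Rightarrow> 'v)
    \<Rightarrow> 'x metric \<Rightarrow> ('g \<Rightarrow> 'x) measure \<Rightarrow> 'y metric \<Rightarrow> ('g \<Rightarrow> 'y) measure
    \<Rightarrow> (('g \<Rightarrow> 'x) \<Rightarrow> ('g \<Rightarrow> 'y)) \<Rightarrow> bool" where
  "process_model_surjective G V \<sigma> d \<mu> e \<nu> \<Phi> \<longleftrightarrow>
     (let X = mtopology_of d; Y = mtopology_of e in
      \<forall>n :: nat \<Rightarrow> nat. \<forall>y. strict_mono n \<and> (\<forall>i. y i \<in> topspace (configs (V (n i)) Y)) \<and>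
        limitin (weak_star (configs (carrier G) Y))
          (\<lambda>i. empirical G (V (n i)) (\<sigma> (n i)) Y (y i)) \<nu> sequentially \<longrightarrow>
        (\<exists>x. (\<forall>i. x i \<in> topspace (configs (V (n i)) X)) \<and>
           limitin (weak_star (configs (carrier G) (prod_topology X Y)))
             (\<lambda>i. empirical G (V (n i)) (\<sigma> (n i)) (prod_topology X Y)
                    (zip_on (V (n i)) (x i) (y i)))
             (graphical_joining G X Y \<mu> \<Phi>) sequentially))"

text \<open>For a factor map between arbitrary systems, model-surjectivity is that of the corresponding
  factor map \<open>\<Phi>'\<close> between metric processes isomorphic to the domain and the target. It does not
  depend on their choice; the definition asks for it for every choice whose alphabets are carried by
  the types \<open>'a\<close> and \<open>'b\<close> (any set in them, with any compact metric). A theorem leaving \<open>'a\<close> and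
  \<open>'b\<close> free covers all metric processes. Every compact metric space is isometric to one carried by
  a set of reals, so \<open>'a = 'b = real\<close> already represents all systems.\<close>

definition model_surjective ::
  "'a itself \<Rightarrow> 'b itself \<Rightarrow> ('g, 'm) monoid_scheme \<Rightarrow> (nat \<Rightarrow> 'v set) \<Rightarrow> (nat \<Rightarrow> 'g \<Rightarrow> 'v \<Rightarrow> 'v)
    \<Rightarrow> 'x measure \<Rightarrow> ('g \<Rightarrow> 'x \<Rightarrow> 'x) \<Rightarrow> 'y measure \<Rightarrow> ('g \<Rightarrow> 'y \<Rightarrow> 'y) \<Rightarrow> ('x \<Rightarrow> 'y) \<Rightarrow> bool" where
  "model_surjective TYPE('a) TYPE('b) G V \<sigma> M T N S \<Phi> \<longleftrightarrow>
     (\<forall>(d :: 'a metric) \<mu> (e :: 'b metric) \<nu> \<alpha> \<beta> \<Phi>'.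
        metric_process G d \<mu> \<and> metric_process G e \<nu> \<and>
        system_iso G M T \<mu> (right_shift G) \<alpha> \<and> system_iso G N S \<nu> (right_shift G) \<beta> \<and>
        factor_map G \<mu> (right_shift G) \<nu> (right_shift G) \<Phi>' \<and> (AE x in M. \<Phi>' (\<alpha> x) = \<beta> (\<Phi> x)) \<longrightarrow>
        process_model_surjective G V \<sigma> d \<mu> e \<nu> \<Phi>')"

end

theory Submission
  imports Defs
begin

text \<open>Let \<open>M\<close> be the given system, \<open>N\<close> its factor and \<open>Z\<close> the complementary factor, so that \<open>M\<close> is
  isomorphic to \<open>N \<times> Z\<close>. Suppose that \<open>\<mu>\<close> is a process on \<open>X\<^sup>G\<close> with \<open>M\<close> as a factor, that \<open>\<nu>\<close> is a
  process isomorphic to \<open>N\<close>, and that \<open>y\<^sub>n\<close> are models of \<open>\<nu>\<close>. The models of \<open>M\<close> above \<open>y\<^sub>n\<close> are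
  found in two steps.

  First there are \<open>x\<^sub>n\<close> for which the pairs \<open>(x\<^sub>n, y\<^sub>n)\<close> are models of \<open>\<mu> \<times> \<nu>\<close>. This is a second moment
  argument. Choose \<open>x\<^sub>n\<close> at random with law \<open>m\<^sub>n\<close>, and test the empirical distribution of the pair
  with a product \<open>f(x) h(y)\<close>. With \<open>c = \<integral>f d\<mu>\<close>, the average over \<open>v\<close> of
  \<open>(f(\<Pi>\<^sub>v x\<^sub>n) - c) h(\<Pi>\<^sub>v y\<^sub>n)\<close> has second moment at most \<open>sup h\<^sup>2\<close> times the average over pairs \<open>v, w\<close>
  of \<open>\<bar>E (f(\<Pi>\<^sub>v x\<^sub>n) - c) (f(\<Pi>\<^sub>w x\<^sub>n) - c)\<bar>\<close>, a bound in which \<open>y\<^sub>n\<close> no longer occurs. So it is enough that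
  this last average tends to \<open>0\<close>, which is the condition \<open>decorrelates\<close> below; the step is
  \<open>exists_independent_models\<close>. If \<open>m\<^sub>n\<close> doubly-quenched converges to \<open>\<mu>\<close>, the condition holds because,
  by Fubini, the average of the squares of these expectations is the second moment, for two
  independent samples \<open>x, x'\<close>, of the average over \<open>v\<close> of \<open>(f(\<Pi>\<^sub>v x) - c) (f(\<Pi>\<^sub>v x') - c)\<close>; that is an
  integral against the empirical distribution of \<open>(x, x')\<close>, hence close to its value \<open>0\<close> at \<open>\<mu> \<times> \<mu>\<close>
  (\<open>doubly_quenched_decorrelates\<close>). If \<open>\<mu>\<close> is Bernoulli and \<open>m\<^sub>n\<close> is a product measure, then
  \<open>f(\<Pi>\<^sub>v x)\<close> and \<open>f(\<Pi>\<^sub>w x)\<close> are independent with mean \<open>c\<close> for most pairs \<open>v, w\<close>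
  (\<open>bernoulli_decorrelates\<close>).

  Secondly, \<open>N \<times> Z \<cong> M\<close> turns \<open>y\<close> together with the \<open>Z\<close>-part of \<open>x\<close> into a point \<open>\<theta>(x, y)\<close> of a process
  isomorphic to \<open>M\<close>. Under \<open>\<mu> \<times> \<nu>\<close> the \<open>N\<close>-part of \<open>\<theta>(x, y)\<close> is \<open>y\<close> almost surely, so the law of
  \<open>(\<theta>(x, y), y)\<close> is the graphical joining. As models are carried forward by every factor map
  (\<open>factor_map_lifts_models\<close>), the models \<open>(x\<^sub>n, y\<^sub>n)\<close> yield \<open>a\<^sub>n\<close> for which \<open>(a\<^sub>n, y\<^sub>n)\<close> are models of the
  graphical joining. The two steps are put together in \<open>complemented_factor_model_surjective\<close>.

  A Bernoulli shift over an arbitrary standard Borel space is a factor of one over the Hilbert cube,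
  because every probability measure on a standard Borel space is the image of one on the cube
  (\<open>standard_borel_image_of_hilbert_cube\<close>). The latter shift is a process over a compact metric
  alphabet, and serves as \<open>\<mu>\<close>.\<close>

section \<open>Compact metrizable spaces\<close>

abbreviation compact_metrizable :: "'k topology \<Rightarrow> bool" where
  "compact_metrizable K \<equiv> compact_space K \<and> metrizable_space K"

definition countable_separating :: "'k topology \<Rightarrow> ('k \<Rightarrow> real) set \<Rightarrow> bool" where
  "countable_separating K \<F> \<longleftrightarrow> countable \<F> \<and> (\<forall>f\<in>\<F>. continuous_map K euclideanreal f) \<and>
     (\<forall>x\<in>topspace K. \<forall>y\<in>topspace K. x \<noteq> y \<longrightarrow> (\<exists>f\<in>\<F>. f x \<noteq> f y))"

definition monomial :: "('k \<Rightarrow> real) list \<Rightarrow> 'k \<Rightarrow> real" where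
  "monomial l x = prod_list (map (\<lambda>f. f x) l)"

lemma monomial_simps [simp]:
  "monomial [] x = 1" "monomial (f # l) x = f x * monomial l x"
  "monomial (l @ l') x = monomial l x * monomial l' x"
  by (auto simp: monomial_def)

lemma continuous_monomial:
  assumes "\<And>f. f \<in> set l \<Longrightarrow> continuous_map K euclideanreal f"
  shows "continuous_map K euclideanreal (monomial l)"
  using assms
proof (induction l)
  case Nil
  then show ?case by (simp add: monomial_def [abs_def])
next
  case (Cons f l)
  have "continuous_map K euclideanreal (\<lambda>x. f x * monomial l x)"
    using Cons by (intro continuous_map_real_mult) auto
  then show ?case by (simp add: monomial_def [abs_def])
qed

lemma continuous_on_compact_bounded:
  assumes "compact_space K" "continuous_map K euclideanreal f"
  obtains B :: real where "B > 0" "\<And>x. x \<in> topspace K \<Longrightarrow> \<bar>f x\<bar> \<le> B"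
proof -
  have "compact (f ` topspace K)"
    using image_compactin [OF _ assms(2)] assms(1) by (simp add: compact_space_def)
  then have "bounded (f ` topspace K)"
    by (rule compact_imp_bounded)
  then obtain B where B: "B > 0" "\<forall>y\<in>f ` topspace K. norm y \<le> B"
    using bounded_pos by blast
  then show ?thesis
    by (intro that [of B]) auto
qed

lemma continuous_map_add_real:
  "continuous_map K euclideanreal f \<Longrightarrow> continuous_map K euclideanreal g
    \<Longrightarrow> continuous_map K euclideanreal (\<lambda>x. f x + g x)"
  by (intro continuous_intros)

lemma compact_metrizable_prod:
  "compact_metrizable X \<Longrightarrow> compact_metrizable Y \<Longrightarrow> compact_metrizable (prod_topology X Y)"
  by (simp add: compact_space_prod_topology metrizable_space_prod_topology)

lemma compact_metrizable_configs:
  assumes "compact_metrizable X" "countable I"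
  shows "compact_metrizable (configs I X)"
proof -
  have "countable {i \<in> I. \<not> (\<exists>a. topspace X \<subseteq> {a})}"
    by (rule countable_subset [OF _ assms(2)]) auto
  then show ?thesis
    using assms by (auto simp: compact_space_product_topology metrizable_space_product_topology)
qed

text \<open>The distances to the points of a countable dense set separate points; total boundedness
  provides such a set.\<close>

lemma compact_metrizable_countable_separating:
  assumes "compact_metrizable K"
  obtains \<F> where "countable_separating K \<F>"
proof -
  obtain M d where M: "Metric_space M d" "K = Metric_space.mtopology M d"
    using assms unfolding metrizable_space_def by blast
  interpret Metric_space M d by (rule M)
  have tb: "mtotally_bounded M"
    using assms M by (simp add: compact_space_eq_mcomplete_mtotally_bounded)
  have "\<exists>C. finite C \<and> C \<subseteq> M \<and> M \<subseteq> (\<Union>x\<in>C. mball x (1 / Suc n))" for n :: nat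
    using tb [unfolded mtotally_bounded_def, rule_format, of "1 / Suc n"] by simp
  then obtain C where C: "\<And>n. finite (C n)" "\<And>n. C n \<subseteq> M"
    "\<And>n. M \<subseteq> (\<Union>x\<in>C n. mball x (1 / Suc n))" by metis
  define D where "D = (\<Union>n. C n)"
  have "countable_separating K ((\<lambda>p x. d p x) ` D)"
    unfolding countable_separating_def
  proof (intro conjI ballI impI)
    have "countable D"
      unfolding D_def by (rule countable_UN) (use C(1) countable_finite in auto)
    then show "countable ((\<lambda>p x. d p x) ` D)" by (rule countable_image)
  next
    fix f assume "f \<in> (\<lambda>p x. d p x) ` D"
    then obtain p where "p \<in> M" "f = (\<lambda>x. d p x)"
      using C(2) by (auto simp: D_def)
    moreover have "continuous_map K euclideanreal (\<lambda>x. mdist (metric (M, d)) p x)"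
      using \<open>p \<in> M\<close> Metric_space_axioms M(2)
      by (intro continuous_map_mdist) (auto simp: mtopology_of_def)
    ultimately show "continuous_map K euclideanreal f"
      using Metric_space_axioms by simp
  next
    fix x y assume xy: "x \<in> topspace K" "y \<in> topspace K" "x \<noteq> y"
    then have xy': "x \<in> M" "y \<in> M" using M(2) by auto
    then have "d x y > 0" using xy by simp
    then obtain n where n: "inverse (real (Suc n)) < d x y / 2"
      using reals_Archimedean [of "d x y / 2"] by auto
    obtain p where p: "p \<in> C n" "d p x < 1 / Suc n"
      using C(3)[of n] xy' by (auto simp: in_mball)
    have "p \<in> M" using p C(2) by auto
    have "d p x \<noteq> d p y"
    proof
      assume eq: "d p x = d p y"
      have "d x y \<le> d x p + d p y" using triangle xy' \<open>p \<in> M\<close> by blast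
      then have "d x y \<le> 2 * d p x" by (simp add: eq commute)
      then show False using p(2) n unfolding inverse_eq_divide by linarith
    qed
    then show "\<exists>f\<in>(\<lambda>p x. d p x) ` D. f x \<noteq> f y"
      using p by (auto simp: D_def)
  qed
  then show ?thesis by (rule that)
qed

text \<open>An injective continuous map from a compact space into a Hausdorff space is an embedding. This
  carries questions about \<open>K\<close> over to the metric space \<^typ>\<open>nat \<Rightarrow> real\<close>.\<close>

lemma countable_separating_embedding:
  assumes K: "compact_space K" and \<F>: "countable_separating K \<F>" "\<F> \<noteq> {}"
  defines "J \<equiv> \<lambda>x n. from_nat_into \<F> n x"
  shows "embedding_map K euclidean (J :: 'k \<Rightarrow> nat \<Rightarrow> real)"
proof (rule continuous_imp_embedding_map [OF _ K])
  have "continuous_map K (product_topology (\<lambda>_. euclidean) UNIV) J"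
    unfolding J_def continuous_map_componentwise_UNIV
    using \<F> from_nat_into [OF \<F>(2)] by (auto simp: countable_separating_def)
  then show "continuous_map K euclidean J"
    by (simp add: euclidean_product_topology)
  show "Hausdorff_space (euclidean :: (nat \<Rightarrow> real) topology)" by simp
  show "inj_on J (topspace K)"
  proof (rule inj_onI, rule ccontr)
    fix x y assume "x \<in> topspace K" "y \<in> topspace K" "J x = J y" "x \<noteq> y"
    then obtain f where f: "f \<in> \<F>" "f x \<noteq> f y"
      using \<F> unfolding countable_separating_def by metis
    then obtain n where "from_nat_into \<F> n = f"
      using from_nat_into_surj \<F>(1) unfolding countable_separating_def by metis
    then show False
      using f \<open>J x = J y\<close> unfolding J_def by metis
  qed
qed

lemma compact_metrizable_embedding:
  fixes K :: "'k topology"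
  assumes "compact_metrizable K"
  obtains J :: "'k \<Rightarrow> nat \<Rightarrow> real" where "embedding_map K euclidean J"
proof -
  obtain \<F> where "countable_separating K \<F>"
    using compact_metrizable_countable_separating assms by blast
  then have "countable_separating K (insert (\<lambda>_. 0) \<F>)"
    by (auto simp: countable_separating_def)
  from countable_separating_embedding [OF _ this] show ?thesis
    using assms that by blast
qed

text \<open>In \<^typ>\<open>nat \<Rightarrow> real\<close> the distance to the complement of an open set is positive exactly on the
  set; pull it back along the embedding.\<close>

lemma open_eq_support:
  fixes K :: "'k topology"
  assumes "compact_metrizable K" "openin K U"
  obtains F where "continuous_map K euclideanreal F" "\<And>x. x \<in> topspace K \<Longrightarrow> F x \<ge> 0"
    "U = {x \<in> topspace K. F x > 0}"
proof -
  obtain J :: "'k \<Rightarrow> nat \<Rightarrow> real" where J: "embedding_map K euclidean J"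
    using compact_metrizable_embedding assms(1) by blast
  then have hom: "homeomorphic_map K (subtopology euclidean (J ` topspace K)) J"
    by (simp add: embedding_map_def)
  then have inj: "inj_on J (topspace K)"
    by (rule homeomorphic_imp_injective_map)
  have cont: "continuous_map K euclidean J"
    using homeomorphic_imp_continuous_map [OF hom] by (simp add: continuous_map_in_subtopology)
  have "openin (subtopology euclidean (J ` topspace K)) (J ` U)"
    using hom assms(2) homeomorphic_map_openness_eq by blast
  then obtain O' where O': "open O'" "J ` U = O' \<inter> J ` topspace K"
    by (auto simp: openin_subtopology)
  have U: "x \<in> U \<longleftrightarrow> J x \<in> O'" if "x \<in> topspace K" for x
  proof
    assume "J x \<in> O'"
    then have "J x \<in> J ` U" using O'(2) that by blast
    then obtain y where "y \<in> U" "J x = J y" by blast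
    then show "x \<in> U"
      using inj_onD [OF inj, of x y] that openin_subset [OF assms(2)] by blast
  qed (use O'(2) in blast)
  \<comment> \<open>\<^const>\<open>infdist\<close> to the empty set is \<open>0\<close>, so the whole space is a case of its own\<close>
  define F where "F x = (if O' = UNIV then 1 else infdist (J x) (- O'))" for x
  show ?thesis
  proof (rule that [of F])
    have c: "continuous_map K euclideanreal (\<lambda>x. infdist (J x) (- O'))"
    proof -
      have "continuous_map euclidean euclideanreal (\<lambda>z. infdist z (- O'))"
        by (simp add: continuous_on_infdist)
      from continuous_map_compose [OF cont this] show ?thesis by (simp add: comp_def)
    qed
    then show "continuous_map K euclideanreal F"
      unfolding F_def by (cases "O' = UNIV") auto
    show "F x \<ge> 0" for x by (simp add: F_def infdist_nonneg)
    show "U = {x \<in> topspace K. 0 < F x}"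
    proof (rule subset_antisym; rule subsetI)
      fix x assume x: "x \<in> U"
      then have xk: "x \<in> topspace K" using openin_subset [OF assms(2)] by auto
      have "J x \<notin> - O'" using U [OF xk] x by auto
      moreover have "- O' \<noteq> {}" if "O' \<noteq> UNIV" using that by blast
      ultimately have "F x > 0"
        using infdist_pos_not_in_closed [of "- O'" "J x"] O'(1)
        unfolding F_def by (cases "O' = UNIV") (auto simp: closed_Compl)
      then show "x \<in> {x \<in> topspace K. 0 < F x}" using xk by auto
    next
      fix x assume x: "x \<in> {x \<in> topspace K. 0 < F x}"
      then show "x \<in> U"
        using U [of x] infdist_zero [of "J x" "- O'"] by (cases "O' = UNIV") (auto simp: F_def)
    qed
  qed
qed

section \<open>Density of monomials\<close>

text \<open>Weak* convergence is tested on monomials in a separating family. This suffices, as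
  their linear span is an algebra and so uniformly dense by Stone-Weierstrass. There are only
  countably many of them, which allows one sequence of models to pass all tests, and a monomial in
  the coordinates of a pair \<open>(x, y)\<close> is a product of one in \<open>x\<close> and one in \<open>y\<close>.\<close>

inductive_set monomial_span :: "('k \<Rightarrow> real) set \<Rightarrow> ('k \<Rightarrow> real) set" for \<F> where
  mono: "l \<in> lists \<F> \<Longrightarrow> monomial l \<in> monomial_span \<F>"
| scale: "f \<in> monomial_span \<F> \<Longrightarrow> (\<lambda>x. c * f x) \<in> monomial_span \<F>"
| add: "f \<in> monomial_span \<F> \<Longrightarrow> g \<in> monomial_span \<F> \<Longrightarrow> (\<lambda>x. f x + g x) \<in> monomial_span \<F>"

lemma monomial_span_mult:
  assumes "f \<in> monomial_span \<F>" "g \<in> monomial_span \<F>"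
  shows "(\<lambda>x. f x * g x) \<in> monomial_span \<F>"
  using assms
proof (induction arbitrary: g)
  case (mono l)
  from mono(2) show ?case
  proof induction
    case (mono l')
    have "monomial (l @ l') \<in> monomial_span \<F>"
      using \<open>l \<in> lists \<F>\<close> mono by (intro monomial_span.mono) auto
    then show ?case by (simp add: monomial_def [abs_def])
  next
    case (scale f c)
    then show ?case
      using monomial_span.scale [OF scale(2), of c] by (simp add: algebra_simps)
  next
    case (add f g)
    then show ?case using monomial_span.add [OF add(3,4)] by (simp add: algebra_simps)
  qed
next
  case (scale f c)
  then show ?case using monomial_span.scale [OF scale(2) [OF scale(3)], of c]
    by (simp add: algebra_simps)
next
  case (add f1 f2)
  then show ?case using monomial_span.add [OF add(3,4) [OF add(5)]]
    by (simp add: algebra_simps)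
qed

lemma monomial_span_continuous:
  assumes "countable_separating K \<F>" "f \<in> monomial_span \<F>"
  shows "continuous_map K euclideanreal f"
  using assms(2)
proof induction
  case (mono l)
  then show ?case using assms(1)
    by (intro continuous_monomial) (auto simp: countable_separating_def)
next
  case (scale f c)
  then show ?case by (intro continuous_map_real_mult_left)
next
  case (add f g)
  then show ?case by (intro continuous_map_add_real)
qed

text \<open>Stone-Weierstrass on the compact image of \<open>K\<close> in \<^typ>\<open>nat \<Rightarrow> real\<close>. The functions
  there that pull back to the span of the monomials form an algebra, which separates points.\<close>

lemma monomials_uniformly_dense:
  assumes K: "compact_space K" and \<F>: "countable_separating K \<F>"
    and F: "continuous_map K euclideanreal F" and "\<epsilon> > 0"
  obtains f where "f \<in> monomial_span \<F>" "\<And>x. x \<in> topspace K \<Longrightarrow> \<bar>F x - f x\<bar> < \<epsilon>"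
proof -
  define \<F>' where "\<F>' = insert (\<lambda>_. 1) \<F>"
  have \<F>': "countable_separating K \<F>'" "\<F>' \<noteq> {}"
    using \<F> by (auto simp: countable_separating_def \<F>'_def)
  define J where "J = (\<lambda>x n. from_nat_into \<F>' n x)"
  have emb: "embedding_map K euclidean J"
    unfolding J_def by (rule countable_separating_embedding [OF K \<F>'])
  define S where "S = J ` topspace K"
  obtain I where I: "homeomorphic_maps K (top_of_set S) J I"
    using emb unfolding embedding_map_def S_def homeomorphic_map_maps by blast
  have Iinv: "I (J x) = x" if "x \<in> topspace K" for x
    using I that by (auto simp: homeomorphic_maps_def)
  have cI: "continuous_map (top_of_set S) K I" and cJ: "continuous_map K (top_of_set S) J"
    using I by (auto simp: homeomorphic_maps_def)
  define R where "R = {g. continuous_on S g \<and> (\<exists>f\<in>monomial_span \<F>. \<forall>x\<in>topspace K. g (J x) = f x)}"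
  interpret function_ring_on R S
  proof
    show "compact S"
      using image_compactin [OF _ cJ, of "topspace K"] K
      by (simp add: compact_space_def S_def compactin_subtopology)
  next
    fix f g assume f: "f \<in> R" and g: "g \<in> R"
    obtain f' where f': "f' \<in> monomial_span \<F>" "\<forall>x\<in>topspace K. f (J x) = f' x"
      using f by (auto simp: R_def)
    obtain g' where g': "g' \<in> monomial_span \<F>" "\<forall>x\<in>topspace K. g (J x) = g' x"
      using g by (auto simp: R_def)
    show "(\<lambda>x. f x + g x) \<in> R"
      unfolding R_def using f g monomial_span.add [OF f'(1) g'(1)] f'(2) g'(2)
      by (auto simp: R_def intro!: continuous_on_add bexI)
    show "(\<lambda>x. f x * g x) \<in> R"
      unfolding R_def using f g monomial_span_mult [OF f'(1) g'(1)] f'(2) g'(2)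
      by (auto simp: R_def intro!: continuous_on_mult bexI)
  next
    fix c :: real
    have "(\<lambda>x. c * monomial [] x) \<in> monomial_span \<F>"
      by (intro monomial_span.scale monomial_span.mono) auto
    then show "(\<lambda>_. c) \<in> R"
      unfolding R_def by force
  next
    fix x y assume xy: "x \<in> S" "y \<in> S" "x \<noteq> y"
    then obtain a b where ab: "a \<in> topspace K" "b \<in> topspace K" "x = J a" "y = J b" "a \<noteq> b"
      by (auto simp: S_def)
    then obtain f where f: "f \<in> \<F>" "f a \<noteq> f b"
      using \<F> unfolding countable_separating_def by metis
    have "continuous_map (top_of_set S) euclideanreal (f \<circ> I)"
      using f \<F> by (intro continuous_map_compose [OF cI]) (auto simp: countable_separating_def)
    moreover have "f \<in> monomial_span \<F>"
      using monomial_span.mono [of "[f]" \<F>] f by (simp add: monomial_def [abs_def])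
    ultimately have "f \<circ> I \<in> R"
      by (auto simp: R_def Iinv comp_def)
    then show "\<exists>f\<in>R. f x \<noteq> f y"
      using f ab Iinv by (intro bexI [of _ "f \<circ> I"]) auto
  qed (auto simp: R_def)
  have "continuous_map (top_of_set S) euclideanreal (F \<circ> I)"
    by (rule continuous_map_compose [OF cI F])
  then have "continuous_on S (F \<circ> I)" by simp
  from Stone_Weierstrass_basic [OF this \<open>\<epsilon> > 0\<close>] obtain g
    where g: "g \<in> R" "\<forall>x\<in>S. \<bar>(F \<circ> I) x - g x\<bar> < \<epsilon>" by blast
  then obtain f where f: "f \<in> monomial_span \<F>" "\<forall>x\<in>topspace K. g (J x) = f x"
    by (auto simp: R_def)
  show ?thesis
    using f g Iinv by (intro that [of f]) (auto simp: S_def)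
qed

section \<open>Borel measures on compact metrizable spaces\<close>

lemma space_borel_of [simp]: "space (borel_of K) = topspace K"
  by (simp add: borel_of_def space_measure_of_conv)

lemma sets_borel_of: "sets (borel_of K) = sigma_sets (topspace K) {U. openin K U}"
  unfolding borel_of_def by (rule sets_measure_of) (use openin_subset in blast)

lemma borel_of_openin: "openin K U \<Longrightarrow> U \<in> sets (borel_of K)"
  unfolding sets_borel_of by (rule sigma_sets.Basic) simp

lemma continuous_map_measurable_borel_of:
  assumes "continuous_map K L f"
  shows "f \<in> borel_of K \<rightarrow>\<^sub>M borel_of L"
  unfolding borel_of_def [of L]
proof (rule measurable_measure_of)
  show "f \<in> space (borel_of K) \<rightarrow> topspace L"
    using assms by (auto simp: continuous_map_def)
  fix U assume "U \<in> {U. openin L U}"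
  then have "openin K {x \<in> topspace K. f x \<in> U}"
    using assms by (auto simp: continuous_map_def)
  moreover have "f -` U \<inter> space (borel_of K) = {x \<in> topspace K. f x \<in> U}" by auto
  ultimately show "f -` U \<inter> space (borel_of K) \<in> sets (borel_of K)"
    by (auto intro: borel_of_openin)
qed (auto dest: openin_subset)

lemma continuous_map_borel_measurable:
  assumes "continuous_map K euclideanreal f"
  shows "f \<in> borel_measurable (borel_of K)"
proof (rule borel_measurableI)
  fix S :: "real set" assume "open S"
  then have "openin K {x \<in> topspace K. f x \<in> S}"
    using assms by (auto simp: continuous_map_def)
  moreover have "f -` S \<inter> space (borel_of K) = {x \<in> topspace K. f x \<in> S}" by auto
  ultimately show "f -` S \<inter> space (borel_of K) \<in> sets (borel_of K)"
    by (auto intro: borel_of_openin)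
qed

lemma Prob_sets: "m \<in> Prob K \<Longrightarrow> sets m = sets (borel_of K)"
  by (auto simp: Prob_def)

lemma Prob_space: "m \<in> Prob K \<Longrightarrow> space m = topspace K"
  using sets_eq_imp_space_eq [OF Prob_sets, of m K] by simp

lemma Prob_prob_space: "m \<in> Prob K \<Longrightarrow> prob_space m"
  by (auto simp: Prob_def)

lemma measurable_Prob_dom: "m \<in> Prob K \<Longrightarrow> measurable m N = measurable (borel_of K) N"
  by (rule measurable_cong_sets) (simp_all add: Prob_sets)

lemma measurable_Prob_cod: "m \<in> Prob K \<Longrightarrow> measurable N m = measurable N (borel_of K)"
  by (rule measurable_cong_sets) (simp_all add: Prob_sets)

lemma distr_in_Prob:
  assumes "prob_space m" "f \<in> m \<rightarrow>\<^sub>M borel_of K"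
  shows "distr m (borel_of K) f \<in> Prob K"
  using assms by (auto simp: Prob_def intro: prob_space.prob_space_distr)

lemma continuous_integrable:
  assumes "compact_space K" "m \<in> Prob K" "continuous_map K euclideanreal f"
  shows "integrable m f"
proof -
  interpret prob_space m using assms Prob_prob_space by blast
  obtain B where "\<And>x. x \<in> topspace K \<Longrightarrow> \<bar>f x\<bar> \<le> B"
    using continuous_on_compact_bounded assms(1,3) by blast
  then show ?thesis
    using continuous_map_borel_measurable [OF assms(3)] measurable_Prob_dom [OF assms(2)] Prob_space [OF assms(2)]
    by (intro integrable_const_bound [of _ B]) auto
qed

text \<open>Measurability of \<open>f \<circ> h\<close> passes from the family to monomials, to their span and, by uniform
  approximation, to all continuous \<open>f\<close>; every open set is of the form \<open>{f > 0}\<close>. For spaces of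
  configurations this reduces measurability to single coordinates, and so identifies the Borel
  sets of a product with the product \<open>\<sigma>\<close>-algebra.\<close>

lemma measurable_borel_ofI_separating:
  assumes K: "compact_metrizable K" and \<F>: "countable_separating K \<F>"
    and h: "h \<in> space M \<rightarrow> topspace K" "\<And>f. f \<in> \<F> \<Longrightarrow> (\<lambda>x. f (h x)) \<in> borel_measurable M"
  shows "h \<in> M \<rightarrow>\<^sub>M borel_of K"
proof -
  have span: "(\<lambda>x. f (h x)) \<in> borel_measurable M" if "f \<in> monomial_span \<F>" for f
    using that
  proof induction
    case (mono l)
    then show ?case
    proof (induction l)
      case (Cons f l)
      then show ?case using h(2) by auto
    qed auto
  qed auto
  have cont: "(\<lambda>x. F (h x)) \<in> borel_measurable M" if F: "continuous_map K euclideanreal F" for F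
  proof -
    have "\<exists>f. f \<in> monomial_span \<F> \<and> (\<forall>x\<in>topspace K. \<bar>F x - f x\<bar> < inverse (Suc n))" for n
      using monomials_uniformly_dense [OF _ \<F> F, of "inverse (Suc n)"] K
      by (metis inverse_positive_iff_positive of_nat_0_less_iff zero_less_Suc)
    then obtain f where f: "\<And>n. f n \<in> monomial_span \<F>"
      "\<And>n x. x \<in> topspace K \<Longrightarrow> \<bar>F x - f n x\<bar> < inverse (Suc n)" by metis
    show ?thesis
    proof (rule borel_measurable_LIMSEQ_real)
      show "(\<lambda>n. f n (h x)) \<longlonglongrightarrow> F (h x)" if "x \<in> space M" for x
      proof -
        have "h x \<in> topspace K" using h(1) that by auto
        then have "(\<lambda>n. f n (h x) - F (h x)) \<longlonglongrightarrow> 0"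
          using f(2) by (intro Lim_null_comparison [OF _ LIMSEQ_inverse_real_of_nat])
            (auto intro!: always_eventually less_imp_le simp: abs_minus_commute)
        then show ?thesis by (simp add: LIM_zero_iff)
      qed
    qed (use span f(1) in auto)
  qed
  show ?thesis
    unfolding borel_of_def
  proof (rule measurable_measure_of)
    fix U assume "U \<in> {U. openin K U}"
    then obtain F where F: "continuous_map K euclideanreal F" "U = {x \<in> topspace K. F x > 0}"
      using open_eq_support K by (metis mem_Collect_eq)
    have "h -` U \<inter> space M = {x \<in> space M. F (h x) > 0}"
      using F(2) h(1) by auto
    moreover have "{x \<in> space M. F (h x) > 0} \<in> sets M"
      using cont [OF F(1)] by measurable
    ultimately show "h -` U \<inter> space M \<in> sets M" by simp
  qed (use h in \<open>auto dest: openin_subset\<close>)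
qed

definition coordinate_functions :: "'i set \<Rightarrow> ('x \<Rightarrow> real) set \<Rightarrow> (('i \<Rightarrow> 'x) \<Rightarrow> real) set" where
  "coordinate_functions I \<F> = (\<lambda>(f, i) z. f (z i)) ` (\<F> \<times> I)"

definition pair_functions :: "('x \<Rightarrow> real) set \<Rightarrow> ('y \<Rightarrow> real) set \<Rightarrow> ('x \<times> 'y \<Rightarrow> real) set" where
  "pair_functions \<F> \<G> = (\<lambda>f z. f (fst z)) ` \<F> \<union> (\<lambda>g z. g (snd z)) ` \<G>"

lemma countable_separating_configs:
  assumes "countable_separating X \<F>" "countable I"
  shows "countable_separating (configs I X) (coordinate_functions I \<F>)"
  unfolding countable_separating_def coordinate_functions_def
proof (intro conjI ballI impI)
  show "countable ((\<lambda>(f, i) z. f (z i)) ` (\<F> \<times> I))"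
    using assms by (auto simp: countable_separating_def)
next
  fix h assume "h \<in> (\<lambda>(f, i) z. f (z i)) ` (\<F> \<times> I)"
  then obtain f i where fi: "f \<in> \<F>" "i \<in> I" "h = (\<lambda>z. f (z i))" by auto
  have "continuous_map (configs I X) euclideanreal (f \<circ> (\<lambda>z. z i))"
    using assms(1) fi(1) continuous_map_product_projection [OF fi(2), of "\<lambda>_. X"]
    by (intro continuous_map_compose [where X' = X]) (auto simp: countable_separating_def)
  then show "continuous_map (configs I X) euclideanreal h"
    using fi by (simp add: comp_def)
next
  fix x y assume xy: "x \<in> topspace (configs I X)" "y \<in> topspace (configs I X)" "x \<noteq> y"
  then have "\<exists>i\<in>I. x i \<noteq> y i"
    using PiE_ext [of x I "\<lambda>_. topspace X" y] by auto
  then obtain i where i: "i \<in> I" "x i \<noteq> y i" "x i \<in> topspace X" "y i \<in> topspace X"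
    using xy by (auto simp: PiE_iff)
  then obtain f where "f \<in> \<F>" "f (x i) \<noteq> f (y i)"
    using assms(1) unfolding countable_separating_def by metis
  then show "\<exists>h\<in>(\<lambda>(f, i) z. f (z i)) ` (\<F> \<times> I). h x \<noteq> h y"
    using i by (intro bexI [of _ "\<lambda>z. f (z i)"]) (auto intro!: image_eqI [of _ _ "(f, i)"])
qed

lemma countable_separating_prod:
  assumes "countable_separating X \<F>" "countable_separating Y \<G>"
  shows "countable_separating (prod_topology X Y) (pair_functions \<F> \<G>)"
  unfolding countable_separating_def pair_functions_def
proof (intro conjI ballI impI)
  show "countable ((\<lambda>f z. f (fst z)) ` \<F> \<union> (\<lambda>g z. g (snd z)) ` \<G>)"
    using assms by (auto simp: countable_separating_def)
next
  fix h assume "h \<in> (\<lambda>f z. f (fst z)) ` \<F> \<union> (\<lambda>g z. g (snd z)) ` \<G>"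
  moreover have "continuous_map (prod_topology X Y) euclideanreal (f \<circ> fst)" if "f \<in> \<F>" for f
    using that assms(1) by (intro continuous_map_compose [OF continuous_map_fst])
      (auto simp: countable_separating_def)
  moreover have "continuous_map (prod_topology X Y) euclideanreal (g \<circ> snd)" if "g \<in> \<G>" for g
    using that assms(2) by (intro continuous_map_compose [OF continuous_map_snd])
      (auto simp: countable_separating_def)
  ultimately show "continuous_map (prod_topology X Y) euclideanreal h"
    by (auto simp: comp_def)
next
  fix x y assume xy: "x \<in> topspace (prod_topology X Y)" "y \<in> topspace (prod_topology X Y)" "x \<noteq> y"
  show "\<exists>h\<in>(\<lambda>f z. f (fst z)) ` \<F> \<union> (\<lambda>g z. g (snd z)) ` \<G>. h x \<noteq> h y"
  proof (cases "fst x = fst y")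
    case False
    have "fst x \<in> topspace X" "fst y \<in> topspace X" using xy by auto
    then obtain f where "f \<in> \<F>" "f (fst x) \<noteq> f (fst y)"
      using False assms(1) unfolding countable_separating_def by metis
    then show ?thesis by (intro bexI [of _ "\<lambda>z. f (fst z)"]) auto
  next
    case True
    then have "snd x \<noteq> snd y" "snd x \<in> topspace Y" "snd y \<in> topspace Y"
      using xy by (auto simp: prod_eq_iff)
    then obtain g where "g \<in> \<G>" "g (snd x) \<noteq> g (snd y)"
      using assms(2) unfolding countable_separating_def by metis
    then show ?thesis by (intro bexI [of _ "\<lambda>z. g (snd z)"]) auto
  qed
qed

lemma L1_triangle:
  fixes f g h :: "'k \<Rightarrow> real"
  assumes "integrable m f" "integrable m g" "integrable m h"
  shows "(\<integral>x. \<bar>f x - h x\<bar> \<partial>m) \<le> (\<integral>x. \<bar>f x - g x\<bar> \<partial>m) + (\<integral>x. \<bar>g x - h x\<bar> \<partial>m)"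
proof -
  have i: "integrable m (\<lambda>x. \<bar>f x - h x\<bar>)" "integrable m (\<lambda>x. \<bar>f x - g x\<bar>)"
    "integrable m (\<lambda>x. \<bar>g x - h x\<bar>)"
    using assms by simp_all
  have "(\<integral>x. \<bar>f x - h x\<bar> \<partial>m) \<le> (\<integral>x. \<bar>f x - g x\<bar> + \<bar>g x - h x\<bar> \<partial>m)"
  proof (rule integral_mono [OF i(1)])
    show "integrable m (\<lambda>x. \<bar>f x - g x\<bar> + \<bar>g x - h x\<bar>)"
      using i by simp
  qed linarith
  also have "\<dots> = (\<integral>x. \<bar>f x - g x\<bar> \<partial>m) + (\<integral>x. \<bar>g x - h x\<bar> \<partial>m)"
    using i(2,3) by (rule Bochner_Integration.integral_add)
  finally show ?thesis .
qed

lemma L1_sum_triangle: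
  fixes f g f' g' :: "'k \<Rightarrow> real"
  assumes "integrable m f" "integrable m g" "integrable m f'" "integrable m g'"
  shows "(\<integral>x. \<bar>f x + g x - (f' x + g' x)\<bar> \<partial>m) \<le> (\<integral>x. \<bar>f x - f' x\<bar> \<partial>m) + (\<integral>x. \<bar>g x - g' x\<bar> \<partial>m)"
  using L1_triangle [of m "\<lambda>x. f x + g x" "\<lambda>x. f' x + g x" "\<lambda>x. f' x + g' x"] assms by simp

text \<open>The functions that can be approximated form a closed subspace of \<open>L\<^sup>1\<close>. The indicator of an open
  set \<open>{F > 0}\<close> is the limit of \<open>min 1 (i F)\<close>; open sets are stable under intersection and generate
  the Borel sets, so all indicators and then all integrable functions follow.\<close>

lemma continuous_dense_in_L1:
  fixes u :: "'k \<Rightarrow> real"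
  assumes K: "compact_metrizable K" and m: "m \<in> Prob K"
    and u: "integrable m u" and "\<epsilon> > 0"
  obtains f where "continuous_map K euclideanreal f" "(\<integral>x. \<bar>u x - f x\<bar> \<partial>m) < \<epsilon>"
proof -
  interpret prob_space m using m by (rule Prob_prob_space)
  define P where "P u \<longleftrightarrow> (\<forall>\<epsilon>>0. \<exists>f. continuous_map K euclideanreal f \<and>
    (\<integral>x. \<bar>u x - f x\<bar> \<partial>m) < \<epsilon>)" for u :: "'k \<Rightarrow> real"
  have int: "integrable m f" if "continuous_map K euclideanreal f" for f
    by (rule continuous_integrable [OF conjunct1 [OF K] m that])
  have lim: "P u" if s: "\<And>i. integrable m (s i)" "\<And>i. P (s i)" "integrable m u"
    and l: "(\<lambda>i. \<integral>x. \<bar>u x - s i x\<bar> \<partial>m) \<longlonglongrightarrow> 0" for u and s :: "nat \<Rightarrow> 'k \<Rightarrow> real"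
    unfolding P_def
  proof (intro allI impI)
    fix \<epsilon> :: real assume "\<epsilon> > 0"
    then have "\<forall>\<^sub>F i in sequentially. (\<integral>x. \<bar>u x - s i x\<bar> \<partial>m) < \<epsilon> / 2"
      by (intro order_tendstoD(2) [OF l]) auto
    then obtain i where i: "(\<integral>x. \<bar>u x - s i x\<bar> \<partial>m) < \<epsilon> / 2"
      by (meson eventually_happens' sequentially_bot)
    obtain f where f: "continuous_map K euclideanreal f" "(\<integral>x. \<bar>s i x - f x\<bar> \<partial>m) < \<epsilon> / 2"
      using s(2) [unfolded P_def, rule_format, of "\<epsilon> / 2" i] \<open>\<epsilon> > 0\<close> by auto
    have "(\<integral>x. \<bar>u x - f x\<bar> \<partial>m) \<le> (\<integral>x. \<bar>u x - s i x\<bar> \<partial>m) + (\<integral>x. \<bar>s i x - f x\<bar> \<partial>m)"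
      by (rule L1_triangle [OF s(3) s(1) int [OF f(1)]])
    then show "\<exists>f. continuous_map K euclideanreal f \<and> (\<integral>x. \<bar>u x - f x\<bar> \<partial>m) < \<epsilon>"
      using f i by (intro exI [of _ f]) auto
  qed
  have add_closed: "P (\<lambda>x. f x + g x)" if fg: "integrable m f" "integrable m g" "P f" "P g" for f g
    unfolding P_def
  proof (intro allI impI)
    fix \<epsilon> :: real assume "\<epsilon> > 0"
    obtain f' where f': "continuous_map K euclideanreal f'" "(\<integral>x. \<bar>f x - f' x\<bar> \<partial>m) < \<epsilon> / 2"
      using fg(3) [unfolded P_def, rule_format, of "\<epsilon> / 2"] \<open>\<epsilon> > 0\<close> by auto
    obtain g' where g': "continuous_map K euclideanreal g'" "(\<integral>x. \<bar>g x - g' x\<bar> \<partial>m) < \<epsilon> / 2"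
      using fg(4) [unfolded P_def, rule_format, of "\<epsilon> / 2"] \<open>\<epsilon> > 0\<close> by auto
    have "(\<integral>x. \<bar>f x + g x - (f' x + g' x)\<bar> \<partial>m) \<le> (\<integral>x. \<bar>f x - f' x\<bar> \<partial>m) + (\<integral>x. \<bar>g x - g' x\<bar> \<partial>m)"
      by (rule L1_sum_triangle [OF fg(1,2) int [OF f'(1)] int [OF g'(1)]])
    then show "\<exists>h. continuous_map K euclideanreal h \<and> (\<integral>x. \<bar>f x + g x - h x\<bar> \<partial>m) < \<epsilon>"
      using f' g' by (intro exI [of _ "\<lambda>x. f' x + g' x"]) (auto intro: continuous_map_add_real)
  qed
  have scale: "P (\<lambda>x. c * f x)" if Pf: "P f" for c f
    unfolding P_def
  proof (intro allI impI)
    fix \<epsilon> :: real assume "\<epsilon> > 0"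
    then have "\<epsilon> / (\<bar>c\<bar> + 1) > 0" by simp
    then obtain f' where f': "continuous_map K euclideanreal f'"
      "(\<integral>x. \<bar>f x - f' x\<bar> \<partial>m) < \<epsilon> / (\<bar>c\<bar> + 1)"
      using Pf unfolding P_def by meson
    have "\<bar>c * f x - c * f' x\<bar> = \<bar>c\<bar> * \<bar>f x - f' x\<bar>" for x
      unfolding abs_mult [symmetric] right_diff_distrib ..
    then have "(\<integral>x. \<bar>c * f x - c * f' x\<bar> \<partial>m) = \<bar>c\<bar> * (\<integral>x. \<bar>f x - f' x\<bar> \<partial>m)"
      by simp
    also have "\<dots> \<le> (\<bar>c\<bar> + 1) * (\<integral>x. \<bar>f x - f' x\<bar> \<partial>m)"
      by (intro mult_right_mono integral_nonneg) auto
    also have "\<dots> < (\<bar>c\<bar> + 1) * (\<epsilon> / (\<bar>c\<bar> + 1))"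
      by (intro mult_strict_left_mono f') auto
    also have "\<dots> = \<epsilon>" by simp
    finally show "\<exists>h. continuous_map K euclideanreal h \<and> (\<integral>x. \<bar>c * f x - h x\<bar> \<partial>m) < \<epsilon>"
      using f' by (intro exI [of _ "\<lambda>x. c * f' x"]) (auto intro: continuous_map_real_mult_left)
  qed
  have const: "P f" if "continuous_map K euclideanreal f" for f
    unfolding P_def using that by (intro allI impI exI [of _ f]) auto
  have lim_dom: "P u" if s: "\<And>i. integrable m (s i)" "\<And>i. P (s i)" and u: "integrable m u"
    and l: "\<And>x. x \<in> space m \<Longrightarrow> (\<lambda>i. s i x) \<longlonglongrightarrow> u x"
    and d: "\<And>i x. x \<in> space m \<Longrightarrow> \<bar>s i x\<bar> \<le> w x" "integrable m w"
  for u w and s :: "nat \<Rightarrow> 'k \<Rightarrow> real"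
  proof (rule lim [OF s u])
    have "(\<lambda>i. \<integral>x. \<bar>u x - s i x\<bar> \<partial>m) \<longlonglongrightarrow> (\<integral>x. 0 \<partial>m)"
    proof (rule integral_dominated_convergence [where w = "\<lambda>x. \<bar>u x\<bar> + w x"])
      show "AE x in m. (\<lambda>i. \<bar>u x - s i x\<bar>) \<longlonglongrightarrow> 0"
      proof (rule AE_I2)
        fix x assume "x \<in> space m"
        from l [OF this] have "(\<lambda>i. u x - s i x) \<longlonglongrightarrow> u x - u x" by (intro tendsto_intros)
        then show "(\<lambda>i. \<bar>u x - s i x\<bar>) \<longlonglongrightarrow> 0" by (simp add: tendsto_rabs_zero)
      qed
      show "AE x in m. norm \<bar>u x - s i x\<bar> \<le> \<bar>u x\<bar> + w x" for i
      proof (rule AE_I2)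
        fix x assume "x \<in> space m"
        then show "norm \<bar>u x - s i x\<bar> \<le> \<bar>u x\<bar> + w x"
          using d(1) [of x i] abs_triangle_ineq4 [of "u x" "s i x"] by simp
      qed
    qed (use s u d(2) in auto)
    then show "(\<lambda>i. \<integral>x. \<bar>u x - s i x\<bar> \<partial>m) \<longlonglongrightarrow> 0" by simp
  qed
  have ind: "P (indicator A)" if "A \<in> sets m" for A
  proof -
    have "Int_stable {U. openin K U}" by (auto intro: Int_stableI)
    moreover have "{U. openin K U} \<subseteq> Pow (topspace K)" by (auto dest: openin_subset)
    moreover have "A \<in> sigma_sets (topspace K) {U. openin K U}"
      using that Prob_sets [OF m] by (simp add: sets_borel_of)
    ultimately show ?thesis
    proof (induction rule: sigma_sets_induct_disjoint)
      case (basic U)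
      then obtain F where F: "continuous_map K euclideanreal F" "\<And>x. x \<in> topspace K \<Longrightarrow> F x \<ge> 0"
        "U = {x \<in> topspace K. F x > 0}"
        using open_eq_support [OF K] by (metis mem_Collect_eq)
      have c: "continuous_map K euclideanreal (\<lambda>x. min 1 (real i * F x))" for i
        using F(1) by (intro continuous_map_real_min continuous_map_real_mult_left) auto
      show ?case
      proof (rule lim_dom [of "\<lambda>i x. min 1 (real i * F x)" _ "\<lambda>_. 1"])
        fix x assume "x \<in> space m"
        then have x: "x \<in> topspace K" using Prob_space [OF m] by simp
        show "\<bar>min 1 (real i * F x)\<bar> \<le> 1" for i
          using F(2) [OF x] by simp
        show "(\<lambda>i. min 1 (real i * F x)) \<longlonglongrightarrow> indicator U x"
        proof (cases "F x > 0")
          case True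
          then obtain N where N: "real N * F x > 1"
            using ex_less_of_nat_mult by blast
          have "\<forall>\<^sub>F i in sequentially. min 1 (real i * F x) = 1"
          proof (rule eventually_sequentiallyI [of N])
            fix i assume "N \<le> i"
            then have "real N * F x \<le> real i * F x"
              using True by (intro mult_right_mono) auto
            then show "min 1 (real i * F x) = 1" using N by simp
          qed
          then show ?thesis using True x F(3)
            by (simp add: tendsto_eventually)
        next
          case False
          then have "F x = 0" using F(2) [OF x] by simp
          then show ?thesis using False F(3) by simp
        qed
      next
        show "integrable m (indicator U :: 'k \<Rightarrow> real)"
          using basic borel_of_openin [of K U] Prob_sets [OF m]
          by (intro integrable_real_indicator) (auto simp: emeasure_eq_measure)
      qed (use c int const in auto)
    next
      case empty
      then show ?case using const [of "\<lambda>_. 0"] by (simp add: indicator_def [abs_def])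
    next
      case (compl A)
      have A: "A \<in> sets m" using compl Prob_sets [OF m] by (simp add: sets_borel_of)
      have "P (\<lambda>x. 1 + (-1) * indicator A x)"
        using A by (intro add_closed scale const compl) (auto simp: emeasure_eq_measure)
      moreover have "(\<integral>x. \<bar>indicator (topspace K - A) x - f x\<bar> \<partial>m)
          = (\<integral>x. \<bar>1 + (-1) * indicator A x - f x\<bar> \<partial>m)" for f :: "'k \<Rightarrow> real"
        by (intro Bochner_Integration.integral_cong) (auto simp: indicator_def Prob_space [OF m])
      ultimately show ?case unfolding P_def by metis
    next
      case (union A)
      have A: "A i \<in> sets m" for i using union Prob_sets [OF m] by (auto simp: sets_borel_of)
      show ?case
      proof (rule lim_dom [of "\<lambda>n x. \<Sum>i<n. indicator (A i) x" _ "\<lambda>_. 1"])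
        have I: "integrable m (indicator (A i) :: 'k \<Rightarrow> real)" for i
          using A by (intro integrable_real_indicator) (auto simp: emeasure_eq_measure)
        show "integrable m (\<lambda>x. \<Sum>i<n. indicator (A i) x :: real)" for n
          using I by auto
        show "P (\<lambda>x. \<Sum>i<n. indicator (A i) x)" for n
        proof (induction n)
          case 0
          then show ?case using const [of "\<lambda>_. 0"] by simp
        next
          case (Suc n)
          then show ?case using I union(3) by (auto intro!: add_closed)
        qed
        show "integrable m (indicator (\<Union>(range A)) :: 'k \<Rightarrow> real)"
          using A by (intro integrable_real_indicator) (auto simp: emeasure_eq_measure)
        fix x
        have S: "(\<lambda>i. indicator (A i) x :: real) sums indicator (\<Union>(range A)) x"
          using union(1) by (intro indicator_sums) (auto simp: disjoint_family_on_def)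
        then show "(\<lambda>n. \<Sum>i<n. indicator (A i) x :: real) \<longlonglongrightarrow> indicator (\<Union>(range A)) x"
          by (simp add: sums_def)
        have "(\<Sum>i<n. indicator (A i) x :: real) \<le> indicator (\<Union>(range A)) x" for n
          using sum_le_suminf [OF sums_summable [OF S], of "{..<n}"] sums_unique [OF S] by auto
        then show "\<bar>\<Sum>i<n. indicator (A i) x :: real\<bar> \<le> 1" for n
          by (smt (verit, best) indicator_le_1 indicator_pos_le sum_nonneg)
      qed auto
    qed
  qed
  from u have "P u"
  proof induction
    case (base A c)
    then show ?case using scale [OF ind, of A c] by (simp add: mult.commute)
  next
    case (add f g)
    then show ?case by (intro add_closed)
  next
    case (lim f s)
    have "integrable m (\<lambda>x. 2 * \<bar>f x\<bar>)" using lim.hyps(4) by simp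
    moreover have "\<bar>s i x\<bar> \<le> 2 * \<bar>f x\<bar>" if "x \<in> space m" for i x
      using lim.hyps(3) [OF that, of i] by simp
    ultimately show ?case
      by (intro lim_dom [OF lim.hyps(1) lim.IH lim.hyps(4) lim.hyps(2), of "\<lambda>x. 2 * \<bar>f x\<bar>"])
  qed
  then have "\<exists>f. continuous_map K euclideanreal f \<and> (\<integral>x. \<bar>u x - f x\<bar> \<partial>m) < \<epsilon>"
    using \<open>\<epsilon> > 0\<close> by (simp add: P_def)
  then show ?thesis using that by blast
qed

lemma continuous_map_monomial_induct [consumes 3, case_names monomial scale add lim]:
  assumes "compact_space K" "countable_separating K \<F>" "continuous_map K euclideanreal F"
    and mono: "\<And>l. l \<in> lists \<F> \<Longrightarrow> P (monomial l)"
    and scale: "\<And>c f. continuous_map K euclideanreal f \<Longrightarrow> P f \<Longrightarrow> P (\<lambda>x. c * f x)"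
    and add: "\<And>f g. continuous_map K euclideanreal f \<Longrightarrow> continuous_map K euclideanreal g \<Longrightarrow>
      P f \<Longrightarrow> P g \<Longrightarrow> P (\<lambda>x. f x + g x)"
    and lim: "\<And>f. continuous_map K euclideanreal f \<Longrightarrow>
      (\<And>\<epsilon>. \<epsilon> > 0 \<Longrightarrow> \<exists>g. continuous_map K euclideanreal g \<and> P g \<and>
        (\<forall>x\<in>topspace K. \<bar>f x - g x\<bar> < \<epsilon>)) \<Longrightarrow> P f"
  shows "P F"
proof (rule lim [OF assms(3)])
  have span: "P f" if "f \<in> monomial_span \<F>" for f
    using that
  proof induction
    case (scale f c)
    then show ?case using monomial_span_continuous [OF assms(2)] by (intro assms(5))
  next
    case (add f g)
    then show ?case using monomial_span_continuous [OF assms(2)] by (intro assms(6))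
  qed (rule mono)
  fix \<epsilon> :: real assume "\<epsilon> > 0"
  then obtain f where f: "f \<in> monomial_span \<F>" "\<And>x. x \<in> topspace K \<Longrightarrow> \<bar>F x - f x\<bar> < \<epsilon>"
    using monomials_uniformly_dense [OF assms(1-3)] by metis
  then show "\<exists>g. continuous_map K euclideanreal g \<and> P g \<and> (\<forall>x\<in>topspace K. \<bar>F x - g x\<bar> < \<epsilon>)"
    using span monomial_span_continuous [OF assms(2)] by (intro exI [of _ f]) simp
qed

section \<open>Weak* convergence\<close>

lemma weak_star_limitD:
  assumes "limitin (weak_star K) P m sequentially"
  shows "m \<in> Prob K" "\<forall>\<^sub>F i in sequentially. P i \<in> Prob K"
    "continuous_map K euclideanreal f \<Longrightarrow> (\<lambda>i. \<integral>x. f x \<partial>P i) \<longlonglongrightarrow> (\<integral>x. f x \<partial>m)"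
proof -
  have ts: "topspace (weak_star K) \<subseteq> Prob K"
    unfolding weak_star_def by auto
  have m: "m \<in> topspace (weak_star K)"
    using assms by (simp add: limitin_def)
  then show "m \<in> Prob K" using ts by blast
  have ev: "\<forall>\<^sub>F i in sequentially. P i \<in> \<O>" if "openin (weak_star K) \<O>" "m \<in> \<O>" for \<O>
    using assms that by (simp add: limitin_def)
  have "\<forall>\<^sub>F i in sequentially. P i \<in> topspace (weak_star K)"
    using m by (intro ev) auto
  then show "\<forall>\<^sub>F i in sequentially. P i \<in> Prob K"
    by (rule eventually_mono) (use ts in blast)
  assume f: "continuous_map K euclideanreal f"
  show "(\<lambda>i. \<integral>x. f x \<partial>P i) \<longlonglongrightarrow> (\<integral>x. f x \<partial>m)"
  proof (rule topological_tendstoI)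
    fix U :: "real set" assume U: "open U" "(\<integral>x. f x \<partial>m) \<in> U"
    have "openin (weak_star K) {m \<in> Prob K. (\<integral>x. f x \<partial>m) \<in> U}"
      unfolding weak_star_def using f U(1) by (intro topology_generated_by_Basis) blast
    from ev [OF this] have "\<forall>\<^sub>F i in sequentially. P i \<in> {m \<in> Prob K. (\<integral>x. f x \<partial>m) \<in> U}"
      using \<open>m \<in> Prob K\<close> U(2) by blast
    then show "\<forall>\<^sub>F i in sequentially. (\<integral>x. f x \<partial>P i) \<in> U"
      by (rule eventually_mono) simp
  qed
qed

lemma weak_star_limitI:
  assumes m: "m \<in> Prob K" and P: "\<forall>\<^sub>F i in sequentially. P i \<in> Prob K"
    and conv: "\<And>f. continuous_map K euclideanreal f \<Longrightarrow> (\<lambda>i. \<integral>x. f x \<partial>P i) \<longlonglongrightarrow> (\<integral>x. f x \<partial>m)"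
  shows "limitin (weak_star K) P m sequentially"
proof -
  define \<B> where "\<B> = {{m \<in> Prob K. (\<integral>x. f x \<partial>m) \<in> U} | f U. continuous_map K euclideanreal f \<and> open U}"
  have "{m \<in> Prob K. (\<integral>x. (\<lambda>_. 0 :: real) x \<partial>m) \<in> UNIV} \<in> \<B>"
    unfolding \<B>_def by (intro CollectI exI [of _ "\<lambda>_. 0"] exI [of _ UNIV]) simp
  then have "m \<in> topspace (weak_star K)"
    unfolding weak_star_def topology_generated_by_topspace \<B>_def [symmetric]
    by (rule UnionI) (use m in simp)
  moreover have "\<forall>\<^sub>F i in sequentially. P i \<in> \<O>" if "generate_topology_on \<B> \<O>" "m \<in> \<O>" for \<O>
    using that
  proof induction
    case (Int a b)
    then show ?case by (auto intro: eventually_conj simp: eventually_conj_iff)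
  next
    case (UN \<K>)
    then obtain k where "k \<in> \<K>" "m \<in> k" by blast
    with UN.IH [of k] have "\<forall>\<^sub>F i in sequentially. P i \<in> k" by simp
    then show ?case by (rule eventually_mono) (use \<open>k \<in> \<K>\<close> in blast)
  next
    case (Basis s)
    then obtain f U where fU: "s = {m \<in> Prob K. (\<integral>x. f x \<partial>m) \<in> U}"
      "continuous_map K euclideanreal f" "open U"
      unfolding \<B>_def by blast
    have "\<forall>\<^sub>F i in sequentially. (\<integral>x. f x \<partial>P i) \<in> U"
      using fU Basis(2) by (intro topological_tendstoD [OF conv]) auto
    with P show ?case by eventually_elim (simp add: fU(1))
  qed auto
  ultimately show ?thesis
    unfolding limitin_def weak_star_def openin_topology_generated_by_iff \<B>_def [symmetric]
    by blast
qed

text \<open>All measures concerned are probabilities, so replacing \<open>F\<close> by a function within \<open>\<epsilon>\<close> of it changes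
  every integral by at most \<open>\<epsilon>\<close>.\<close>

lemma uniform_limit_integral_tendsto:
  fixes F :: "'k \<Rightarrow> real"
  assumes K: "compact_space K" and m: "m \<in> Prob K" and P: "\<forall>\<^sub>F i in sequentially. P i \<in> Prob K"
    and F: "continuous_map K euclideanreal F"
    and app: "\<And>\<epsilon>. \<epsilon> > 0 \<Longrightarrow> \<exists>g. continuous_map K euclideanreal g \<and>
      (\<lambda>i. \<integral>x. g x \<partial>P i) \<longlonglongrightarrow> (\<integral>x. g x \<partial>m) \<and> (\<forall>x\<in>topspace K. \<bar>F x - g x\<bar> < \<epsilon>)"
  shows "(\<lambda>i. \<integral>x. F x \<partial>P i) \<longlonglongrightarrow> (\<integral>x. F x \<partial>m)"
proof (rule tendstoI)
  fix \<epsilon> :: real assume "\<epsilon> > 0"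
  then obtain g where g: "continuous_map K euclideanreal g"
    "(\<lambda>i. \<integral>x. g x \<partial>P i) \<longlonglongrightarrow> (\<integral>x. g x \<partial>m)" "\<forall>x\<in>topspace K. \<bar>F x - g x\<bar> < \<epsilon> / 3"
    using app [of "\<epsilon> / 3"] by auto
  have close: "\<bar>(\<integral>x. F x \<partial>n) - (\<integral>x. g x \<partial>n)\<bar> \<le> \<epsilon> / 3" if n: "n \<in> Prob K" for n
  proof -
    interpret prob_space n using n by (rule Prob_prob_space)
    have I: "integrable n F" "integrable n g"
      using continuous_integrable [OF K n] F g(1) by blast+
    have "\<bar>(\<integral>x. F x \<partial>n) - (\<integral>x. g x \<partial>n)\<bar> = \<bar>\<integral>x. F x - g x \<partial>n\<bar>"
      using I by simp
    also have "\<dots> \<le> (\<integral>x. \<bar>F x - g x\<bar> \<partial>n)"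
      by (rule integral_abs_bound)
    also have "\<dots> \<le> (\<integral>x. \<epsilon> / 3 \<partial>n)"
      using I g(3) Prob_space [OF n] by (intro integral_mono) (auto intro: less_imp_le)
    also have "\<dots> = \<epsilon> / 3" using prob_space by simp
    finally show ?thesis .
  qed
  have "\<forall>\<^sub>F i in sequentially. dist (\<integral>x. g x \<partial>P i) (\<integral>x. g x \<partial>m) < \<epsilon> / 3"
    using \<open>\<epsilon> > 0\<close> by (intro tendstoD [OF g(2)]) simp
  with P show "\<forall>\<^sub>F i in sequentially. dist (\<integral>x. F x \<partial>P i) (\<integral>x. F x \<partial>m) < \<epsilon>"
  proof eventually_elim
    case (elim i)
    then show ?case
      using close [OF elim(1)] close [OF m] unfolding dist_real_def by linarith
  qed
qed

lemma weak_star_limit_monomialsI: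
  assumes K: "compact_space K" and \<F>: "countable_separating K \<F>"
    and m: "m \<in> Prob K" and P: "\<forall>\<^sub>F i in sequentially. P i \<in> Prob K"
    and conv: "\<And>l. l \<in> lists \<F> \<Longrightarrow> (\<lambda>i. \<integral>x. monomial l x \<partial>P i) \<longlonglongrightarrow> (\<integral>x. monomial l x \<partial>m)"
  shows "limitin (weak_star K) P m sequentially"
proof (rule weak_star_limitI [OF m P])
  fix F :: "'a \<Rightarrow> real" assume "continuous_map K euclideanreal F"
  from K \<F> this show "(\<lambda>i. \<integral>x. F x \<partial>P i) \<longlonglongrightarrow> (\<integral>x. F x \<partial>m)"
  proof (induction rule: continuous_map_monomial_induct)
    case (monomial l)
    then show ?case by (rule conv)
  next
    case (scale c f)
    then show ?case by (simp add: tendsto_mult_left)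
  next
    case (add f g)
    have "(\<lambda>i. (\<integral>x. f x \<partial>P i) + (\<integral>x. g x \<partial>P i)) \<longlonglongrightarrow> (\<integral>x. f x \<partial>m) + (\<integral>x. g x \<partial>m)"
      by (intro tendsto_add add)
    moreover have "(\<integral>x. f x \<partial>m) + (\<integral>x. g x \<partial>m) = (\<integral>x. f x + g x \<partial>m)"
      using continuous_integrable [OF K m] add by simp
    moreover have "\<forall>\<^sub>F i in sequentially. (\<integral>x. f x \<partial>P i) + (\<integral>x. g x \<partial>P i) = (\<integral>x. f x + g x \<partial>P i)"
      using P by eventually_elim (use continuous_integrable [OF K] add in simp)
    ultimately show ?case
      using tendsto_cong by force
  next
    case (lim f)
    then show ?case by (intro uniform_limit_integral_tendsto [OF K m P]) auto
  qed
qed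

section \<open>Averages\<close>

definition average :: "'v set \<Rightarrow> ('v \<Rightarrow> real) \<Rightarrow> real" where
  "average W u = (\<Sum>v\<in>W. u v) / real (card W)"

lemma average_mono: "(\<And>v. v \<in> W \<Longrightarrow> f v \<le> g v) \<Longrightarrow> average W f \<le> average W g"
  unfolding average_def by (intro divide_right_mono sum_mono) auto

lemma average_cong: "(\<And>v. v \<in> W \<Longrightarrow> f v = g v) \<Longrightarrow> average W f = average W g"
  unfolding average_def by simp

lemma average_nonneg: "(\<And>v. v \<in> W \<Longrightarrow> 0 \<le> f v) \<Longrightarrow> 0 \<le> average W f"
  unfolding average_def by (intro divide_nonneg_nonneg sum_nonneg) auto

lemma average_add: "average W (\<lambda>v. f v + g v) = average W f + average W g"
  unfolding average_def by (simp add: sum.distrib add_divide_distrib)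

lemma average_diff: "average W (\<lambda>v. f v - g v) = average W f - average W g"
  unfolding average_def by (simp add: sum_subtractf diff_divide_distrib)

lemma average_cmult: "average W (\<lambda>v. c * f v) = c * average W f"
  unfolding average_def by (simp flip: sum_distrib_left)

lemma average_sum: "average W (\<lambda>v. \<Sum>j\<in>J. f j v) = (\<Sum>j\<in>J. average W (f j))"
  unfolding average_def by (simp add: sum.swap [of _ J] sum_divide_distrib)

lemma average_const: "finite W \<Longrightarrow> W \<noteq> {} \<Longrightarrow> average W (\<lambda>_. c) = c"
  unfolding average_def by simp

lemma average_const_le: "0 \<le> c \<Longrightarrow> average W (\<lambda>_. c) \<le> c"
  unfolding average_def by (cases "card W = 0") auto

lemma average_abs: "\<bar>average W f\<bar> \<le> average W (\<lambda>v. \<bar>f v\<bar>)"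
  unfolding average_def by (simp add: abs_divide divide_right_mono sum_abs)

lemma average_permutes: "s permutes W \<Longrightarrow> average W (\<lambda>v. f (s v)) = average W f"
  unfolding average_def using sum.permute [of s W f] by (simp add: comp_def)

lemma average_indicator_le:
  assumes "finite W" "\<And>v. v \<in> W \<Longrightarrow> v \<notin> S \<Longrightarrow> f v = 0" "\<And>v. v \<in> W \<Longrightarrow> f v \<le> c"
  shows "average W f \<le> c * (real (card {v\<in>W. v \<in> S}) / real (card W))"
proof -
  have "(\<Sum>v\<in>W. f v) = (\<Sum>v\<in>{v\<in>W. v \<in> S}. f v)"
    using assms(1,2) by (intro sum.mono_neutral_right) auto
  also have "\<dots> \<le> (\<Sum>v\<in>{v\<in>W. v \<in> S}. c)"
    using assms(3) by (intro sum_mono) auto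
  finally show ?thesis
    unfolding average_def by (simp add: divide_right_mono mult.commute)
qed

section \<open>Choosing a diagonal sequence\<close>

text \<open>At stage \<open>i\<close> satisfy as many of the first \<open>i\<close> requirements, in an enumeration of \<open>J\<close>, as can be
  satisfied together; this number tends to infinity.\<close>

lemma diagonal_choice:
  assumes J: "countable J" and S: "\<And>i. S i \<noteq> {}"
    and fin: "\<And>F. finite F \<Longrightarrow> F \<subseteq> J \<Longrightarrow> \<forall>\<^sub>F i in sequentially. \<exists>x\<in>S i. \<forall>j\<in>F. Q j i x"
  obtains x where "\<And>i. x i \<in> S i" "\<And>j. j \<in> J \<Longrightarrow> \<forall>\<^sub>F i in sequentially. Q j i (x i)"
proof (cases "J = {}")
  case True
  have "\<forall>i. \<exists>x. x \<in> S i" using S by blast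
  then obtain x where "\<And>i. x i \<in> S i" by metis
  then show ?thesis using that True by blast
next
  case False
  define F where "F k = from_nat_into J ` {..<k}" for k :: nat
  have FJ: "F k \<subseteq> J" "finite (F k)" for k
    using from_nat_into [OF False] by (auto simp: F_def)
  define L where "L i = {k. k \<le> i \<and> (\<exists>x\<in>S i. \<forall>j\<in>F k. Q j i x)}" for i
  have L: "finite (L i)" "0 \<in> L i" for i
    using S [of i] by (auto simp: L_def F_def intro: finite_subset [of _ "{..i}"])
  have "Max (L i) \<in> L i" for i
    using L by (intro Max_in) auto
  then have "\<forall>i. \<exists>x. x \<in> S i \<and> (\<forall>j\<in>F (Max (L i)). Q j i x)"
    by (auto simp: L_def)
  then obtain x where x: "\<And>i. x i \<in> S i" "\<And>i j. j \<in> F (Max (L i)) \<Longrightarrow> Q j i (x i)"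
    by metis
  show ?thesis
  proof (rule that [OF x(1)])
    fix j assume "j \<in> J"
    then obtain n where n: "from_nat_into J n = j"
      using from_nat_into_surj [OF J] by blast
    have "\<forall>\<^sub>F i in sequentially. \<exists>x\<in>S i. \<forall>j\<in>F (Suc n). Q j i x"
      using FJ by (intro fin) auto
    moreover have "\<forall>\<^sub>F i in sequentially. Suc n \<le> i"
      by (rule eventually_ge_at_top)
    ultimately show "\<forall>\<^sub>F i in sequentially. Q j i (x i)"
    proof eventually_elim
      case (elim i)
      then have "Suc n \<in> L i" by (auto simp: L_def)
      then have "Suc n \<le> Max (L i)" using L by (intro Max_ge) auto
      then have "j \<in> F (Max (L i))" using n by (auto simp: F_def)
      then show ?case by (rule x(2))
    qed
  qed
qed

section \<open>Measurable functions followed along a sequence of models\<close>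

text \<open>The infimum changes by at most \<open>\<Sum>j\<in>J. \<bar>g j y - g j x\<bar>\<close> from \<open>x\<close> to \<open>y\<close>.\<close>

lemma continuous_INF_distance:
  fixes A :: "'a set" and q :: "'j \<Rightarrow> 'a \<Rightarrow> real" and g :: "'j \<Rightarrow> 'k \<Rightarrow> real"
  assumes "A \<noteq> {}" and g: "\<And>j. j \<in> J \<Longrightarrow> continuous_map K euclideanreal (g j)"
  shows "continuous_map K euclideanreal (\<lambda>x. INF a\<in>A. \<Sum>j\<in>J. \<bar>q j a - g j x\<bar>)"
proof -
  define D where "D x = (INF a\<in>A. \<Sum>j\<in>J. \<bar>q j a - g j x\<bar>)" for x
  have bdd: "bdd_below ((\<lambda>a. \<Sum>j\<in>J. \<bar>q j a - g j x\<bar>) ` A)" for x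
    by (intro bdd_belowI [of _ 0]) (auto intro: sum_nonneg)
  have le: "D x \<le> D y + (\<Sum>j\<in>J. \<bar>g j y - g j x\<bar>)" for x y
  proof -
    have "D x - (\<Sum>j\<in>J. \<bar>g j y - g j x\<bar>) \<le> (\<Sum>j\<in>J. \<bar>q j a - g j y\<bar>)" if "a \<in> A" for a
    proof -
      have "D x \<le> (\<Sum>j\<in>J. \<bar>q j a - g j x\<bar>)"
        unfolding D_def using bdd that by (rule cINF_lower)
      also have "\<dots> \<le> (\<Sum>j\<in>J. \<bar>q j a - g j y\<bar> + \<bar>g j y - g j x\<bar>)"
        by (intro sum_mono) linarith
      finally show ?thesis by (simp add: sum.distrib)
    qed
    then have "D x - (\<Sum>j\<in>J. \<bar>g j y - g j x\<bar>) \<le> D y"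
      unfolding D_def [of y] using assms(1) by (intro cINF_greatest)
    then show ?thesis by simp
  qed
  have "continuous_map K euclideanreal D"
    unfolding continuous_map_atin
  proof
    fix x assume x: "x \<in> topspace K"
    have "((\<lambda>y. \<Sum>j\<in>J. \<bar>g j y - g j x\<bar>) \<longlongrightarrow> (\<Sum>j\<in>J. \<bar>g j x - g j x\<bar>)) (atin K x)"
      using g x by (intro tendsto_sum tendsto_rabs tendsto_diff tendsto_const)
        (auto simp: continuous_map_atin)
    then have "((\<lambda>y. \<Sum>j\<in>J. \<bar>g j y - g j x\<bar>) \<longlongrightarrow> 0) (atin K x)" by simp
    moreover have "\<bar>D y - D x\<bar> \<le> (\<Sum>j\<in>J. \<bar>g j y - g j x\<bar>)" for y
      using le [of x y] le [of y x] by (simp add: abs_minus_commute abs_le_iff)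
    ultimately have "((\<lambda>y. D y - D x) \<longlongrightarrow> 0) (atin K x)"
      by (intro Lim_null_comparison [of "\<lambda>y. D y - D x"]) auto
    then show "limitin euclideanreal D (D x) (atin K x)"
      by (simp add: LIM_zero_iff)
  qed
  then show ?thesis by (simp add: D_def [abs_def])
qed

text \<open>Points \<open>p i v\<close>, indexed by \<open>v \<in> W i\<close>, whose uniform distributions converge weak* to \<open>\<rho>\<close>. The
  case that matters is \<open>p i v = \<Pi>\<^sub>v w\<^sub>i\<close> for models \<open>w\<^sub>i\<close> of a process.\<close>

locale equidistributed =
  fixes K :: "'k topology" and \<rho> :: "'k measure" and W :: "nat \<Rightarrow> 'v set" and p :: "nat \<Rightarrow> 'v \<Rightarrow> 'k"
  assumes compact_metrizable_K: "compact_metrizable K"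
    and \<rho>: "\<rho> \<in> Prob K"
    and p: "\<And>i v. v \<in> W i \<Longrightarrow> p i v \<in> topspace K"
    and equidistributed: "\<And>f. continuous_map K euclideanreal f \<Longrightarrow>
      (\<lambda>i. average (W i) (\<lambda>v. f (p i v))) \<longlonglongrightarrow> (\<integral>x. f x \<partial>\<rho>)"
begin

lemma compact_K: "compact_space K" using compact_metrizable_K by simp

lemma integrable_continuous: "continuous_map K euclideanreal f \<Longrightarrow> integrable \<rho> f"
  by (rule continuous_integrable [OF compact_K \<rho>])

lemma integrable_bounded:
  assumes "U \<in> borel_measurable \<rho>" "\<And>x. x \<in> topspace K \<Longrightarrow> \<bar>U x\<bar> \<le> (B :: real)"
  shows "integrable \<rho> U"
proof -
  interpret prob_space \<rho> using \<rho> by (rule Prob_prob_space)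
  show ?thesis
    using assms Prob_space [OF \<rho>] by (intro integrable_const_bound [of _ B]) auto
qed

text \<open>A measurable function \<open>U\<close> cannot be evaluated at the points \<open>p i v\<close>, which may form a null set
  for \<open>\<rho>\<close>. Its values there are replaced by numbers \<open>u i v\<close> that are close on average to those of
  continuous functions close to \<open>U\<close> in \<open>L\<^sup>1\<close>. The common bound makes products behave.\<close>

definition tracks :: "(nat \<Rightarrow> 'v \<Rightarrow> real) \<Rightarrow> ('k \<Rightarrow> real) \<Rightarrow> bool" where
  "tracks u U \<longleftrightarrow> U \<in> borel_measurable \<rho> \<and>
     (\<exists>B. (\<forall>i. \<forall>v\<in>W i. \<bar>u i v\<bar> \<le> B) \<and> (\<forall>x\<in>topspace K. \<bar>U x\<bar> \<le> B)) \<and>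
     (\<forall>\<epsilon>>0. \<exists>f. continuous_map K euclideanreal f \<and> (\<integral>x. \<bar>U x - f x\<bar> \<partial>\<rho>) < \<epsilon> \<and>
        (\<forall>\<^sub>F i in sequentially. average (W i) (\<lambda>v. \<bar>u i v - f (p i v)\<bar>) < \<epsilon>))"

lemma tracks_continuous:
  assumes "continuous_map K euclideanreal f"
  shows "tracks (\<lambda>i v. f (p i v)) f"
proof -
  obtain B where "\<And>x. x \<in> topspace K \<Longrightarrow> \<bar>f x\<bar> \<le> B"
    using continuous_on_compact_bounded [OF compact_K assms] by blast
  then have "\<exists>B. (\<forall>i. \<forall>v\<in>W i. \<bar>f (p i v)\<bar> \<le> B) \<and> (\<forall>x\<in>topspace K. \<bar>f x\<bar> \<le> B)"
    using p by blast
  moreover have "f \<in> borel_measurable \<rho>"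
    using continuous_map_borel_measurable [OF assms] measurable_Prob_dom [OF \<rho>] by blast
  ultimately show ?thesis
    unfolding tracks_def using assms
    by (auto intro!: exI [of _ f] simp: average_def)
qed

lemma tracks_cong:
  assumes "tracks u U" "\<And>i v. v \<in> W i \<Longrightarrow> u i v = u' i v" "AE x in \<rho>. U x = U' x"
    "U' \<in> borel_measurable \<rho>" "\<And>x. x \<in> topspace K \<Longrightarrow> \<bar>U' x\<bar> \<le> B'"
  shows "tracks u' U'"
proof -
  obtain B where B: "\<And>i v. v \<in> W i \<Longrightarrow> \<bar>u i v\<bar> \<le> B"
    and U: "U \<in> borel_measurable \<rho>"
    using assms(1) unfolding tracks_def by blast
  have bnd: "\<exists>B. (\<forall>i. \<forall>v\<in>W i. \<bar>u' i v\<bar> \<le> B) \<and> (\<forall>x\<in>topspace K. \<bar>U' x\<bar> \<le> B)"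
  proof (intro exI [of _ "max B B'"] conjI allI ballI)
    fix i v assume "v \<in> W i"
    then show "\<bar>u' i v\<bar> \<le> max B B'" using B [of v i] assms(2) [of v i] by simp
  next
    fix x assume "x \<in> topspace K"
    then show "\<bar>U' x\<bar> \<le> max B B'" using assms(5) [of x] by simp
  qed
  have int: "(\<integral>x. \<bar>U' x - f x\<bar> \<partial>\<rho>) = (\<integral>x. \<bar>U x - f x\<bar> \<partial>\<rho>)" if "continuous_map K euclideanreal f" for f
  proof (rule integral_cong_AE)
    have f: "f \<in> borel_measurable \<rho>" using integrable_continuous [OF that] by auto
    show "(\<lambda>x. \<bar>U' x - f x\<bar>) \<in> borel_measurable \<rho>" "(\<lambda>x. \<bar>U x - f x\<bar>) \<in> borel_measurable \<rho>"
      using f U assms(4) by auto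
    show "AE x in \<rho>. \<bar>U' x - f x\<bar> = \<bar>U x - f x\<bar>"
      using assms(3) by eventually_elim simp
  qed
  have av: "average (W i) (\<lambda>v. \<bar>u' i v - f (p i v)\<bar>) = average (W i) (\<lambda>v. \<bar>u i v - f (p i v)\<bar>)" for i and f :: "'k \<Rightarrow> real"
    using assms(2) by (intro average_cong) simp
  show ?thesis
    unfolding tracks_def
  proof (intro conjI allI impI)
    fix \<epsilon> :: real assume "\<epsilon> > 0"
    then obtain f where f: "continuous_map K euclideanreal f" "(\<integral>x. \<bar>U x - f x\<bar> \<partial>\<rho>) < \<epsilon>"
        "\<forall>\<^sub>F i in sequentially. average (W i) (\<lambda>v. \<bar>u i v - f (p i v)\<bar>) < \<epsilon>"
      using assms(1) unfolding tracks_def by blast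
    then show "\<exists>f. continuous_map K euclideanreal f \<and> (\<integral>x. \<bar>U' x - f x\<bar> \<partial>\<rho>) < \<epsilon> \<and>
        (\<forall>\<^sub>F i in sequentially. average (W i) (\<lambda>v. \<bar>u' i v - f (p i v)\<bar>) < \<epsilon>)"
      by (intro exI [of _ f]) (simp add: int av)
  qed (rule assms(4), rule bnd)
qed

text \<open>\<open>UV - fg = U (V - g) + g (U - f)\<close>: the approximation \<open>g\<close> of \<open>V\<close> is chosen first, and \<open>f\<close> afterwards
  with a precision that depends on the bound of \<open>g\<close>.\<close>

lemma tracks_mult:
  assumes "tracks u U" "tracks v V"
  shows "tracks (\<lambda>i x. u i x * v i x) (\<lambda>x. U x * V x)"
proof -
  obtain B where B: "\<And>i v. v \<in> W i \<Longrightarrow> \<bar>u i v\<bar> \<le> B" "\<And>x. x \<in> topspace K \<Longrightarrow> \<bar>U x\<bar> \<le> B"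
    and U: "U \<in> borel_measurable \<rho>" using assms(1) unfolding tracks_def by blast
  obtain C where C: "\<And>i w. w \<in> W i \<Longrightarrow> \<bar>v i w\<bar> \<le> C" "\<And>x. x \<in> topspace K \<Longrightarrow> \<bar>V x\<bar> \<le> C"
    and V: "V \<in> borel_measurable \<rho>" using assms(2) unfolding tracks_def by blast
  have bnd: "\<bar>a * b\<bar> \<le> \<bar>B\<bar> * \<bar>C\<bar>" if "\<bar>a\<bar> \<le> B" "\<bar>b\<bar> \<le> C" for a b :: real
    unfolding abs_mult using that by (intro mult_mono) auto
  show ?thesis
    unfolding tracks_def
  proof (intro conjI allI impI exI [of _ "\<bar>B\<bar> * \<bar>C\<bar>"] ballI)
    show "(\<lambda>x. U x * V x) \<in> borel_measurable \<rho>" using U V by simp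
    show "\<bar>u i w * v i w\<bar> \<le> \<bar>B\<bar> * \<bar>C\<bar>" if "w \<in> W i" for i w
      using B(1) C(1) that by (intro bnd) auto
    show "\<bar>U x * V x\<bar> \<le> \<bar>B\<bar> * \<bar>C\<bar>" if "x \<in> topspace K" for x
      using B(2) C(2) that by (intro bnd) auto
    fix \<epsilon> :: real assume "\<epsilon> > 0"
    define \<delta> where "\<delta> = \<epsilon> / (2 * (\<bar>B\<bar> + 1))"
    have "\<delta> > 0" using \<open>\<epsilon> > 0\<close> by (simp add: \<delta>_def)
    then obtain g where g: "continuous_map K euclideanreal g" "(\<integral>x. \<bar>V x - g x\<bar> \<partial>\<rho>) < \<delta>"
        "\<forall>\<^sub>F i in sequentially. average (W i) (\<lambda>w. \<bar>v i w - g (p i w)\<bar>) < \<delta>"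
      using assms(2) unfolding tracks_def by blast
    obtain D where D: "D > 0" "\<And>x. x \<in> topspace K \<Longrightarrow> \<bar>g x\<bar> \<le> D"
      using continuous_on_compact_bounded [OF compact_K g(1)] by blast
    define \<eta> where "\<eta> = \<epsilon> / (2 * D)"
    have "\<eta> > 0" using \<open>\<epsilon> > 0\<close> D(1) by (simp add: \<eta>_def)
    then obtain f where f: "continuous_map K euclideanreal f" "(\<integral>x. \<bar>U x - f x\<bar> \<partial>\<rho>) < \<eta>"
        "\<forall>\<^sub>F i in sequentially. average (W i) (\<lambda>w. \<bar>u i w - f (p i w)\<bar>) < \<eta>"
      using assms(1) unfolding tracks_def by blast
    have key: "\<bar>a * b - a' * b'\<bar> \<le> (\<bar>B\<bar> + 1) * \<bar>b - b'\<bar> + D * \<bar>a - a'\<bar>" if "\<bar>a\<bar> \<le> B" "\<bar>b'\<bar> \<le> D" for a b a' b' :: real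
    proof -
      have "a * b - a' * b' = a * (b - b') + b' * (a - a')" by algebra
      then have "\<bar>a * b - a' * b'\<bar> \<le> \<bar>a\<bar> * \<bar>b - b'\<bar> + \<bar>b'\<bar> * \<bar>a - a'\<bar>"
        by (metis abs_mult abs_triangle_ineq)
      also have "\<dots> \<le> (\<bar>B\<bar> + 1) * \<bar>b - b'\<bar> + D * \<bar>a - a'\<bar>"
        using that by (intro add_mono mult_right_mono) auto
      finally show ?thesis .
    qed
    have tot: "(\<bar>B\<bar> + 1) * a + D * b < \<epsilon>" if "a < \<delta>" "b < \<eta>" for a b
    proof -
      have "(\<bar>B\<bar> + 1) * a < (\<bar>B\<bar> + 1) * \<delta>" using that by (intro mult_strict_left_mono) auto
      moreover have "D * b < D * \<eta>" using that D(1) by (intro mult_strict_left_mono) auto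
      moreover have "(\<bar>B\<bar> + 1) * \<delta> = \<epsilon> / 2"
      proof -
        have "c * (\<epsilon> / (2 * c)) = \<epsilon> / 2" if "c \<noteq> 0" for c using that by simp
        moreover have "\<bar>B\<bar> + 1 \<noteq> 0" by linarith
        ultimately show ?thesis unfolding \<delta>_def .
      qed
      moreover have "D * \<eta> = \<epsilon> / 2" using D(1) unfolding \<eta>_def by simp
      ultimately show ?thesis by linarith
    qed
    have I: "integrable \<rho> U" "integrable \<rho> V" "integrable \<rho> f" "integrable \<rho> g"
      using integrable_bounded [OF U B(2)] integrable_bounded [OF V C(2)]
        integrable_continuous f(1) g(1) by auto
    have fg: "continuous_map K euclideanreal (\<lambda>x. f x * g x)"
      using f(1) g(1) by (rule continuous_map_real_mult)
    have UV: "integrable \<rho> (\<lambda>x. U x * V x)"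
    proof (rule integrable_bounded)
      show "(\<lambda>x. U x * V x) \<in> borel_measurable \<rho>" using U V by simp
      show "\<bar>U x * V x\<bar> \<le> \<bar>B\<bar> * \<bar>C\<bar>" if "x \<in> topspace K" for x
        by (rule bnd [OF B(2) [OF that] C(2) [OF that]])
    qed
    have "(\<integral>x. \<bar>U x * V x - f x * g x\<bar> \<partial>\<rho>) \<le> (\<integral>x. (\<bar>B\<bar> + 1) * \<bar>V x - g x\<bar> + D * \<bar>U x - f x\<bar> \<partial>\<rho>)"
    proof (rule integral_mono)
      show "integrable \<rho> (\<lambda>x. \<bar>U x * V x - f x * g x\<bar>)"
        using UV integrable_continuous [OF fg] by auto
      show "integrable \<rho> (\<lambda>x. (\<bar>B\<bar> + 1) * \<bar>V x - g x\<bar> + D * \<bar>U x - f x\<bar>)"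
        using I by auto
      show "\<bar>U x * V x - f x * g x\<bar> \<le> (\<bar>B\<bar> + 1) * \<bar>V x - g x\<bar> + D * \<bar>U x - f x\<bar>" if "x \<in> space \<rho>" for x
        using that Prob_space [OF \<rho>] B(2) D(2) by (intro key) auto
    qed
    also have "\<dots> = (\<bar>B\<bar> + 1) * (\<integral>x. \<bar>V x - g x\<bar> \<partial>\<rho>) + D * (\<integral>x. \<bar>U x - f x\<bar> \<partial>\<rho>)"
      using I by simp
    also have "\<dots> < \<epsilon>" using f(2) g(2) by (intro tot)
    finally have 1: "(\<integral>x. \<bar>U x * V x - f x * g x\<bar> \<partial>\<rho>) < \<epsilon>" .
    have 2: "\<forall>\<^sub>F i in sequentially. average (W i) (\<lambda>w. \<bar>u i w * v i w - f (p i w) * g (p i w)\<bar>) < \<epsilon>"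
      using f(3) g(3)
    proof eventually_elim
      case (elim i)
      have "average (W i) (\<lambda>w. \<bar>u i w * v i w - f (p i w) * g (p i w)\<bar>)
        \<le> average (W i) (\<lambda>w. (\<bar>B\<bar> + 1) * \<bar>v i w - g (p i w)\<bar> + D * \<bar>u i w - f (p i w)\<bar>)"
        using B(1) D(2) p by (intro average_mono key) auto
      also have "\<dots> = (\<bar>B\<bar> + 1) * average (W i) (\<lambda>w. \<bar>v i w - g (p i w)\<bar>)
          + D * average (W i) (\<lambda>w. \<bar>u i w - f (p i w)\<bar>)"
        by (simp only: average_add average_cmult)
      also have "\<dots> < \<epsilon>" using elim by (intro tot)
      finally show ?case .
    qed
    from fg 1 2 show "\<exists>h. continuous_map K euclideanreal h \<and> (\<integral>x. \<bar>U x * V x - h x\<bar> \<partial>\<rho>) < \<epsilon> \<and>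
        (\<forall>\<^sub>F i in sequentially. average (W i) (\<lambda>w. \<bar>u i w * v i w - h (p i w)\<bar>) < \<epsilon>)"
      by (intro exI [of _ "\<lambda>x. f x * g x"]) simp
  qed
qed

lemma tracks_average_tendsto:
  assumes "tracks u U"
  shows "(\<lambda>i. average (W i) (u i)) \<longlonglongrightarrow> (\<integral>x. U x \<partial>\<rho>)"
proof (rule tendstoI)
  fix \<epsilon> :: real assume "\<epsilon> > 0"
  then have "\<epsilon> / 3 > 0" by simp
  then obtain f where f: "continuous_map K euclideanreal f" "(\<integral>x. \<bar>U x - f x\<bar> \<partial>\<rho>) < \<epsilon> / 3"
      "\<forall>\<^sub>F i in sequentially. average (W i) (\<lambda>v. \<bar>u i v - f (p i v)\<bar>) < \<epsilon> / 3"
    using assms unfolding tracks_def by blast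
  obtain B where B: "\<And>x. x \<in> topspace K \<Longrightarrow> \<bar>U x\<bar> \<le> B" and U: "U \<in> borel_measurable \<rho>"
    using assms unfolding tracks_def by blast
  have "\<bar>(\<integral>x. U x \<partial>\<rho>) - (\<integral>x. f x \<partial>\<rho>)\<bar> = \<bar>\<integral>x. U x - f x \<partial>\<rho>\<bar>"
    using integrable_bounded [OF U B] integrable_continuous [OF f(1)] by simp
  also have "\<dots> \<le> (\<integral>x. \<bar>U x - f x\<bar> \<partial>\<rho>)" by (rule integral_abs_bound)
  finally have 1: "\<bar>(\<integral>x. U x \<partial>\<rho>) - (\<integral>x. f x \<partial>\<rho>)\<bar> < \<epsilon> / 3" using f(2) by linarith
  have "\<forall>\<^sub>F i in sequentially. dist (average (W i) (\<lambda>v. f (p i v))) (\<integral>x. f x \<partial>\<rho>) < \<epsilon> / 3"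
    using \<open>\<epsilon> / 3 > 0\<close> by (intro tendstoD [OF equidistributed] f(1))
  with f(3) show "\<forall>\<^sub>F i in sequentially. dist (average (W i) (u i)) (\<integral>x. U x \<partial>\<rho>) < \<epsilon>"
  proof eventually_elim
    case (elim i)
    have "\<bar>average (W i) (u i) - average (W i) (\<lambda>v. f (p i v))\<bar> \<le> average (W i) (\<lambda>v. \<bar>u i v - f (p i v)\<bar>)"
      unfolding average_diff [symmetric] by (rule average_abs)
    then show ?case using elim 1 unfolding dist_real_def by linarith
  qed
qed

end

context equidistributed begin

text \<open>A measurable map \<open>\<theta>\<close> into \<open>A\<close> is followed by points of \<open>A\<close>. For finitely many \<open>q\<close> in the
  family take continuous \<open>g q\<close> close to \<open>q \<circ> \<theta>\<close> in \<open>L\<^sup>1\<close>, and let \<open>a i v\<close> almost minimize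
  \<open>\<Sum>q. \<bar>q a - g q (p i v)\<bar>\<close> over \<open>a \<in> A\<close>. The minimum is a continuous function \<open>D\<close> of \<open>p i v\<close>, so its
  average over \<open>v\<close> tends to \<open>\<integral>D d\<rho>\<close>, and this is small as \<open>\<theta> x\<close> is itself a candidate. Minimizing over
  \<open>A\<close> makes continuous maps into \<open>A\<close> unnecessary; they would be too few for a disconnected \<open>A\<close>.\<close>

lemma exists_tracking:
  fixes A :: "'a topology"
  assumes \<F>: "countable_separating A \<F>" and A: "compact_space A"
    and \<theta>: "\<theta> \<in> \<rho> \<rightarrow>\<^sub>M borel_of A"
  obtains a where "\<And>i. a i \<in> (\<Pi>\<^sub>E v\<in>W i. topspace A)"
    "\<And>q. q \<in> \<F> \<Longrightarrow> tracks (\<lambda>i v. q (a i v)) (\<lambda>x. q (\<theta> x))"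
proof -
  interpret prob_space \<rho> using \<rho> by (rule Prob_prob_space)
  have \<theta>': "\<theta> x \<in> topspace A" if "x \<in> topspace K" for x
    using measurable_space [OF \<theta>] that Prob_space [OF \<rho>] by simp
  have "topspace K \<noteq> {}" using not_empty Prob_space [OF \<rho>] by simp
  then have ne: "topspace A \<noteq> {}" using \<theta>' by blast
  have cont: "continuous_map A euclideanreal q" if "q \<in> \<F>" for q
    using \<F> that by (simp add: countable_separating_def)
  have meas: "(\<lambda>x. q (\<theta> x)) \<in> borel_measurable \<rho>" if "q \<in> \<F>" for q
    using measurable_compose [OF \<theta> continuous_map_borel_measurable [OF cont [OF that]]] .
  have bnd: "\<exists>B. \<forall>y\<in>topspace A. \<bar>q y\<bar> \<le> B" if "q \<in> \<F>" for q
    by (rule continuous_on_compact_bounded [OF A cont [OF that]]) blast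
  have int: "integrable \<rho> (\<lambda>x. q (\<theta> x))" if q: "q \<in> \<F>" for q
  proof -
    obtain B where "\<forall>y\<in>topspace A. \<bar>q y\<bar> \<le> B" using bnd [OF q] by blast
    with \<theta>' have "\<And>x. x \<in> topspace K \<Longrightarrow> \<bar>q (\<theta> x)\<bar> \<le> B" by blast
    then show ?thesis by (rule integrable_bounded [OF meas [OF q]])
  qed
  have ex: "\<exists>f. continuous_map K euclideanreal f \<and> (\<integral>x. \<bar>q (\<theta> x) - f x\<bar> \<partial>\<rho>) < \<epsilon>" if "q \<in> \<F>" "\<epsilon> > 0" for q and \<epsilon> :: real
    using continuous_dense_in_L1 [OF compact_metrizable_K \<rho> int [OF that(1)] that(2)] by blast
  have "\<forall>q k. \<exists>f. q \<in> \<F> \<longrightarrow> continuous_map K euclideanreal f \<and> (\<integral>x. \<bar>q (\<theta> x) - f x\<bar> \<partial>\<rho>) < 1 / real (Suc k)"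
    using ex by simp
  then obtain f where f: "\<And>q k. q \<in> \<F> \<Longrightarrow> continuous_map K euclideanreal (f q k)"
    "\<And>q k. q \<in> \<F> \<Longrightarrow> (\<integral>x. \<bar>q (\<theta> x) - f q k x\<bar> \<partial>\<rho>) < 1 / real (Suc k)"
    by metis
  define S where "S i = (\<Pi>\<^sub>E v\<in>W i. topspace A)" for i
  define Q where "Q = (\<lambda>(q, k) i (a :: 'v \<Rightarrow> 'a).
    average (W i) (\<lambda>v. \<bar>q (a v) - f q k (p i v)\<bar>) < 2 / real (Suc k))"
  obtain a where a: "\<And>i. a i \<in> S i" "\<And>j. j \<in> \<F> \<times> UNIV \<Longrightarrow> \<forall>\<^sub>F i in sequentially. Q j i (a i)"
  proof (rule diagonal_choice [of "\<F> \<times> (UNIV :: nat set)" S Q])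
    show "countable (\<F> \<times> (UNIV :: nat set))" using \<F> by (simp add: countable_separating_def)
    show "S i \<noteq> {}" for i using ne by (simp add: S_def PiE_eq_empty_iff)
    fix T :: "(('a \<Rightarrow> real) \<times> nat) set" assume T: "finite T" "T \<subseteq> \<F> \<times> UNIV"
    define J where "J = fst ` T"
    have J: "finite J" "J \<subseteq> \<F>" using T by (auto simp: J_def)
    \<comment> \<open>the points have to follow a fixed approximation \<open>f q k\<close> for every \<open>k\<close> in \<open>T\<close>; they are chosen
      to follow a better one, \<open>g q\<close>, of a precision finer than the finest in \<open>T\<close>\<close>
    define m where "m = Max (insert 0 (snd ` T))"
    have m: "snd t \<le> m" if "t \<in> T" for t
      unfolding m_def using T(1) that by (intro Max_ge) auto
    define \<eta> where "\<eta> = 1 / real (Suc m)"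
    define \<delta> where "\<delta> = \<eta> / (card J + 3)"
    have \<delta>: "\<delta> > 0" "(real (card J) + 3) * \<delta> = \<eta>" by (simp_all add: \<delta>_def \<eta>_def)
    have "\<forall>q. \<exists>g. q \<in> \<F> \<longrightarrow> continuous_map K euclideanreal g \<and> (\<integral>x. \<bar>q (\<theta> x) - g x\<bar> \<partial>\<rho>) < \<delta>"
      using ex \<delta>(1) by simp
    then obtain g where g: "\<And>q. q \<in> \<F> \<Longrightarrow> continuous_map K euclideanreal (g q)"
      "\<And>q. q \<in> \<F> \<Longrightarrow> (\<integral>x. \<bar>q (\<theta> x) - g q x\<bar> \<partial>\<rho>) < \<delta>" by metis
    define D where "D x = (INF a\<in>topspace A. \<Sum>q\<in>J. \<bar>q a - g q x\<bar>)" for x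
    have bdd: "bdd_below ((\<lambda>a. \<Sum>q\<in>J. \<bar>q a - g q x\<bar>) ` topspace A)" for x
      by (intro bdd_belowI [of _ 0]) (auto intro: sum_nonneg)
    have D: "continuous_map K euclideanreal D"
      unfolding D_def [abs_def] using ne g(1) J(2) by (intro continuous_INF_distance) auto
    have "(\<integral>x. D x \<partial>\<rho>) \<le> (\<integral>x. (\<Sum>q\<in>J. \<bar>q (\<theta> x) - g q x\<bar>) \<partial>\<rho>)"
    proof (rule integral_mono)
      show "integrable \<rho> (\<lambda>x. \<Sum>q\<in>J. \<bar>q (\<theta> x) - g q x\<bar>)"
        using J(2) int integrable_continuous [OF g(1)]
        by (intro Bochner_Integration.integrable_sum integrable_abs Bochner_Integration.integrable_diff) auto
      fix x assume "x \<in> space \<rho>"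
      then have "\<theta> x \<in> topspace A" using \<theta>' Prob_space [OF \<rho>] by simp
      then show "D x \<le> (\<Sum>q\<in>J. \<bar>q (\<theta> x) - g q x\<bar>)"
        unfolding D_def by (rule cINF_lower [OF bdd])
    qed (rule integrable_continuous [OF D])
    also have "\<dots> = (\<Sum>q\<in>J. \<integral>x. \<bar>q (\<theta> x) - g q x\<bar> \<partial>\<rho>)"
      using J(2) int integrable_continuous [OF g(1)]
      by (intro Bochner_Integration.integral_sum integrable_abs Bochner_Integration.integrable_diff) auto
    also have "\<dots> \<le> (\<Sum>q\<in>J. \<delta>)"
      using g(2) J(2) by (intro sum_mono less_imp_le) auto
    also have "\<dots> < (real (card J) + 1) * \<delta>" using \<delta>(1) by (simp add: distrib_right)
    finally have "\<forall>\<^sub>F i in sequentially. average (W i) (\<lambda>v. D (p i v)) < (real (card J) + 1) * \<delta>"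
      by (intro order_tendstoD(2) [OF equidistributed [OF D]])
    moreover have "\<forall>\<^sub>F i in sequentially. \<forall>t\<in>T.
      average (W i) (\<lambda>v. \<bar>g (fst t) (p i v) - f (fst t) (snd t) (p i v)\<bar>) < \<delta> + 1 / real (Suc (snd t))"
    proof (rule eventually_ball_finite [OF T(1)], rule ballI)
      fix t assume "t \<in> T"
      then have t: "fst t \<in> \<F>" using T(2) by auto
      have c: "continuous_map K euclideanreal (\<lambda>x. \<bar>g (fst t) x - f (fst t) (snd t) x\<bar>)"
        using g(1) f(1) t by (intro continuous_map_real_abs continuous_map_diff) auto
      have "(\<integral>x. \<bar>g (fst t) x - f (fst t) (snd t) x\<bar> \<partial>\<rho>)
          \<le> (\<integral>x. \<bar>g (fst t) x - fst t (\<theta> x)\<bar> \<partial>\<rho>) + (\<integral>x. \<bar>fst t (\<theta> x) - f (fst t) (snd t) x\<bar> \<partial>\<rho>)"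
        by (intro L1_triangle int integrable_continuous g(1) f(1) t)
      also have "\<dots> < \<delta> + 1 / real (Suc (snd t))"
        using g(2) [OF t] f(2) [OF t, of "snd t"] by (intro add_strict_mono) (simp_all add: abs_minus_commute)
      finally show "\<forall>\<^sub>F i in sequentially.
        average (W i) (\<lambda>v. \<bar>g (fst t) (p i v) - f (fst t) (snd t) (p i v)\<bar>) < \<delta> + 1 / real (Suc (snd t))"
        by (intro order_tendstoD(2) [OF equidistributed [OF c]])
    qed
    ultimately show "\<forall>\<^sub>F i in sequentially. \<exists>a\<in>S i. \<forall>j\<in>T. Q j i a"
    proof eventually_elim
      case (elim i)
      have "\<exists>b\<in>topspace A. (\<Sum>q\<in>J. \<bar>q b - g q x\<bar>) < D x + \<delta>" for x
      proof (rule ccontr)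
        assume "\<not> ?thesis"
        then have "D x + \<delta> \<le> (\<Sum>q\<in>J. \<bar>q b - g q x\<bar>)" if "b \<in> topspace A" for b
          using that by force
        then have "D x + \<delta> \<le> (INF b\<in>topspace A. \<Sum>q\<in>J. \<bar>q b - g q x\<bar>)"
          by (rule cINF_greatest [OF ne])
        then have "D x + \<delta> \<le> D x" by (simp add: D_def)
        then show False using \<delta>(1) by simp
      qed
      then have "\<forall>x. \<exists>b. b \<in> topspace A \<and> (\<Sum>q\<in>J. \<bar>q b - g q x\<bar>) < D x + \<delta>"
        by (simp only: Bex_def simp_thms)
      then obtain b where b: "\<And>x. b x \<in> topspace A" "\<And>x. (\<Sum>q\<in>J. \<bar>q (b x) - g q x\<bar>) < D x + \<delta>"
        unfolding choice_iff by auto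
      define a where "a = (\<lambda>v\<in>W i. b (p i v))"
      have "a \<in> S i" using b(1) by (auto simp: S_def a_def)
      moreover have "Q t i a" if t: "t \<in> T" for t
      proof -
        obtain q k where qk: "t = (q, k)" by (cases t)
        have q: "q \<in> J" using t qk by (force simp: J_def)
        have "average (W i) (\<lambda>v. \<bar>q (a v) - f q k (p i v)\<bar>)
          \<le> average (W i) (\<lambda>v. (D (p i v) + \<delta>) + \<bar>g q (p i v) - f q k (p i v)\<bar>)"
        proof (rule average_mono)
          fix v assume v: "v \<in> W i"
          have "\<bar>q (a v) - g q (p i v)\<bar> \<le> (\<Sum>q\<in>J. \<bar>q (a v) - g q (p i v)\<bar>)"
            using q J(1) by (intro member_le_sum) auto
          also have "\<dots> < D (p i v) + \<delta>" using b(2) v by (simp add: a_def)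
          finally show "\<bar>q (a v) - f q k (p i v)\<bar> \<le> (D (p i v) + \<delta>) + \<bar>g q (p i v) - f q k (p i v)\<bar>"
            by linarith
        qed
        also have "\<dots> = average (W i) (\<lambda>v. D (p i v)) + average (W i) (\<lambda>_. \<delta>)
            + average (W i) (\<lambda>v. \<bar>g q (p i v) - f q k (p i v)\<bar>)"
          by (simp only: average_add)
        also have "\<dots> < (real (card J) + 1) * \<delta> + \<delta> + (\<delta> + 1 / real (Suc k))"
          using elim(1) bspec [OF elim(2) t] average_const_le [of \<delta> "W i"] \<delta>(1) by (simp add: qk)
        also have "\<dots> = (real (card J) + 3) * \<delta> + 1 / real (Suc k)" by (simp add: algebra_simps)
        also have "\<dots> = \<eta> + 1 / real (Suc k)" by (simp only: \<delta>(2))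
        also have "\<dots> \<le> 1 / real (Suc k) + 1 / real (Suc k)"
          using m [OF t] unfolding \<eta>_def by (intro add_right_mono divide_left_mono) (auto simp: qk)
        finally show ?thesis by (simp add: Q_def qk)
      qed
      ultimately show ?case by blast
    qed
  qed blast
  show ?thesis
  proof (rule that)
    show "a i \<in> (\<Pi>\<^sub>E v\<in>W i. topspace A)" for i using a(1) by (simp add: S_def)
    fix q assume q: "q \<in> \<F>"
    obtain B where B: "\<forall>y\<in>topspace A. \<bar>q y\<bar> \<le> B" using bnd [OF q] by blast
    show "tracks (\<lambda>i v. q (a i v)) (\<lambda>x. q (\<theta> x))"
      unfolding tracks_def
    proof (intro conjI allI impI exI [of _ B] ballI)
      show "(\<lambda>x. q (\<theta> x)) \<in> borel_measurable \<rho>" by (rule meas [OF q])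
      show "\<bar>q (a i v)\<bar> \<le> B" if "v \<in> W i" for i v
        using B a(1) [of i] that by (auto simp: S_def)
      show "\<bar>q (\<theta> x)\<bar> \<le> B" if "x \<in> topspace K" for x
        using B \<theta>' [OF that] by blast
      fix \<epsilon> :: real assume "\<epsilon> > 0"
      then obtain k where "inverse (real (Suc k)) < \<epsilon> / 2"
        using reals_Archimedean [of "\<epsilon> / 2"] by auto
      then have k: "2 / real (Suc k) < \<epsilon>" unfolding inverse_eq_divide by linarith
      \<comment> \<open>the diagonal choice achieves \<open>2 / Suc k\<close> for an approximation with error \<open>1 / Suc k\<close>\<close>
      have "1 / real (Suc k) \<le> 2 / real (Suc k)" by (intro divide_right_mono) auto
      then have "(\<integral>x. \<bar>q (\<theta> x) - f q k x\<bar> \<partial>\<rho>) < \<epsilon>" using f(2) [OF q, of k] k by linarith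
      moreover have "\<forall>\<^sub>F i in sequentially. average (W i) (\<lambda>v. \<bar>q (a i v) - f q k (p i v)\<bar>) < 2 / real (Suc k)"
        using a(2) [of "(q, k)"] q by (simp add: Q_def)
      then have "\<forall>\<^sub>F i in sequentially. average (W i) (\<lambda>v. \<bar>q (a i v) - f q k (p i v)\<bar>) < \<epsilon>"
        by (rule eventually_mono) (use k in linarith)
      ultimately show "\<exists>h. continuous_map K euclideanreal h \<and> (\<integral>x. \<bar>q (\<theta> x) - h x\<bar> \<partial>\<rho>) < \<epsilon> \<and>
          (\<forall>\<^sub>F i in sequentially. average (W i) (\<lambda>v. \<bar>q (a i v) - h (p i v)\<bar>) < \<epsilon>)"
        using f(1) [OF q] by (intro exI [of _ "f q k"]) simp
    qed
  qed
qed

end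

section \<open>Model spaces over a sofic approximation\<close>

lemma continuous_map_reindex:
  assumes "\<And>j. j \<in> J \<Longrightarrow> r j \<in> I"
  shows "continuous_map (configs I X) (configs J X) (\<lambda>x. \<lambda>j\<in>J. x (r j))"
proof -
  have "continuous_map (configs I X) X (\<lambda>x. (\<lambda>j\<in>J. x (r j)) j)" if "j \<in> J" for j
    using continuous_map_product_projection [OF assms [OF that], of "\<lambda>_. X"] that by simp
  then show ?thesis
    by (auto simp: continuous_map_componentwise)
qed

lemma continuous_map_configs_map:
  assumes "continuous_map X Y \<phi>"
  shows "continuous_map (configs I X) (configs I Y) (\<lambda>z. \<lambda>i\<in>I. \<phi> (z i))"
proof -
  have "continuous_map (configs I X) Y (\<lambda>z. (\<lambda>i\<in>I. \<phi> (z i)) j)" if "j \<in> I" for j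
    using continuous_map_compose [OF continuous_map_product_projection [OF that, of "\<lambda>_. X"] assms] that
    by (simp add: comp_def)
  then show ?thesis by (auto simp: continuous_map_componentwise)
qed

lemma continuous_map_right_shift:
  assumes "group G" "h \<in> carrier G"
  shows "continuous_map (configs (carrier G) X) (configs (carrier G) X) (right_shift G h)"
  unfolding right_shift_def [abs_def]
  by (rule continuous_map_reindex) (use assms in \<open>simp add: group.is_monoid monoid.m_closed\<close>)

locale sofic_group = group G for G :: "('g, 'm) monoid_scheme" (structure) +
  fixes V :: "nat \<Rightarrow> 'v set" and \<sigma> :: "nat \<Rightarrow> 'g \<Rightarrow> 'v \<Rightarrow> 'v"
  assumes countable_carrier: "countable (carrier G)"
    and sofic: "sofic_approximation G V \<sigma>"
begin

lemma finite_V: "finite (V n)"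
  using sofic by (simp add: sofic_approximation_def)

lemma permutes_V: "g \<in> carrier G \<Longrightarrow> \<sigma> n g permutes V n"
  using sofic by (simp add: sofic_approximation_def)

lemma \<sigma>_in_V: "g \<in> carrier G \<Longrightarrow> v \<in> V n \<Longrightarrow> \<sigma> n g v \<in> V n"
  using permutes_V permutes_in_image by metis

lemma card_V: "filterlim (\<lambda>n. card (V n)) at_top sequentially"
  using sofic by (simp add: sofic_approximation_def)

lemma eventually_nonempty: "\<forall>\<^sub>F n in sequentially. V n \<noteq> {}"
proof -
  have "\<forall>\<^sub>F n in sequentially. card (V n) \<ge> 1"
    using card_V by (simp add: filterlim_at_top)
  then show ?thesis by (rule eventually_mono) auto
qed

lemma complement_fraction_tendsto_0:
  assumes "(\<lambda>n. real (card {v \<in> V n. Q n v}) / real (card (V n))) \<longlonglongrightarrow> 1"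
  shows "(\<lambda>n. real (card {v \<in> V n. \<not> Q n v}) / real (card (V n))) \<longlonglongrightarrow> 0"
proof -
  have "\<forall>\<^sub>F n in sequentially. 1 - real (card {v \<in> V n. Q n v}) / real (card (V n))
      = real (card {v \<in> V n. \<not> Q n v}) / real (card (V n))"
    using eventually_nonempty
  proof eventually_elim
    case (elim n)
    have "card (V n) = card ({v \<in> V n. Q n v} \<union> {v \<in> V n. \<not> Q n v})"
      by (rule arg_cong [of _ _ card]) auto
    also have "\<dots> = card {v \<in> V n. Q n v} + card {v \<in> V n. \<not> Q n v}"
      using finite_V by (intro card_Un_disjoint) auto
    finally have c: "real (card (V n)) = real (card {v \<in> V n. Q n v}) + real (card {v \<in> V n. \<not> Q n v})"
      by simp
    have "real (card (V n)) > 0" using elim finite_V by (simp add: card_gt_0_iff)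
    then have "1 = real (card (V n)) / real (card (V n))" by simp
    also have "\<dots> = real (card {v \<in> V n. Q n v}) / real (card (V n)) + real (card {v \<in> V n. \<not> Q n v}) / real (card (V n))"
      by (subst c) (simp add: add_divide_distrib)
    finally show ?case by linarith
  qed
  moreover have "(\<lambda>n. 1 - real (card {v \<in> V n. Q n v}) / real (card (V n))) \<longlonglongrightarrow> 1 - 1"
    using assms by (intro tendsto_diff tendsto_const)
  ultimately show ?thesis using tendsto_cong by force
qed

lemma nonmultiplicative_fraction_tendsto_0:
  assumes "g \<in> carrier G" "h \<in> carrier G"
  shows "(\<lambda>n. real (card {v \<in> V n. \<sigma> n g (\<sigma> n h v) \<noteq> \<sigma> n (g \<otimes> h) v}) / real (card (V n))) \<longlonglongrightarrow> 0"
  using complement_fraction_tendsto_0 [of "\<lambda>n v. \<sigma> n g (\<sigma> n h v) = \<sigma> n (g \<otimes> h) v"] sofic assms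
  by (simp add: sofic_approximation_def)

lemma nonfree_fraction_tendsto_0:
  assumes "g \<in> carrier G" "h \<in> carrier G" "g \<noteq> h"
  shows "(\<lambda>n. real (card {v \<in> V n. \<sigma> n g v = \<sigma> n h v}) / real (card (V n))) \<longlonglongrightarrow> 0"
  using complement_fraction_tendsto_0 [of "\<lambda>n v. \<sigma> n g v \<noteq> \<sigma> n h v"] sofic assms
  by (simp add: sofic_approximation_def)

text \<open>Model-surjectivity is a statement about all subsequences of \<open>\<Sigma>\<close>. As these are sofic
  approximations again, the later arguments can use the full sequence.\<close>

lemma sofic_group_subseq:
  assumes "strict_mono (r :: nat \<Rightarrow> nat)"
  shows "sofic_group G (\<lambda>i. V (r i)) (\<lambda>i. \<sigma> (r i))"
proof (unfold_locales)
  have r: "filterlim r sequentially sequentially"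
    by (rule filterlim_subseq [OF assms])
  have lim: "((\<lambda>i. f (r i)) \<longlongrightarrow> l) sequentially" if "f \<longlonglongrightarrow> l" for f :: "nat \<Rightarrow> real" and l
    by (rule filterlim_compose [OF that r])
  show "sofic_approximation G (\<lambda>i. V (r i)) (\<lambda>i. \<sigma> (r i))"
    using sofic unfolding sofic_approximation_def
    by (auto intro: lim [where f = "\<lambda>n. real (card _) / real (card (V n))"] lim filterlim_compose [OF card_V r])
qed (rule countable_carrier)

lemma pullback_in_configs:
  "x \<in> topspace (configs (V n) X) \<Longrightarrow> v \<in> V n \<Longrightarrow> pullback G (\<sigma> n) v x \<in> topspace (configs (carrier G) X)"
  using \<sigma>_in_V by (auto simp: pullback_def PiE_iff)

lemma continuous_map_pullback:
  assumes "v \<in> V n"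
  shows "continuous_map (configs (V n) X) (configs (carrier G) X) (pullback G (\<sigma> n) v)"
  unfolding pullback_def [abs_def]
  by (rule continuous_map_reindex) (use \<sigma>_in_V assms in simp)

lemma measurable_pullback_uniform:
  assumes "x \<in> topspace (configs (V n) X)"
  shows "(\<lambda>v. pullback G (\<sigma> n) v x) \<in> uniform_count_measure (V n) \<rightarrow>\<^sub>M borel_of (configs (carrier G) X)"
  using pullback_in_configs [OF assms]
  by (auto simp: measurable_def uniform_count_measure_def space_point_measure sets_point_measure)

lemma empirical_in_Prob:
  assumes "x \<in> topspace (configs (V n) X)" "V n \<noteq> {}"
  shows "empirical G (V n) (\<sigma> n) X x \<in> Prob (configs (carrier G) X)"
  unfolding empirical_def using assms finite_V
  by (intro distr_in_Prob prob_space_uniform_count_measure measurable_pullback_uniform) auto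

lemma integral_empirical:
  assumes "x \<in> topspace (configs (V n) X)" "continuous_map (configs (carrier G) X) euclideanreal f"
  shows "(\<integral>z. f z \<partial>empirical G (V n) (\<sigma> n) X x) = average (V n) (\<lambda>v. f (pullback G (\<sigma> n) v x))"
  unfolding empirical_def average_def
  by (subst integral_distr [OF measurable_pullback_uniform [OF assms(1)] continuous_map_borel_measurable [OF assms(2)]])
    (simp add: integral_uniform_count_measure finite_V)

lemma compact_metrizable_process: "compact_metrizable X \<Longrightarrow> compact_metrizable (configs (carrier G) X)"
  using countable_carrier by (intro compact_metrizable_configs)

lemma compact_metrizable_model: "compact_metrizable X \<Longrightarrow> compact_metrizable (configs (V n) X)"
  using finite_V by (intro compact_metrizable_configs) (auto intro: countable_finite)

lemma models_equidistributed:
  assumes "compact_metrizable X" "\<And>i. w i \<in> topspace (configs (V i) X)"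
    "limitin (weak_star (configs (carrier G) X)) (\<lambda>i. empirical G (V i) (\<sigma> i) X (w i)) \<rho> sequentially"
  shows "equidistributed (configs (carrier G) X) \<rho> V (\<lambda>i v. pullback G (\<sigma> i) v (w i))"
proof
  show "compact_metrizable (configs (carrier G) X)" using assms(1) by (rule compact_metrizable_process)
  show "\<rho> \<in> Prob (configs (carrier G) X)" by (rule weak_star_limitD [OF assms(3)])
  show "pullback G (\<sigma> i) v (w i) \<in> topspace (configs (carrier G) X)" if "v \<in> V i" for i v
    using that assms(2) by (intro pullback_in_configs)
  fix f assume f: "continuous_map (configs (carrier G) X) euclideanreal f"
  show "(\<lambda>i. average (V i) (\<lambda>v. f (pullback G (\<sigma> i) v (w i)))) \<longlonglongrightarrow> (\<integral>x. f x \<partial>\<rho>)"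
    using weak_star_limitD(3) [OF assms(3) f] by (simp add: integral_empirical [OF assms(2) f])
qed

text \<open>For a coordinate \<open>z k\<close> the two sides can differ only where \<open>\<sigma>\<^sup>k (\<sigma>\<^sup>g v) \<noteq> \<sigma>\<^bsup>kg\<^esup> v\<close>, a vanishing
  proportion of \<open>v\<close>. The property passes to monomials, to their span and to uniform limits.\<close>

lemma pullback_almost_equivariant:
  fixes X :: "'x topology"
  assumes X: "compact_metrizable X" and x: "\<And>i. x i \<in> topspace (configs (V i) X)"
    and g: "g \<in> carrier G" and f: "continuous_map (configs (carrier G) X) euclideanreal f"
  shows "(\<lambda>i. average (V i) (\<lambda>v. \<bar>f (pullback G (\<sigma> i) (\<sigma> i g v) (x i))
           - f (right_shift G g (pullback G (\<sigma> i) v (x i)))\<bar>)) \<longlonglongrightarrow> 0"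
proof -
  define K where "K = configs (carrier G) X"
  have K: "compact_space K" using compact_metrizable_process [OF X] by (simp add: K_def)
  define a where "a i v = pullback G (\<sigma> i) (\<sigma> i g v) (x i)" for i v
  define b where "b i v = right_shift G g (pullback G (\<sigma> i) v (x i))" for i v
  have a: "a i v \<in> topspace K" if "v \<in> V i" for i v
    unfolding a_def K_def using x g that by (intro pullback_in_configs \<sigma>_in_V)
  have b: "b i v \<in> topspace K" if "v \<in> V i" for i v
    using continuous_map_right_shift [OF is_group g, of X] pullback_in_configs [OF x that]
    unfolding b_def K_def continuous_map_def by blast
  define P where "P f \<longleftrightarrow> (\<lambda>i. average (V i) (\<lambda>v. \<bar>f (a i v) - f (b i v)\<bar>)) \<longlonglongrightarrow> 0" for f :: "('g \<Rightarrow> 'x) \<Rightarrow> real"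
  have squeeze: "P f" if "\<And>i. average (V i) (\<lambda>v. \<bar>f (a i v) - f (b i v)\<bar>) \<le> c i" "c \<longlonglongrightarrow> 0" for f c
    unfolding P_def
  proof (rule tendsto_sandwich [OF _ _ tendsto_const that(2)])
    show "\<forall>\<^sub>F i in sequentially. 0 \<le> average (V i) (\<lambda>v. \<bar>f (a i v) - f (b i v)\<bar>)"
      by (intro always_eventually allI average_nonneg) auto
  qed (use that(1) in auto)
  obtain \<F> where \<F>: "countable_separating X \<F>"
    using compact_metrizable_countable_separating [OF X] by blast
  define \<G> where "\<G> = coordinate_functions (carrier G) \<F>"
  have \<G>: "countable_separating K \<G>"
    unfolding K_def \<G>_def by (rule countable_separating_configs [OF \<F> countable_carrier])
  have gen: "P h" if h: "h \<in> \<G>" for h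
  proof -
    obtain q k where q: "q \<in> \<F>" and k: "k \<in> carrier G" and hq: "h = (\<lambda>z. q (z k))"
      using h by (auto simp: \<G>_def coordinate_functions_def)
    obtain B where B: "B > 0" "\<And>y. y \<in> topspace X \<Longrightarrow> \<bar>q y\<bar> \<le> B"
      using continuous_on_compact_bounded [of X q] X \<F> q unfolding countable_separating_def by blast
    show ?thesis
    proof (rule squeeze)
      fix i
      show "average (V i) (\<lambda>v. \<bar>h (a i v) - h (b i v)\<bar>)
        \<le> 2 * B * (real (card {v\<in>V i. v \<in> {v \<in> V i. \<sigma> i k (\<sigma> i g v) \<noteq> \<sigma> i (k \<otimes> g) v}}) / real (card (V i)))"
      proof (rule average_indicator_le [OF finite_V])
        fix v assume v: "v \<in> V i"
        have eq: "h (a i v) = q (x i (\<sigma> i k (\<sigma> i g v)))" "h (b i v) = q (x i (\<sigma> i (k \<otimes> g) v))"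
          using k g by (auto simp: hq a_def b_def pullback_def right_shift_def)
        have "x i u \<in> topspace X" if "u \<in> V i" for u
          using x [of i] that by auto
        then have "\<bar>h (a i v)\<bar> \<le> B" "\<bar>h (b i v)\<bar> \<le> B"
          unfolding eq using v k g by (auto intro!: B(2) \<sigma>_in_V)
        then show "\<bar>h (a i v) - h (b i v)\<bar> \<le> 2 * B" by linarith
        show "\<bar>h (a i v) - h (b i v)\<bar> = 0"
          if "v \<notin> {v \<in> V i. \<sigma> i k (\<sigma> i g v) \<noteq> \<sigma> i (k \<otimes> g) v}"
          using that v eq by simp
      qed
      show "(\<lambda>i. 2 * B * (real (card {v\<in>V i. v \<in> {v \<in> V i. \<sigma> i k (\<sigma> i g v) \<noteq> \<sigma> i (k \<otimes> g) v}}) / real (card (V i)))) \<longlonglongrightarrow> 0"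
        using tendsto_mult_left [OF nonmultiplicative_fraction_tendsto_0 [OF k g], of "2 * B"] by simp
    qed
  qed
  from K \<G> have "P f"
  proof (rule continuous_map_monomial_induct)
    show "continuous_map K euclideanreal f" using f by (simp add: K_def)
    show "P (monomial l)" if "l \<in> lists \<G>" for l
      using that
    proof (induction l)
      case Nil
      then show ?case by (simp add: P_def average_def)
    next
      case (Cons h l)
      have hc: "continuous_map K euclideanreal h"
        using \<G> Cons(1) by (simp add: countable_separating_def)
      have lc: "continuous_map K euclideanreal (monomial l)"
        using \<G> Cons(2) by (intro continuous_monomial) (auto simp: countable_separating_def)
      obtain B where B: "\<And>y. y \<in> topspace K \<Longrightarrow> \<bar>h y\<bar> \<le> B"
        using continuous_on_compact_bounded [OF K hc] by blast
      obtain C where C: "\<And>y. y \<in> topspace K \<Longrightarrow> \<bar>monomial l y\<bar> \<le> C"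
        using continuous_on_compact_bounded [OF K lc] by blast
      let ?m = "monomial l"
      show ?case
      proof (rule squeeze)
        fix i
        have "average (V i) (\<lambda>v. \<bar>monomial (h # l) (a i v) - monomial (h # l) (b i v)\<bar>)
          \<le> average (V i) (\<lambda>v. B * \<bar>?m (a i v) - ?m (b i v)\<bar> + C * \<bar>h (a i v) - h (b i v)\<bar>)"
        proof (rule average_mono)
          fix v assume v: "v \<in> V i"
          have "monomial (h # l) (a i v) - monomial (h # l) (b i v)
            = h (a i v) * (?m (a i v) - ?m (b i v)) + ?m (b i v) * (h (a i v) - h (b i v))"
            by (simp add: algebra_simps)
          then have "\<bar>monomial (h # l) (a i v) - monomial (h # l) (b i v)\<bar>
            \<le> \<bar>h (a i v)\<bar> * \<bar>?m (a i v) - ?m (b i v)\<bar> + \<bar>?m (b i v)\<bar> * \<bar>h (a i v) - h (b i v)\<bar>"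
            by (metis abs_mult abs_triangle_ineq)
          also have "\<dots> \<le> B * \<bar>?m (a i v) - ?m (b i v)\<bar> + C * \<bar>h (a i v) - h (b i v)\<bar>"
            using B [OF a [OF v]] C [OF b [OF v]] by (intro add_mono mult_right_mono) auto
          finally show "\<bar>monomial (h # l) (a i v) - monomial (h # l) (b i v)\<bar>
            \<le> B * \<bar>?m (a i v) - ?m (b i v)\<bar> + C * \<bar>h (a i v) - h (b i v)\<bar>" .
        qed
        then show "average (V i) (\<lambda>v. \<bar>monomial (h # l) (a i v) - monomial (h # l) (b i v)\<bar>)
          \<le> B * average (V i) (\<lambda>v. \<bar>?m (a i v) - ?m (b i v)\<bar>) + C * average (V i) (\<lambda>v. \<bar>h (a i v) - h (b i v)\<bar>)"
          by (simp only: average_add average_cmult)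
        have "(\<lambda>i. B * average (V i) (\<lambda>v. \<bar>?m (a i v) - ?m (b i v)\<bar>) + C * average (V i) (\<lambda>v. \<bar>h (a i v) - h (b i v)\<bar>))
          \<longlonglongrightarrow> B * 0 + C * 0"
          using Cons(3) gen [OF Cons(1)] unfolding P_def by (intro tendsto_add tendsto_mult_left)
        then show "(\<lambda>i. B * average (V i) (\<lambda>v. \<bar>?m (a i v) - ?m (b i v)\<bar>) + C * average (V i) (\<lambda>v. \<bar>h (a i v) - h (b i v)\<bar>)) \<longlonglongrightarrow> 0"
          by simp
      qed
    qed
    show "P (\<lambda>x. c * f x)" if "P f" for c f
    proof -
      have "\<bar>c * f (a i v) - c * f (b i v)\<bar> = \<bar>c\<bar> * \<bar>f (a i v) - f (b i v)\<bar>" for i v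
        unfolding abs_mult [symmetric] right_diff_distrib ..
      then show ?thesis
        using that tendsto_mult_left [of _ 0 sequentially "\<bar>c\<bar>"] unfolding P_def by (simp add: average_cmult)
    qed
    show "P (\<lambda>x. f x + h x)" if "P f" "P h" for f h
    proof (rule squeeze)
      show "average (V i) (\<lambda>v. \<bar>f (a i v) + h (a i v) - (f (b i v) + h (b i v))\<bar>)
        \<le> average (V i) (\<lambda>v. \<bar>f (a i v) - f (b i v)\<bar>) + average (V i) (\<lambda>v. \<bar>h (a i v) - h (b i v)\<bar>)" for i
        unfolding average_add [symmetric] by (intro average_mono) linarith
      show "(\<lambda>i. average (V i) (\<lambda>v. \<bar>f (a i v) - f (b i v)\<bar>) + average (V i) (\<lambda>v. \<bar>h (a i v) - h (b i v)\<bar>)) \<longlonglongrightarrow> 0"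
        using tendsto_add [OF that [unfolded P_def]] by simp
    qed
    fix f :: "('g \<Rightarrow> 'x) \<Rightarrow> real"
    assume app: "\<And>\<epsilon>. \<epsilon> > 0 \<Longrightarrow> \<exists>h. continuous_map K euclideanreal h \<and> P h \<and> (\<forall>x\<in>topspace K. \<bar>f x - h x\<bar> < \<epsilon>)"
    show "P f"
      unfolding P_def
    proof (rule tendstoI)
      fix \<epsilon> :: real assume "\<epsilon> > 0"
      then obtain h where h: "P h" "\<forall>x\<in>topspace K. \<bar>f x - h x\<bar> < \<epsilon> / 4"
        using app [of "\<epsilon> / 4"] by auto
      have "\<forall>\<^sub>F i in sequentially. average (V i) (\<lambda>v. \<bar>h (a i v) - h (b i v)\<bar>) < \<epsilon> / 2"
        using h(1) \<open>\<epsilon> > 0\<close> unfolding P_def by (intro order_tendstoD(2)) auto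
      then show "\<forall>\<^sub>F i in sequentially. dist (average (V i) (\<lambda>v. \<bar>f (a i v) - f (b i v)\<bar>)) 0 < \<epsilon>"
      proof eventually_elim
        case (elim i)
        have "average (V i) (\<lambda>v. \<bar>f (a i v) - f (b i v)\<bar>) \<le> average (V i) (\<lambda>v. \<bar>h (a i v) - h (b i v)\<bar> + \<epsilon> / 2)"
        proof (rule average_mono)
          fix v assume v: "v \<in> V i"
          show "\<bar>f (a i v) - f (b i v)\<bar> \<le> \<bar>h (a i v) - h (b i v)\<bar> + \<epsilon> / 2"
            using bspec [OF h(2) a [OF v]] bspec [OF h(2) b [OF v]] by linarith
        qed
        also have "\<dots> \<le> average (V i) (\<lambda>v. \<bar>h (a i v) - h (b i v)\<bar>) + \<epsilon> / 2"
          unfolding average_add using average_const_le [of "\<epsilon> / 2" "V i"] \<open>\<epsilon> > 0\<close> by simp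
        finally show ?case
          using elim average_nonneg [of "V i" "\<lambda>v. \<bar>f (a i v) - f (b i v)\<bar>"] by (simp add: dist_real_def)
      qed
    qed
  qed
  then show ?thesis by (simp add: P_def a_def b_def)
qed

end

section \<open>Processes of pairs\<close>

lemma zip_on_in_configs:
  "x \<in> topspace (configs I X) \<Longrightarrow> y \<in> topspace (configs I Y) \<Longrightarrow>
    zip_on I x y \<in> topspace (configs I (prod_topology X Y))"
  by (auto simp: zip_on_def PiE_iff)

lemma pullback_zip_on:
  assumes "\<And>g. g \<in> carrier G \<Longrightarrow> s g v \<in> W"
  shows "pullback G s v (zip_on W x y) = zip_on (carrier G) (pullback G s v x) (pullback G s v y)"
  using assms by (auto simp: zip_on_def pullback_def fun_eq_iff)

lemma right_shift_zip_on:
  assumes "group G" "h \<in> carrier G"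
  shows "right_shift G h (zip_on (carrier G) x y) = zip_on (carrier G) (right_shift G h x) (right_shift G h y)"
proof -
  interpret group G by fact
  show ?thesis using assms(2) by (auto simp: zip_on_def right_shift_def fun_eq_iff)
qed

lemma monomial_zip_on:
  assumes "l \<in> lists (coordinate_functions I (pair_functions \<F> \<G>))"
  obtains a b where "a \<in> lists (coordinate_functions I \<F>)" "b \<in> lists (coordinate_functions I \<G>)"
    "\<And>x y. monomial l (zip_on I x y) = monomial a x * monomial b y"
proof -
  have "\<exists>a b. a \<in> lists (coordinate_functions I \<F>) \<and> b \<in> lists (coordinate_functions I \<G>) \<and>
    (\<forall>x y. monomial l (zip_on I x y) = monomial a x * monomial b y)"
    using assms
  proof (induction l)
    case Nil
    then show ?case by (intro exI [of _ "[]"]) simp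
  next
    case (Cons h l)
    then obtain a b where ab: "a \<in> lists (coordinate_functions I \<F>)" "b \<in> lists (coordinate_functions I \<G>)"
      "\<And>x y. monomial l (zip_on I x y) = monomial a x * monomial b y" by blast
    from Cons(1) obtain k i where hk: "h = (\<lambda>z. k (z i))" "i \<in> I" "k \<in> pair_functions \<F> \<G>"
      by (auto simp: coordinate_functions_def)
    from hk(3) consider f where "f \<in> \<F>" "k = (\<lambda>z. f (fst z))" | g where "g \<in> \<G>" "k = (\<lambda>z. g (snd z))"
      by (auto simp: pair_functions_def)
    then show ?case
    proof cases
      case 1
      then have "(\<lambda>z. f (z i)) \<in> coordinate_functions I \<F>"
        using hk(2) by (auto simp: coordinate_functions_def intro!: image_eqI [of _ _ "(f, i)"])
      moreover have "h (zip_on I x y) = f (x i)" for x y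
        using 1 hk by (simp add: zip_on_def)
      ultimately show ?thesis
        using ab by (intro exI [of _ "(\<lambda>z. f (z i)) # a"] exI [of _ b]) simp
    next
      case 2
      then have "(\<lambda>z. g (z i)) \<in> coordinate_functions I \<G>"
        using hk(2) by (auto simp: coordinate_functions_def intro!: image_eqI [of _ _ "(g, i)"])
      moreover have "h (zip_on I x y) = g (y i)" for x y
        using 2 hk by (simp add: zip_on_def)
      ultimately show ?thesis
        using ab by (intro exI [of _ a] exI [of _ "(\<lambda>z. g (z i)) # b"]) simp
    qed
  qed
  then show ?thesis using that by blast
qed

lemma coordinate_functions_continuous:
  assumes "countable_separating X \<F>" "countable I" "h \<in> coordinate_functions I \<F>"
  shows "continuous_map (configs I X) euclideanreal h"
  using countable_separating_configs [OF assms(1,2)] assms(3) by (simp add: countable_separating_def)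

lemma measurable_zip_on:
  assumes X: "compact_metrizable X" and Y: "compact_metrizable Y" and I: "countable I"
    and a: "a \<in> M \<rightarrow>\<^sub>M borel_of (configs I X)" and b: "b \<in> M \<rightarrow>\<^sub>M borel_of (configs I Y)"
  shows "(\<lambda>x. zip_on I (a x) (b x)) \<in> M \<rightarrow>\<^sub>M borel_of (configs I (prod_topology X Y))"
proof -
  obtain \<F> where \<F>: "countable_separating X \<F>"
    using compact_metrizable_countable_separating [OF X] by blast
  obtain \<G> where \<G>: "countable_separating Y \<G>"
    using compact_metrizable_countable_separating [OF Y] by blast
  show ?thesis
  proof (rule measurable_borel_ofI_separating)
    show "compact_metrizable (configs I (prod_topology X Y))"
      by (intro compact_metrizable_configs compact_metrizable_prod X Y I)
    show "countable_separating (configs I (prod_topology X Y)) (coordinate_functions I (pair_functions \<F> \<G>))"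
      by (intro countable_separating_configs countable_separating_prod \<F> \<G> I)
    show "(\<lambda>x. zip_on I (a x) (b x)) \<in> space M \<rightarrow> topspace (configs I (prod_topology X Y))"
    proof
      fix x assume "x \<in> space M"
      then show "zip_on I (a x) (b x) \<in> topspace (configs I (prod_topology X Y))"
        using measurable_space [OF a] measurable_space [OF b] unfolding space_borel_of
        by (intro zip_on_in_configs)
    qed
    fix h assume "h \<in> coordinate_functions I (pair_functions \<F> \<G>)"
    then have "[h] \<in> lists (coordinate_functions I (pair_functions \<F> \<G>))" by simp
    then obtain c d where cd: "c \<in> lists (coordinate_functions I \<F>)" "d \<in> lists (coordinate_functions I \<G>)"
      "\<And>x y. monomial [h] (zip_on I x y) = monomial c x * monomial d y"
      by (rule monomial_zip_on) blast
    have "continuous_map (configs I X) euclideanreal (monomial c)"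
      using cd(1) coordinate_functions_continuous [OF \<F> I] by (intro continuous_monomial) auto
    from measurable_compose [OF a continuous_map_borel_measurable [OF this]]
    have c: "(\<lambda>x. monomial c (a x)) \<in> borel_measurable M" .
    have "continuous_map (configs I Y) euclideanreal (monomial d)"
      using cd(2) coordinate_functions_continuous [OF \<G> I] by (intro continuous_monomial) auto
    from measurable_compose [OF b continuous_map_borel_measurable [OF this]]
    have d: "(\<lambda>x. monomial d (b x)) \<in> borel_measurable M" .
    have "h (zip_on I (a x) (b x)) = monomial c (a x) * monomial d (b x)" for x
      using cd(3) [of "a x" "b x"] by simp
    then show "(\<lambda>x. h (zip_on I (a x) (b x))) \<in> borel_measurable M"
      using c d by simp
  qed
qed

lemma integral_pair_product:
  fixes f :: "'a \<Rightarrow> real" and g :: "'b \<Rightarrow> real"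
  assumes "prob_space M" "prob_space N"
    and f: "f \<in> borel_measurable M" "\<And>x. x \<in> space M \<Longrightarrow> \<bar>f x\<bar> \<le> B"
    and g: "g \<in> borel_measurable N" "\<And>x. x \<in> space N \<Longrightarrow> \<bar>g x\<bar> \<le> C"
  shows "integrable (M \<Otimes>\<^sub>M N) (\<lambda>z. f (fst z) * g (snd z))"
    "(\<integral>z. f (fst z) * g (snd z) \<partial>(M \<Otimes>\<^sub>M N)) = (\<integral>x. f x \<partial>M) * (\<integral>y. g y \<partial>N)"
proof -
  interpret M: prob_space M by fact
  interpret N: prob_space N by fact
  interpret pair_prob_space M N ..
  show I: "integrable (M \<Otimes>\<^sub>M N) (\<lambda>z. f (fst z) * g (snd z))"
  proof (rule integrable_const_bound [of _ "\<bar>B\<bar> * \<bar>C\<bar>"])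
    show "AE z in M \<Otimes>\<^sub>M N. norm (f (fst z) * g (snd z)) \<le> \<bar>B\<bar> * \<bar>C\<bar>"
    proof (rule AE_I2)
      fix z assume "z \<in> space (M \<Otimes>\<^sub>M N)"
      then have "fst z \<in> space M" "snd z \<in> space N" by (auto simp: space_pair_measure)
      then have "\<bar>f (fst z)\<bar> \<le> \<bar>B\<bar>" "\<bar>g (snd z)\<bar> \<le> \<bar>C\<bar>" using f(2) g(2) by force+
      then show "norm (f (fst z) * g (snd z)) \<le> \<bar>B\<bar> * \<bar>C\<bar>"
        unfolding real_norm_def abs_mult by (intro mult_mono) auto
    qed
    show "(\<lambda>z. f (fst z) * g (snd z)) \<in> borel_measurable (M \<Otimes>\<^sub>M N)"
      using f(1) g(1) by measurable
  qed
  have "(\<integral>z. f (fst z) * g (snd z) \<partial>(M \<Otimes>\<^sub>M N)) = (\<integral>x. (\<integral>y. f x * g y \<partial>N) \<partial>M)"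
    using integral_fst [of "\<lambda>x y. f x * g y"] I unfolding case_prod_beta' by metis
  also have "\<dots> = (\<integral>x. f x \<partial>M) * (\<integral>y. g y \<partial>N)" by simp
  finally show "(\<integral>z. f (fst z) * g (snd z) \<partial>(M \<Otimes>\<^sub>M N)) = (\<integral>x. f x \<partial>M) * (\<integral>y. g y \<partial>N)" .
qed

lemma measurable_zip_pair:
  assumes X: "compact_metrizable X" and Y: "compact_metrizable Y" and I: "countable I"
    and \<mu>: "\<mu> \<in> Prob (configs I X)" and \<nu>: "\<nu> \<in> Prob (configs I Y)"
  shows "(\<lambda>(x, y). zip_on I x y) \<in> \<mu> \<Otimes>\<^sub>M \<nu> \<rightarrow>\<^sub>M borel_of (configs I (prod_topology X Y))"
proof -
  have "fst \<in> \<mu> \<Otimes>\<^sub>M \<nu> \<rightarrow>\<^sub>M borel_of (configs I X)" "snd \<in> \<mu> \<Otimes>\<^sub>M \<nu> \<rightarrow>\<^sub>M borel_of (configs I Y)"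
    using measurable_fst [of \<mu> \<nu>] measurable_snd [of \<mu> \<nu>]
    by (simp_all add: measurable_Prob_cod [OF \<mu>] measurable_Prob_cod [OF \<nu>])
  from measurable_zip_on [OF X Y I this] show ?thesis
    by (simp add: case_prod_beta')
qed

lemma prod_config_measure_in_Prob:
  assumes "compact_metrizable X" "compact_metrizable Y" "countable I"
    and \<mu>: "\<mu> \<in> Prob (configs I X)" and \<nu>: "\<nu> \<in> Prob (configs I Y)"
  shows "prod_config_measure I X Y \<mu> \<nu> \<in> Prob (configs I (prod_topology X Y))"
proof -
  interpret M: prob_space \<mu> using \<mu> by (rule Prob_prob_space)
  interpret N: prob_space \<nu> using \<nu> by (rule Prob_prob_space)
  interpret pair_prob_space \<mu> \<nu> ..
  show ?thesis
    unfolding prod_config_measure_def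
    by (intro distr_in_Prob measurable_zip_pair assms prob_space_axioms)
qed

lemma integral_prod_config_measure:
  fixes f :: "('i \<Rightarrow> 'x) \<Rightarrow> real" and g :: "('i \<Rightarrow> 'y) \<Rightarrow> real"
  assumes XY: "compact_metrizable X" "compact_metrizable Y" and I: "countable I"
    and \<mu>: "\<mu> \<in> Prob (configs I X)" and \<nu>: "\<nu> \<in> Prob (configs I Y)"
    and F: "F \<in> borel_measurable (borel_of (configs I (prod_topology X Y)))"
      "\<And>x y. x \<in> topspace (configs I X) \<Longrightarrow> y \<in> topspace (configs I Y) \<Longrightarrow> F (zip_on I x y) = f x * g y"
    and f: "continuous_map (configs I X) euclideanreal f"
    and g: "continuous_map (configs I Y) euclideanreal g"
  shows "(\<integral>z. F z \<partial>prod_config_measure I X Y \<mu> \<nu>) = (\<integral>x. f x \<partial>\<mu>) * (\<integral>y. g y \<partial>\<nu>)"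
proof -
  have K: "compact_space (configs I X)" "compact_space (configs I Y)"
    using compact_metrizable_configs XY I by blast+
  obtain B where B: "\<And>x. x \<in> topspace (configs I X) \<Longrightarrow> \<bar>f x\<bar> \<le> B"
    by (rule continuous_on_compact_bounded [OF K(1) f]) blast
  obtain C where C: "\<And>x. x \<in> topspace (configs I Y) \<Longrightarrow> \<bar>g x\<bar> \<le> C"
    by (rule continuous_on_compact_bounded [OF K(2) g]) blast
  have "(\<integral>z. F z \<partial>prod_config_measure I X Y \<mu> \<nu>) = (\<integral>z. F (case z of (x, y) \<Rightarrow> zip_on I x y) \<partial>(\<mu> \<Otimes>\<^sub>M \<nu>))"
    unfolding prod_config_measure_def
    by (rule integral_distr [OF measurable_zip_pair [OF XY I \<mu> \<nu>] F(1)])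
  also have "\<dots> = (\<integral>z. f (fst z) * g (snd z) \<partial>(\<mu> \<Otimes>\<^sub>M \<nu>))"
    using F(2) Prob_space [OF \<mu>] Prob_space [OF \<nu>]
    by (intro Bochner_Integration.integral_cong) (auto simp: space_pair_measure)
  also have "\<dots> = (\<integral>x. f x \<partial>\<mu>) * (\<integral>y. g y \<partial>\<nu>)"
  proof (rule integral_pair_product)
    show "f \<in> borel_measurable \<mu>" "g \<in> borel_measurable \<nu>"
      using continuous_map_borel_measurable f g measurable_Prob_dom [OF \<mu>] measurable_Prob_dom [OF \<nu>] by blast+
    show "\<And>x. x \<in> space \<mu> \<Longrightarrow> \<bar>f x\<bar> \<le> B" "\<And>x. x \<in> space \<nu> \<Longrightarrow> \<bar>g x\<bar> \<le> C"
      using B C Prob_space [OF \<mu>] Prob_space [OF \<nu>] by simp_all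
  qed (use Prob_prob_space \<mu> \<nu> in blast)+
  finally show ?thesis .
qed

section \<open>Lifting models through factor maps\<close>

locale model_sequence = sofic_group G V \<sigma>
  for G :: "('g, 'm) monoid_scheme" (structure) and V :: "nat \<Rightarrow> 'v set"
    and \<sigma> :: "nat \<Rightarrow> 'g \<Rightarrow> 'v \<Rightarrow> 'v" +
  fixes X :: "'x topology" and \<rho> :: "('g \<Rightarrow> 'x) measure" and w :: "nat \<Rightarrow> 'v \<Rightarrow> 'x"
  assumes X: "compact_metrizable X" and w: "\<And>i. w i \<in> topspace (configs (V i) X)"
    and limit: "limitin (weak_star (configs (carrier G) X)) (\<lambda>i. empirical G (V i) (\<sigma> i) X (w i)) \<rho> sequentially"
begin

sublocale equidistributed "configs (carrier G) X" \<rho> V "\<lambda>i v. pullback G (\<sigma> i) v (w i)"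
  by (rule models_equidistributed [OF X w limit])

text \<open>Permuting \<open>v\<close> by \<open>\<sigma>\<^sup>g\<close> preserves averages and shifting preserves \<open>\<rho>\<close>; almost equivariance of
  \<open>v \<mapsto> \<Pi>\<^sub>v w\<^sub>i\<close> connects the two.\<close>

lemma tracks_shift:
  assumes g: "g \<in> carrier G" and inv: "distr \<rho> \<rho> (right_shift G g) = \<rho>" and t: "tracks u U"
  shows "tracks (\<lambda>i v. u i (\<sigma> i g v)) (\<lambda>z. U (right_shift G g z))"
proof -
  let ?K = "configs (carrier G) X"
  have cs: "continuous_map ?K ?K (right_shift G g)"
    using is_group g by (rule continuous_map_right_shift)
  have ms: "right_shift G g \<in> \<rho> \<rightarrow>\<^sub>M \<rho>"
    using continuous_map_measurable_borel_of [OF cs] measurable_Prob_dom [OF \<rho>] measurable_Prob_cod [OF \<rho>] by blast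
  have sK: "right_shift G g z \<in> topspace ?K" if "z \<in> topspace ?K" for z
    using cs that unfolding continuous_map_def by blast
  obtain B where B: "\<And>i v. v \<in> V i \<Longrightarrow> \<bar>u i v\<bar> \<le> B" "\<And>x. x \<in> topspace ?K \<Longrightarrow> \<bar>U x\<bar> \<le> B"
    and U: "U \<in> borel_measurable \<rho>" using t unfolding tracks_def by blast
  show ?thesis
    unfolding tracks_def
  proof (intro conjI allI impI exI [of _ B] ballI)
    show "(\<lambda>z. U (right_shift G g z)) \<in> borel_measurable \<rho>"
      using measurable_compose [OF ms U] .
    show "\<bar>u i (\<sigma> i g v)\<bar> \<le> B" if "v \<in> V i" for i v
      by (intro B(1) \<sigma>_in_V g that)
    show "\<bar>U (right_shift G g z)\<bar> \<le> B" if "z \<in> topspace ?K" for z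
      by (intro B(2) sK that)
    fix \<epsilon> :: real assume "\<epsilon> > 0"
    then have e2: "\<epsilon> / 2 > 0" by simp
    then obtain f where f: "continuous_map ?K euclideanreal f" "(\<integral>x. \<bar>U x - f x\<bar> \<partial>\<rho>) < \<epsilon> / 2"
      "\<forall>\<^sub>F i in sequentially. average (V i) (\<lambda>v. \<bar>u i v - f (pullback G (\<sigma> i) v (w i))\<bar>) < \<epsilon> / 2"
      using t unfolding tracks_def by blast
    have fs: "continuous_map ?K euclideanreal (\<lambda>z. f (right_shift G g z))"
      using continuous_map_compose [OF cs f(1)] by (simp add: comp_def)
    have fm: "f \<in> borel_measurable \<rho>" using integrable_continuous [OF f(1)] by auto
    have "(\<integral>x. \<bar>U x - f x\<bar> \<partial>\<rho>) = (\<integral>x. \<bar>U x - f x\<bar> \<partial>distr \<rho> \<rho> (right_shift G g))"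
      by (simp only: inv)
    also have "\<dots> = (\<integral>x. \<bar>U (right_shift G g x) - f (right_shift G g x)\<bar> \<partial>\<rho>)"
      using U fm by (intro integral_distr ms) simp
    finally have 1: "(\<integral>x. \<bar>U (right_shift G g x) - f (right_shift G g x)\<bar> \<partial>\<rho>) < \<epsilon>"
      using f(2) e2 by linarith
    have "\<forall>\<^sub>F i in sequentially. average (V i) (\<lambda>v. \<bar>f (pullback G (\<sigma> i) (\<sigma> i g v) (w i))
           - f (right_shift G g (pullback G (\<sigma> i) v (w i)))\<bar>) < \<epsilon> / 2"
      by (rule order_tendstoD(2) [OF pullback_almost_equivariant [OF X w g f(1)] e2])
    with f(3) have 2: "\<forall>\<^sub>F i in sequentially.
      average (V i) (\<lambda>v. \<bar>u i (\<sigma> i g v) - f (right_shift G g (pullback G (\<sigma> i) v (w i)))\<bar>) < \<epsilon>"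
    proof eventually_elim
      case (elim i)
      have "average (V i) (\<lambda>v. \<bar>u i (\<sigma> i g v) - f (right_shift G g (pullback G (\<sigma> i) v (w i)))\<bar>)
        \<le> average (V i) (\<lambda>v. \<bar>u i (\<sigma> i g v) - f (pullback G (\<sigma> i) (\<sigma> i g v) (w i))\<bar>
          + \<bar>f (pullback G (\<sigma> i) (\<sigma> i g v) (w i)) - f (right_shift G g (pullback G (\<sigma> i) v (w i)))\<bar>)"
        by (intro average_mono) linarith
      also have "\<dots> = average (V i) (\<lambda>v. \<bar>u i (\<sigma> i g v) - f (pullback G (\<sigma> i) (\<sigma> i g v) (w i))\<bar>)
          + average (V i) (\<lambda>v. \<bar>f (pullback G (\<sigma> i) (\<sigma> i g v) (w i)) - f (right_shift G g (pullback G (\<sigma> i) v (w i)))\<bar>)"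
        by (rule average_add)
      also have "average (V i) (\<lambda>v. \<bar>u i (\<sigma> i g v) - f (pullback G (\<sigma> i) (\<sigma> i g v) (w i))\<bar>)
          = average (V i) (\<lambda>v. \<bar>u i v - f (pullback G (\<sigma> i) v (w i))\<bar>)"
        by (rule average_permutes [OF permutes_V [OF g]])
      finally show ?case using elim by linarith
    qed
    from fs 1 2 show "\<exists>h. continuous_map ?K euclideanreal h \<and> (\<integral>x. \<bar>U (right_shift G g x) - h x\<bar> \<partial>\<rho>) < \<epsilon> \<and>
      (\<forall>\<^sub>F i in sequentially. average (V i) (\<lambda>v. \<bar>u i (\<sigma> i g v) - h (pullback G (\<sigma> i) v (w i))\<bar>) < \<epsilon>)"
      by (intro exI [of _ "\<lambda>z. f (right_shift G g z)"]) simp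
  qed
qed

lemma tracks_monomial:
  assumes "\<And>h. h \<in> set l \<Longrightarrow> tracks (\<lambda>i v. h (a i v)) (\<lambda>z. h (\<theta> z))"
  shows "tracks (\<lambda>i v. monomial l (a i v)) (\<lambda>z. monomial l (\<theta> z))"
  using assms
proof (induction l)
  case Nil
  then show ?case using tracks_continuous [of "\<lambda>_. 1"] by simp
next
  case (Cons h l)
  then show ?case by (simp add: tracks_mult)
qed

text \<open>By equivariance \<open>\<theta>\<close> is determined by its coordinate at \<open>\<one>\<close>. Points \<open>a i v\<close> that follow this
  coordinate will do: then \<open>a i (\<sigma>\<^sup>g v)\<close> follows the coordinate at \<open>g\<close>, and since products can be
  followed as well, all monomials in the coordinates have the right limits.\<close>

lemma factor_map_lifts_models:
  fixes A :: "'a topology"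
  assumes A: "compact_metrizable A"
    and inv: "\<And>g. g \<in> carrier G \<Longrightarrow> distr \<rho> \<rho> (right_shift G g) = \<rho>"
    and \<theta>: "\<theta> \<in> \<rho> \<rightarrow>\<^sub>M borel_of (configs (carrier G) A)"
    and equi: "\<And>g. g \<in> carrier G \<Longrightarrow> AE z in \<rho>. \<theta> (right_shift G g z) = right_shift G g (\<theta> z)"
  obtains a where "\<And>i. a i \<in> topspace (configs (V i) A)"
    "limitin (weak_star (configs (carrier G) (prod_topology A X)))
       (\<lambda>i. empirical G (V i) (\<sigma> i) (prod_topology A X) (zip_on (V i) (a i) (w i)))
       (distr \<rho> (borel_of (configs (carrier G) (prod_topology A X))) (\<lambda>z. zip_on (carrier G) (\<theta> z) z))
       sequentially"
proof -
  let ?K = "configs (carrier G) X" and ?L = "configs (carrier G) (prod_topology A X)"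
  obtain \<F> where \<F>: "countable_separating A \<F>"
    using compact_metrizable_countable_separating [OF A] by blast
  obtain \<G> where \<G>: "countable_separating X \<G>"
    using compact_metrizable_countable_separating [OF X] by blast
  have \<theta>_space: "\<theta> z \<in> topspace (configs (carrier G) A)" if "z \<in> topspace ?K" for z
    using measurable_space [OF \<theta>] that Prob_space [OF \<rho>] by simp
  have coord: "(\<lambda>z. \<theta> z g) \<in> \<rho> \<rightarrow>\<^sub>M borel_of A" if "g \<in> carrier G" for g
    using measurable_compose [OF \<theta> continuous_map_measurable_borel_of
        [OF continuous_map_product_projection [OF that, of "\<lambda>_. A"]]] .
  obtain a where a: "\<And>i. a i \<in> (\<Pi>\<^sub>E v\<in>V i. topspace A)"
    "\<And>q. q \<in> \<F> \<Longrightarrow> tracks (\<lambda>i v. q (a i v)) (\<lambda>z. q (\<theta> z \<one>))"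
    using exists_tracking [OF \<F> _ coord [OF one_closed]] A by blast
  have a': "a i \<in> topspace (configs (V i) A)" for i using a(1) by simp
  have zip: "zip_on (V i) (a i) (w i) \<in> topspace (configs (V i) (prod_topology A X))" for i
    by (rule zip_on_in_configs [OF a' w])
  have A_tracks: "tracks (\<lambda>i v. h (pullback G (\<sigma> i) v (a i))) (\<lambda>z. h (\<theta> z))"
    if h: "h \<in> coordinate_functions (carrier G) \<F>" for h
  proof -
    obtain q g where q: "q \<in> \<F>" and g: "g \<in> carrier G" and hq: "h = (\<lambda>z. q (z g))"
      using h by (auto simp: coordinate_functions_def)
    have qc: "continuous_map A euclideanreal q" using \<F> q by (simp add: countable_separating_def)
    obtain B where B: "\<And>y. y \<in> topspace A \<Longrightarrow> \<bar>q y\<bar> \<le> B"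
      by (rule continuous_on_compact_bounded [OF _ qc]) (use A in blast)+
    show ?thesis
    proof (rule tracks_cong [OF tracks_shift [OF g inv [OF g] a(2) [OF q]]])
      show "q (a i (\<sigma> i g v)) = h (pullback G (\<sigma> i) v (a i))" for i v
        using g by (simp add: hq pullback_def)
      show "AE z in \<rho>. q (\<theta> (right_shift G g z) \<one>) = h (\<theta> z)"
        using equi [OF g] by eventually_elim (use g in \<open>simp add: hq right_shift_def\<close>)
      show "(\<lambda>z. h (\<theta> z)) \<in> borel_measurable \<rho>"
        unfolding hq using measurable_compose [OF coord [OF g] continuous_map_borel_measurable [OF qc]] .
      show "\<bar>h (\<theta> z)\<bar> \<le> B" if "z \<in> topspace ?K" for z
        unfolding hq using \<theta>_space [OF that] g by (intro B) auto
    qed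
  qed
  have tr: "tracks (\<lambda>i v. monomial l (pullback G (\<sigma> i) v (zip_on (V i) (a i) (w i))))
      (\<lambda>z. monomial l (zip_on (carrier G) (\<theta> z) z))"
    if l: "l \<in> lists (coordinate_functions (carrier G) (pair_functions \<F> \<G>))" for l
  proof -
    obtain c d where cd: "c \<in> lists (coordinate_functions (carrier G) \<F>)"
      "d \<in> lists (coordinate_functions (carrier G) \<G>)"
      "\<And>x y. monomial l (zip_on (carrier G) x y) = monomial c x * monomial d y"
      using monomial_zip_on [OF l] by blast
    have "tracks (\<lambda>i v. monomial c (pullback G (\<sigma> i) v (a i))) (\<lambda>z. monomial c (\<theta> z))"
      using cd(1) by (intro tracks_monomial A_tracks) auto
    moreover have "tracks (\<lambda>i v. monomial d (pullback G (\<sigma> i) v (w i))) (\<lambda>z. monomial d z)"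
      using cd(2) coordinate_functions_continuous [OF \<G> countable_carrier]
      by (intro tracks_continuous continuous_monomial) auto
    ultimately have t: "tracks (\<lambda>i v. monomial c (pullback G (\<sigma> i) v (a i)) * monomial d (pullback G (\<sigma> i) v (w i)))
      (\<lambda>z. monomial l (zip_on (carrier G) (\<theta> z) z))"
      unfolding cd(3) by (rule tracks_mult)
    then obtain B where "\<forall>z\<in>topspace ?K. \<bar>monomial l (zip_on (carrier G) (\<theta> z) z)\<bar> \<le> B"
      and "(\<lambda>z. monomial l (zip_on (carrier G) (\<theta> z) z)) \<in> borel_measurable \<rho>"
      unfolding tracks_def by blast
    then show ?thesis
      using \<sigma>_in_V by (intro tracks_cong [OF t, of _ _ B]) (auto simp: pullback_zip_on cd(3))
  qed
  have L: "compact_metrizable ?L"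
    by (intro compact_metrizable_process compact_metrizable_prod A X)
  have sep: "countable_separating ?L (coordinate_functions (carrier G) (pair_functions \<F> \<G>))"
    by (intro countable_separating_configs countable_separating_prod \<F> \<G> countable_carrier)
  have id: "(\<lambda>z. z) \<in> \<rho> \<rightarrow>\<^sub>M borel_of ?K"
    by (rule measurable_ident_sets [OF Prob_sets [OF \<rho>]])
  have zm: "(\<lambda>z. zip_on (carrier G) (\<theta> z) z) \<in> \<rho> \<rightarrow>\<^sub>M borel_of ?L"
    by (rule measurable_zip_on [OF A X countable_carrier \<theta> id])
  show ?thesis
  proof (rule that [OF a' weak_star_limit_monomialsI [OF _ sep]])
    show "compact_space ?L" using L by simp
    show "distr \<rho> (borel_of ?L) (\<lambda>z. zip_on (carrier G) (\<theta> z) z) \<in> Prob ?L"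
      by (intro distr_in_Prob zm Prob_prob_space [OF \<rho>])
    show "\<forall>\<^sub>F i in sequentially. empirical G (V i) (\<sigma> i) (prod_topology A X) (zip_on (V i) (a i) (w i)) \<in> Prob ?L"
      using eventually_nonempty by eventually_elim (rule empirical_in_Prob [OF zip])
    fix l assume l: "l \<in> lists (coordinate_functions (carrier G) (pair_functions \<F> \<G>))"
    have lc: "continuous_map ?L euclideanreal (monomial l)"
      using l sep by (intro continuous_monomial) (auto simp: countable_separating_def)
    show "(\<lambda>i. \<integral>x. monomial l x \<partial>empirical G (V i) (\<sigma> i) (prod_topology A X) (zip_on (V i) (a i) (w i)))
      \<longlonglongrightarrow> (\<integral>x. monomial l x \<partial>distr \<rho> (borel_of ?L) (\<lambda>z. zip_on (carrier G) (\<theta> z) z))"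
      unfolding integral_empirical [OF zip lc] integral_distr [OF zm continuous_map_borel_measurable [OF lc]]
      by (rule tracks_average_tendsto [OF tr [OF l]])
  qed
qed

end

section \<open>Independent models from a second moment bound\<close>

lemma average_multc: "average W (\<lambda>v. f v * c) = average W f * c"
  unfolding average_def by (simp flip: sum_distrib_right)

lemma average_square: "(average W a)\<^sup>2 = average W (\<lambda>v. average W (\<lambda>w. a v * a w))"
  by (simp add: average_cmult average_multc power2_eq_square)

lemma average_square_le: "(average W u)\<^sup>2 \<le> average W (\<lambda>v. (u v)\<^sup>2)"
proof (cases "card W = 0")
  case True
  then show ?thesis by (simp add: average_def)
next
  case False
  have "(\<Sum>v\<in>W. u v)\<^sup>2 \<le> (\<Sum>v\<in>W. (u v)\<^sup>2) * card W"
    by (rule sum_squared_le_sum_of_squares)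
  then have "(\<Sum>v\<in>W. u v)\<^sup>2 / (real (card W))\<^sup>2 \<le> ((\<Sum>v\<in>W. (u v)\<^sup>2) * card W) / (real (card W))\<^sup>2"
    by (rule divide_right_mono) simp
  then show ?thesis using False by (simp add: average_def power_divide power2_eq_square)
qed

lemma integral_average:
  assumes "\<And>v. v \<in> W \<Longrightarrow> integrable m (F v)"
  shows "integrable m (\<lambda>x. average W (\<lambda>v. F v x))"
    "(\<integral>x. average W (\<lambda>v. F v x) \<partial>m) = average W (\<lambda>v. \<integral>x. F v x \<partial>m)"
proof -
  have "integrable m (\<lambda>x. \<Sum>v\<in>W. F v x)"
    using assms by (rule Bochner_Integration.integrable_sum)
  then show "integrable m (\<lambda>x. average W (\<lambda>v. F v x))"
    unfolding average_def by simp
  have "(\<integral>x. (\<Sum>v\<in>W. F v x) \<partial>m) = (\<Sum>v\<in>W. \<integral>x. F v x \<partial>m)"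
    using assms by (rule Bochner_Integration.integral_sum)
  then show "(\<integral>x. average W (\<lambda>v. F v x) \<partial>m) = average W (\<lambda>v. \<integral>x. F v x \<partial>m)"
    unfolding average_def by simp
qed

lemma (in prob_space) exists_below_expectation:
  fixes Z :: "'a \<Rightarrow> real"
  assumes "integrable M Z" "expectation Z < \<delta>"
  obtains x where "x \<in> space M" "Z x < \<delta>"
proof -
  have "\<exists>x\<in>space M. Z x < \<delta>"
  proof (rule ccontr)
    assume "\<not> ?thesis"
    then have "\<And>x. x \<in> space M \<Longrightarrow> \<delta> \<le> Z x" by force
    then have "(\<integral>x. \<delta> \<partial>M) \<le> expectation Z"
      using assms(1) by (intro integral_mono) auto
    then show False using assms(2) by (simp add: prob_space)
  qed
  then show ?thesis using that by blast
qed

context sofic_group begin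

text \<open>For most pairs \<open>v, w\<close> the values \<open>f(\<Pi>\<^sub>v x)\<close> and \<open>f(\<Pi>\<^sub>w x)\<close> are nearly uncorrelated under \<open>m n\<close>.
  Deviations are taken from the mean under \<open>\<mu>\<close> and not under \<open>m n\<close>; so the condition says as well
  that the mean of \<open>f(\<Pi>\<^sub>v x)\<close> is close to \<open>\<integral>f d\<mu>\<close> for most \<open>v\<close>.\<close>

definition decorrelates :: "'x topology \<Rightarrow> ('x \<Rightarrow> real) set \<Rightarrow> (nat \<Rightarrow> ('v \<Rightarrow> 'x) measure) \<Rightarrow> ('g \<Rightarrow> 'x) measure \<Rightarrow> bool" where
  "decorrelates X \<F> m \<mu> \<longleftrightarrow> (\<forall>l\<in>lists (coordinate_functions (carrier G) \<F>).
     (\<lambda>n. average (V n) (\<lambda>v. average (V n) (\<lambda>w.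
        \<bar>\<integral>x. (monomial l (pullback G (\<sigma> n) v x) - (\<integral>z. monomial l z \<partial>\<mu>))
            * (monomial l (pullback G (\<sigma> n) w x) - (\<integral>z. monomial l z \<partial>\<mu>)) \<partial>m n\<bar>))) \<longlonglongrightarrow> 0)"

lemma continuous_pullback_function:
  assumes "continuous_map (configs (carrier G) X) euclideanreal f" "v \<in> V n"
  shows "continuous_map (configs (V n) X) euclideanreal (\<lambda>x. f (pullback G (\<sigma> n) v x))"
  using continuous_map_compose [OF continuous_map_pullback [OF assms(2)] assms(1)] by (simp add: comp_def)

text \<open>Every test consists of a monomial \<open>f\<close> in \<open>x\<close> and a monomial \<open>h\<close> in \<open>y\<close>. Its error for a random
  \<open>x\<close> has second moment at most \<open>sup h\<^sup>2\<close> times the average that tends to \<open>0\<close> by \<open>decorrelates\<close>.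
  Hence finitely many tests can eventually be met at once, to any given precision, by one \<open>x\<close>; since
  there are countably many, a diagonal choice meets all of them.\<close>

lemma exists_independent_models:
  fixes X :: "'x topology" and Y :: "'y topology"
  assumes X: "compact_metrizable X" and Y: "compact_metrizable Y"
    and \<F>: "countable_separating X \<F>" and \<G>: "countable_separating Y \<G>"
    and \<mu>: "\<mu> \<in> Prob (configs (carrier G) X)" and m: "\<And>n. m n \<in> Prob (configs (V n) X)"
    and dec: "decorrelates X \<F> m \<mu>"
    and y: "\<And>n. y n \<in> topspace (configs (V n) Y)"
    and lim: "limitin (weak_star (configs (carrier G) Y)) (\<lambda>n. empirical G (V n) (\<sigma> n) Y (y n)) \<nu> sequentially"
  obtains x where "\<And>n. x n \<in> topspace (configs (V n) X)"
    "limitin (weak_star (configs (carrier G) (prod_topology X Y)))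
       (\<lambda>n. empirical G (V n) (\<sigma> n) (prod_topology X Y) (zip_on (V n) (x n) (y n)))
       (prod_config_measure (carrier G) X Y \<mu> \<nu>) sequentially"
proof -
  let ?\<F> = "coordinate_functions (carrier G) \<F>" and ?\<G> = "coordinate_functions (carrier G) \<G>"
  let ?KX = "configs (carrier G) X" and ?KY = "configs (carrier G) Y"
  note I = countable_carrier
  interpret Y: model_sequence G V \<sigma> Y \<nu> y
    by unfold_locales (use Y y lim in auto)
  define c where "c l = (\<integral>z. monomial l z \<partial>\<mu>)" for l
  define c' where "c' l = (\<integral>z. monomial l z \<partial>\<nu>)" for l
  have contX: "continuous_map ?KX euclideanreal (monomial l)" if "l \<in> lists ?\<F>" for l
    using that coordinate_functions_continuous [OF \<F> I] by (intro continuous_monomial) auto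
  have contY: "continuous_map ?KY euclideanreal (monomial l)" if "l \<in> lists ?\<G>" for l
    using that coordinate_functions_continuous [OF \<G> I] by (intro continuous_monomial) auto
  define a where "a l n v x = monomial l (pullback G (\<sigma> n) v x) - c l" for l n v and x :: "'v \<Rightarrow> 'x"
  define h where "h l n v = monomial l (pullback G (\<sigma> n) v (y n))" for l n v
  define D where "D l l' n x = average (V n) (\<lambda>v. a l n v x * h l' n v)" for l l' n x
  have ac: "continuous_map (configs (V n) X) euclideanreal (a l n v)" if "l \<in> lists ?\<F>" "v \<in> V n" for l n v
    unfolding a_def [abs_def]
    by (intro continuous_map_diff continuous_pullback_function contX that) auto
  have KV: "compact_space (configs (V n) X)" for n
    using compact_metrizable_model [OF X] by blast
  have aint: "integrable (m n) (\<lambda>x. a l n v x * a l n w x)" if "l \<in> lists ?\<F>" "v \<in> V n" "w \<in> V n" for l n v w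
    by (rule continuous_integrable [OF KV m]) (intro continuous_map_real_mult ac that)
  have D2: "(D l l' n x)\<^sup>2 = average (V n) (\<lambda>v. average (V n) (\<lambda>w. (a l n v x * a l n w x) * (h l' n v * h l' n w)))" for l l' n x
    unfolding D_def average_square by (simp add: mult_ac)
  have D2_int: "integrable (m n) (\<lambda>x. (D l l' n x)\<^sup>2)" if "l \<in> lists ?\<F>" for l l' n
    unfolding D2 by (intro integral_average(1) integrable_mult_left) (simp add: aint that)
  have ED2: "(\<lambda>n. \<integral>x. (D l l' n x)\<^sup>2 \<partial>m n) \<longlonglongrightarrow> 0" if l: "l \<in> lists ?\<F>" and l': "l' \<in> lists ?\<G>" for l l'
  proof -
    obtain H where H: "H > 0" "\<And>z. z \<in> topspace ?KY \<Longrightarrow> \<bar>monomial l' z\<bar> \<le> H"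
      by (rule continuous_on_compact_bounded [OF Y.compact_K contY [OF l']]) blast
    have h: "\<bar>h l' n v\<bar> \<le> H" if "v \<in> V n" for n v
      unfolding h_def by (intro H(2) pullback_in_configs y that)
    have upper: "(\<integral>x. (D l l' n x)\<^sup>2 \<partial>m n) \<le> (H * H) * average (V n) (\<lambda>v. average (V n) (\<lambda>w. \<bar>\<integral>x. a l n v x * a l n w x \<partial>m n\<bar>))" for n
    proof -
      have "(\<integral>x. (D l l' n x)\<^sup>2 \<partial>m n)
        = average (V n) (\<lambda>v. \<integral>x. average (V n) (\<lambda>w. (a l n v x * a l n w x) * (h l' n v * h l' n w)) \<partial>m n)"
        unfolding D2 by (intro integral_average(2) integral_average(1) integrable_mult_left) (simp add: aint l)
      also have "\<dots> = average (V n) (\<lambda>v. average (V n) (\<lambda>w. \<integral>x. (a l n v x * a l n w x) * (h l' n v * h l' n w) \<partial>m n))"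
        by (intro average_cong integral_average(2) integrable_mult_left) (simp add: aint l)
      also have "\<dots> \<le> average (V n) (\<lambda>v. average (V n) (\<lambda>w. (H * H) * \<bar>\<integral>x. a l n v x * a l n w x \<partial>m n\<bar>))"
      proof (intro average_mono)
        fix v w assume vw: "v \<in> V n" "w \<in> V n"
        let ?J = "\<integral>x. a l n v x * a l n w x \<partial>m n"
        have "(\<integral>x. (a l n v x * a l n w x) * (h l' n v * h l' n w) \<partial>m n) = ?J * (h l' n v * h l' n w)"
          by (rule integral_mult_left_zero)
        also have "\<dots> \<le> \<bar>?J\<bar> * (\<bar>h l' n v\<bar> * \<bar>h l' n w\<bar>)"
          by (metis abs_ge_self abs_mult)
        also have "\<dots> \<le> \<bar>?J\<bar> * (H * H)"
          using h vw H(1) by (intro mult_left_mono mult_mono) auto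
        finally show "(\<integral>x. (a l n v x * a l n w x) * (h l' n v * h l' n w) \<partial>m n) \<le> H * H * \<bar>?J\<bar>"
          by (simp add: mult.commute)
      qed
      also have "\<dots> = (H * H) * average (V n) (\<lambda>v. average (V n) (\<lambda>w. \<bar>\<integral>x. a l n v x * a l n w x \<partial>m n\<bar>))"
        by (simp only: average_cmult)
      finally show ?thesis .
    qed
    have upper_lim: "(\<lambda>n. (H * H) * average (V n) (\<lambda>v. average (V n) (\<lambda>w. \<bar>\<integral>x. a l n v x * a l n w x \<partial>m n\<bar>))) \<longlonglongrightarrow> (H * H) * 0"
      using dec l unfolding decorrelates_def a_def c_def by (intro tendsto_mult_left) blast
    show ?thesis
    proof (rule tendsto_sandwich [OF _ _ tendsto_const])
      show "\<forall>\<^sub>F n in sequentially. 0 \<le> (\<integral>x. (D l l' n x)\<^sup>2 \<partial>m n)" by simp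
      show "\<forall>\<^sub>F n in sequentially. (\<integral>x. (D l l' n x)\<^sup>2 \<partial>m n)
        \<le> (H * H) * average (V n) (\<lambda>v. average (V n) (\<lambda>w. \<bar>\<integral>x. a l n v x * a l n w x \<partial>m n\<bar>))"
        by (intro always_eventually allI upper)
      show "(\<lambda>n. (H * H) * average (V n) (\<lambda>v. average (V n) (\<lambda>w. \<bar>\<integral>x. a l n v x * a l n w x \<partial>m n\<bar>))) \<longlonglongrightarrow> 0"
        using upper_lim by simp
    qed
  qed
  define Q where "Q = (\<lambda>(l, l', k :: nat) n x. \<bar>D l l' n x\<bar> < 1 / real (Suc k))"
  obtain x where x: "\<And>n. x n \<in> topspace (configs (V n) X)"
    "\<And>j. j \<in> lists ?\<F> \<times> lists ?\<G> \<times> UNIV \<Longrightarrow> \<forall>\<^sub>F n in sequentially. Q j n (x n)"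
  proof (rule diagonal_choice [of "lists ?\<F> \<times> lists ?\<G> \<times> (UNIV :: nat set)" "\<lambda>n. topspace (configs (V n) X)" Q])
    have "countable ?\<F>" "countable ?\<G>"
      using countable_separating_configs [OF \<F> I] countable_separating_configs [OF \<G> I]
      by (simp_all add: countable_separating_def)
    then show "countable (lists ?\<F> \<times> lists ?\<G> \<times> (UNIV :: nat set))"
      by (intro countable_SIGMA countable_lists) auto
    show "topspace (configs (V n) X) \<noteq> {}" for n
      using prob_space.not_empty [OF Prob_prob_space [OF m]] Prob_space [OF m] by metis
    fix T assume T: "finite T" "T \<subseteq> lists ?\<F> \<times> lists ?\<G> \<times> (UNIV :: nat set)"
    define k0 where "k0 = Max (insert 0 ((\<lambda>t. snd (snd t)) ` T))"
    have k0: "snd (snd t) \<le> k0" if "t \<in> T" for t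
      unfolding k0_def using T(1) that by (intro Max_ge) auto
    define \<delta> where "\<delta> = 1 / real (Suc k0)"
    have \<delta>: "\<delta> > 0" by (simp add: \<delta>_def)
    have "(\<lambda>n. \<Sum>t\<in>T. \<integral>x. (D (fst t) (fst (snd t)) n x)\<^sup>2 \<partial>m n) \<longlonglongrightarrow> (\<Sum>t\<in>T. 0)"
      using T(2) by (intro tendsto_sum ED2) auto
    then have "\<forall>\<^sub>F n in sequentially. (\<Sum>t\<in>T. \<integral>x. (D (fst t) (fst (snd t)) n x)\<^sup>2 \<partial>m n) < \<delta>\<^sup>2"
      using \<delta> by (intro order_tendstoD(2)) auto
    then show "\<forall>\<^sub>F n in sequentially. \<exists>x\<in>topspace (configs (V n) X). \<forall>t\<in>T. Q t n x"
    proof eventually_elim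
      case (elim n)
      interpret prob_space "m n" using m by (rule Prob_prob_space)
      have i: "integrable (m n) (\<lambda>x. (D (fst t) (fst (snd t)) n x)\<^sup>2)" if "t \<in> T" for t
        using T(2) that by (intro D2_int) auto
      obtain x where x: "x \<in> space (m n)" "(\<Sum>t\<in>T. (D (fst t) (fst (snd t)) n x)\<^sup>2) < \<delta>\<^sup>2"
      proof (rule exists_below_expectation)
        show "integrable (m n) (\<lambda>x. \<Sum>t\<in>T. (D (fst t) (fst (snd t)) n x)\<^sup>2)"
          using i by (rule Bochner_Integration.integrable_sum)
        have "expectation (\<lambda>x. \<Sum>t\<in>T. (D (fst t) (fst (snd t)) n x)\<^sup>2)
          = (\<Sum>t\<in>T. expectation (\<lambda>x. (D (fst t) (fst (snd t)) n x)\<^sup>2))"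
          using i by (rule Bochner_Integration.integral_sum)
        then show "expectation (\<lambda>x. \<Sum>t\<in>T. (D (fst t) (fst (snd t)) n x)\<^sup>2) < \<delta>\<^sup>2"
          using elim by simp
      qed
      have "Q t n x" if t: "t \<in> T" for t
      proof -
        have "(D (fst t) (fst (snd t)) n x)\<^sup>2 \<le> (\<Sum>t\<in>T. (D (fst t) (fst (snd t)) n x)\<^sup>2)"
          using T(1) t by (intro member_le_sum) auto
        then have "\<bar>D (fst t) (fst (snd t)) n x\<bar>\<^sup>2 < \<delta>\<^sup>2" using x(2) by simp
        then have "\<bar>D (fst t) (fst (snd t)) n x\<bar> < \<delta>"
          using \<delta> by (intro power_less_imp_less_base [of _ 2 \<delta>]) auto
        also have "\<delta> \<le> 1 / real (Suc (snd (snd t)))"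
          using k0 [OF t] unfolding \<delta>_def by (intro divide_left_mono) auto
        finally show ?thesis by (simp add: Q_def case_prod_beta)
      qed
      moreover have "x \<in> topspace (configs (V n) X)" using x(1) Prob_space [OF m] by simp
      ultimately show ?case by blast
    qed
  qed blast
  have D_lim: "(\<lambda>n. D l l' n (x n)) \<longlonglongrightarrow> 0" if l: "l \<in> lists ?\<F>" and l': "l' \<in> lists ?\<G>" for l l'
  proof (rule tendstoI)
    fix \<epsilon> :: real assume "\<epsilon> > 0"
    then obtain k where "inverse (real (Suc k)) < \<epsilon>" using reals_Archimedean by blast
    then have k: "1 / real (Suc k) < \<epsilon>" unfolding inverse_eq_divide .
    have "\<forall>\<^sub>F n in sequentially. Q (l, l', k) n (x n)" using l l' by (intro x(2)) simp
    then show "\<forall>\<^sub>F n in sequentially. dist (D l l' n (x n)) 0 < \<epsilon>"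
      by (rule eventually_mono) (use k in \<open>simp add: Q_def dist_real_def\<close>)
  qed
  have lim_mono: "(\<lambda>n. average (V n) (\<lambda>v. monomial l (pullback G (\<sigma> n) v (x n)) * monomial l' (pullback G (\<sigma> n) v (y n)))) \<longlonglongrightarrow> c l * c' l'"
    if l: "l \<in> lists ?\<F>" and l': "l' \<in> lists ?\<G>" for l l'
  proof -
    have "average (V n) (\<lambda>v. monomial l (pullback G (\<sigma> n) v (x n)) * monomial l' (pullback G (\<sigma> n) v (y n)))
      = D l l' n (x n) + c l * average (V n) (\<lambda>v. monomial l' (pullback G (\<sigma> n) v (y n)))" for n
      unfolding D_def average_cmult [symmetric] average_add [symmetric] a_def h_def
      by (simp add: algebra_simps)
    moreover have "(\<lambda>n. D l l' n (x n) + c l * average (V n) (\<lambda>v. monomial l' (pullback G (\<sigma> n) v (y n)))) \<longlonglongrightarrow> 0 + c l * c' l'"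
      unfolding c'_def
      by (intro tendsto_add D_lim l l' tendsto_mult_left Y.equidistributed contY)
    ultimately show ?thesis by simp
  qed
  let ?L = "configs (carrier G) (prod_topology X Y)"
  have L: "compact_metrizable ?L"
    by (intro compact_metrizable_process compact_metrizable_prod X Y)
  have sep: "countable_separating ?L (coordinate_functions (carrier G) (pair_functions \<F> \<G>))"
    by (intro countable_separating_configs countable_separating_prod \<F> \<G> I)
  have zip: "zip_on (V n) (x n) (y n) \<in> topspace (configs (V n) (prod_topology X Y))" for n
    by (rule zip_on_in_configs [OF x(1) y])
  show ?thesis
  proof (rule that [OF x(1) weak_star_limit_monomialsI [OF _ sep]])
    show "compact_space ?L" using L by simp
    show "prod_config_measure (carrier G) X Y \<mu> \<nu> \<in> Prob ?L"
      by (intro prod_config_measure_in_Prob X Y I \<mu> Y.\<rho>)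
    show "\<forall>\<^sub>F n in sequentially. empirical G (V n) (\<sigma> n) (prod_topology X Y) (zip_on (V n) (x n) (y n)) \<in> Prob ?L"
      using eventually_nonempty by eventually_elim (rule empirical_in_Prob [OF zip])
    fix l assume l: "l \<in> lists (coordinate_functions (carrier G) (pair_functions \<F> \<G>))"
    have lc: "continuous_map ?L euclideanreal (monomial l)"
      using l sep by (intro continuous_monomial) (auto simp: countable_separating_def)
    obtain p q where pq: "p \<in> lists ?\<F>" "q \<in> lists ?\<G>"
      "\<And>x y. monomial l (zip_on (carrier G) x y) = monomial p x * monomial q y"
      using monomial_zip_on [OF l] by blast
    have av: "average (V n) (\<lambda>v. monomial l (pullback G (\<sigma> n) v (zip_on (V n) (x n) (y n))))
      = average (V n) (\<lambda>v. monomial p (pullback G (\<sigma> n) v (x n)) * monomial q (pullback G (\<sigma> n) v (y n)))" for n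
      using \<sigma>_in_V by (intro average_cong) (simp add: pullback_zip_on pq(3))
    have int: "(\<integral>z. monomial l z \<partial>prod_config_measure (carrier G) X Y \<mu> \<nu>) = c p * c' q"
      unfolding c_def c'_def
      by (rule integral_prod_config_measure [OF X Y I \<mu> Y.\<rho> continuous_map_borel_measurable [OF lc] pq(3)
        contX [OF pq(1)] contY [OF pq(2)]])
    show "(\<lambda>n. \<integral>z. monomial l z \<partial>empirical G (V n) (\<sigma> n) (prod_topology X Y) (zip_on (V n) (x n) (y n)))
      \<longlonglongrightarrow> (\<integral>z. monomial l z \<partial>prod_config_measure (carrier G) X Y \<mu> \<nu>)"
      unfolding integral_empirical [OF zip lc] av int by (rule lim_mono [OF pq(1,2)])
  qed
qed

text \<open>Let \<open>F(x, x') = (f(x) - c) (f(x') - c)\<close>, whose integral against \<open>\<mu> \<times> \<mu>\<close> is \<open>0\<close>. On the model space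
  of a neighbourhood where \<open>\<bar>\<integral>F\<bar> < \<delta>\<close>, which has almost full measure for \<open>m n \<times> m n\<close>, the empirical
  integral \<open>D n\<close> of \<open>F\<close> is less than \<open>\<delta>\<close> in absolute value, and it is bounded everywhere. So its second moment tends to \<open>0\<close>. Expanding the square and
  using Fubini, this second moment is the average of the squares of the expectations in
  question, and the Cauchy-Schwarz inequality removes the squares.\<close>

lemma doubly_quenched_decorrelates:
  fixes X :: "'x topology"
  assumes X: "compact_metrizable X" and \<F>: "countable_separating X \<F>"
    and \<mu>: "\<mu> \<in> Prob (configs (carrier G) X)" and m: "\<And>n. m n \<in> Prob (configs (V n) X)"
    and dq: "doubly_quenched_converges G V \<sigma> X m \<mu>"
  shows "decorrelates X \<F> m \<mu>"
  unfolding decorrelates_def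
proof
  fix l assume l: "l \<in> lists (coordinate_functions (carrier G) \<F>)"
  let ?K = "configs (carrier G) X" and ?L = "configs (carrier G) (prod_topology X X)"
  let ?M = "\<lambda>n. prod_config_measure (V n) X X (m n) (m n)"
  note I = countable_carrier
  have I': "countable (V n)" for n using finite_V by (rule countable_finite)
  define c where "c = (\<integral>z. monomial l z \<partial>\<mu>)"
  define f where "f z = monomial l z - c" for z
  have lc: "continuous_map ?K euclideanreal (monomial l)"
    using l coordinate_functions_continuous [OF \<F> I] by (intro continuous_monomial) auto
  then have fc: "continuous_map ?K euclideanreal f"
    unfolding f_def [abs_def] by (intro continuous_map_diff) auto
  have K: "compact_space ?K" "compact_space ?L"
    using compact_metrizable_process X compact_metrizable_prod by blast+
  have f0: "(\<integral>z. f z \<partial>\<mu>) = 0"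
  proof -
    interpret prob_space \<mu> using \<mu> by (rule Prob_prob_space)
    show ?thesis unfolding f_def using continuous_integrable [OF K(1) \<mu> lc] by (simp add: c_def prob_space)
  qed
  define F where "F z = f (\<lambda>g\<in>carrier G. fst (z g)) * f (\<lambda>g\<in>carrier G. snd (z g))" for z
  have Fc: "continuous_map ?L euclideanreal F"
    using continuous_map_compose [OF continuous_map_configs_map [OF continuous_map_fst] fc]
      continuous_map_compose [OF continuous_map_configs_map [OF continuous_map_snd] fc]
    unfolding F_def [abs_def] comp_def by (rule continuous_map_real_mult)
  have Fzip: "F (zip_on (carrier G) x y) = f x * f y" if "x \<in> topspace ?K" "y \<in> topspace ?K" for x y
  proof -
    have "(\<lambda>g\<in>carrier G. fst (zip_on (carrier G) x y g)) = x" "(\<lambda>g\<in>carrier G. snd (zip_on (carrier G) x y g)) = y"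
      using that by (auto simp: zip_on_def fun_eq_iff PiE_iff extensional_def)
    then show ?thesis by (simp add: F_def)
  qed
  obtain B where B: "B > 0" "\<And>z. z \<in> topspace ?L \<Longrightarrow> \<bar>F z\<bar> \<le> B"
    by (rule continuous_on_compact_bounded [OF K(2) Fc]) blast
  define D where "D n z = average (V n) (\<lambda>v. F (pullback G (\<sigma> n) v z))" for n z
  define t where "t n v w = (\<integral>x. f (pullback G (\<sigma> n) v x) * f (pullback G (\<sigma> n) w x) \<partial>m n)" for n v w
  have MP: "?M n \<in> Prob (configs (V n) (prod_topology X X))" for n
    by (intro prod_config_measure_in_Prob X I' m)
  have FFc: "continuous_map (configs (V n) (prod_topology X X)) euclideanreal
      (\<lambda>z. F (pullback G (\<sigma> n) v z) * F (pullback G (\<sigma> n) w z))" if "v \<in> V n" "w \<in> V n" for n v w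
    by (intro continuous_map_real_mult continuous_pullback_function Fc that)
  have KV: "compact_space (configs (V n) (prod_topology X X))" for n
    using compact_metrizable_model compact_metrizable_prod X by blast
  have FFi: "integrable (?M n) (\<lambda>z. F (pullback G (\<sigma> n) v z) * F (pullback G (\<sigma> n) w z))" if "v \<in> V n" "w \<in> V n" for n v w
    by (rule continuous_integrable [OF KV MP FFc [OF that]])
  have FF: "(\<integral>z. F (pullback G (\<sigma> n) v z) * F (pullback G (\<sigma> n) w z) \<partial>?M n) = (t n v w)\<^sup>2" if "v \<in> V n" "w \<in> V n" for n v w
    unfolding t_def power2_eq_square
  proof (rule integral_prod_config_measure [OF X X I' m m continuous_map_borel_measurable [OF FFc [OF that]]])
    show "continuous_map (configs (V n) X) euclideanreal (\<lambda>x. f (pullback G (\<sigma> n) v x) * f (pullback G (\<sigma> n) w x))"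
      "continuous_map (configs (V n) X) euclideanreal (\<lambda>x. f (pullback G (\<sigma> n) v x) * f (pullback G (\<sigma> n) w x))"
      by (intro continuous_map_real_mult continuous_pullback_function fc that)+
    fix x y assume xy: "x \<in> topspace (configs (V n) X)" "y \<in> topspace (configs (V n) X)"
    have "F (pullback G (\<sigma> n) u (zip_on (V n) x y)) = f (pullback G (\<sigma> n) u x) * f (pullback G (\<sigma> n) u y)" if "u \<in> V n" for u
      using that \<sigma>_in_V by (simp add: pullback_zip_on Fzip [OF pullback_in_configs [OF xy(1) that] pullback_in_configs [OF xy(2) that]])
    then show "F (pullback G (\<sigma> n) v (zip_on (V n) x y)) * F (pullback G (\<sigma> n) w (zip_on (V n) x y))
      = (f (pullback G (\<sigma> n) v x) * f (pullback G (\<sigma> n) w x)) * (f (pullback G (\<sigma> n) v y) * f (pullback G (\<sigma> n) w y))"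
      using that by (simp add: mult_ac)
  qed
  have D2: "(D n z)\<^sup>2 = average (V n) (\<lambda>v. average (V n) (\<lambda>w. F (pullback G (\<sigma> n) v z) * F (pullback G (\<sigma> n) w z)))" for n z
    unfolding D_def by (rule average_square)
  have D2i: "integrable (?M n) (\<lambda>z. (D n z)\<^sup>2)" for n
    unfolding D2 by (intro integral_average(1) FFi)
  have D2_int: "(\<integral>z. (D n z)\<^sup>2 \<partial>?M n) = average (V n) (\<lambda>v. average (V n) (\<lambda>w. (t n v w)\<^sup>2))" for n
  proof -
    have "(\<integral>z. (D n z)\<^sup>2 \<partial>?M n)
      = average (V n) (\<lambda>v. \<integral>z. average (V n) (\<lambda>w. F (pullback G (\<sigma> n) v z) * F (pullback G (\<sigma> n) w z)) \<partial>?M n)"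
      unfolding D2 by (intro integral_average(2) integral_average(1) FFi)
    also have "\<dots> = average (V n) (\<lambda>v. average (V n) (\<lambda>w. \<integral>z. F (pullback G (\<sigma> n) v z) * F (pullback G (\<sigma> n) w z) \<partial>?M n))"
      by (intro average_cong integral_average(2) FFi)
    also have "\<dots> = average (V n) (\<lambda>v. average (V n) (\<lambda>w. (t n v w)\<^sup>2))"
      by (intro average_cong FF)
    finally show ?thesis .
  qed
  have D_le: "\<bar>D n z\<bar> \<le> B" if "z \<in> topspace (configs (V n) (prod_topology X X))" for n z
  proof -
    have "\<bar>D n z\<bar> \<le> average (V n) (\<lambda>v. \<bar>F (pullback G (\<sigma> n) v z)\<bar>)"
      unfolding D_def by (rule average_abs)
    also have "\<dots> \<le> average (V n) (\<lambda>_. B)"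
      by (intro average_mono B(2) pullback_in_configs that)
    also have "\<dots> \<le> B" using B(1) by (intro average_const_le) simp
    finally show ?thesis .
  qed
  have lim2: "(\<lambda>n. average (V n) (\<lambda>v. average (V n) (\<lambda>w. (t n v w)\<^sup>2))) \<longlonglongrightarrow> 0"
  proof (rule tendstoI)
    fix \<epsilon> :: real assume \<epsilon>: "\<epsilon> > 0"
    define \<delta> where "\<delta> = sqrt (\<epsilon> / 2)"
    have \<delta>: "\<delta> > 0" "\<delta>\<^sup>2 = \<epsilon> / 2" using \<epsilon> by (simp_all add: \<delta>_def)
    define \<O> where "\<O> = {\<eta> \<in> Prob ?L. (\<integral>z. F z \<partial>\<eta>) \<in> ball 0 \<delta>}"
    have "openin (weak_star ?L) \<O>"
      unfolding weak_star_def \<O>_def using Fc by (intro topology_generated_by_Basis) blast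
    moreover have "prod_config_measure (carrier G) X X \<mu> \<mu> \<in> \<O>"
    proof -
      have "(\<integral>z. F z \<partial>prod_config_measure (carrier G) X X \<mu> \<mu>) = 0"
        using integral_prod_config_measure [OF X X I \<mu> \<mu> continuous_map_borel_measurable [OF Fc] Fzip fc fc] f0 by simp
      then show ?thesis
        using \<delta>(1) prod_config_measure_in_Prob [OF X X I \<mu> \<mu>] by (simp add: \<O>_def)
    qed
    ultimately have lim: "(\<lambda>n. measure (?M n) (model_space G (V n) (\<sigma> n) (prod_topology X X) \<O>)) \<longlonglongrightarrow> 1"
      using dq unfolding doubly_quenched_converges_def quenched_converges_def by blast
    define \<eta> where "\<eta> = min 1 (\<epsilon> / (4 * B\<^sup>2))"
    have \<eta>: "\<eta> > 0" "\<eta> \<le> 1" "\<eta> \<le> \<epsilon> / (4 * B\<^sup>2)" using \<epsilon> B(1) by (simp_all add: \<eta>_def)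
    have "B\<^sup>2 * \<eta> \<le> B\<^sup>2 * (\<epsilon> / (4 * B\<^sup>2))" using \<eta>(3) by (intro mult_left_mono) auto
    also have "\<dots> = \<epsilon> / 4" using B(1) by simp
    finally have \<eta>B: "B\<^sup>2 * \<eta> \<le> \<epsilon> / 4" .
    have "\<forall>\<^sub>F n in sequentially. 1 - \<eta> < measure (?M n) (model_space G (V n) (\<sigma> n) (prod_topology X X) \<O>)"
      using \<eta>(1) by (intro order_tendstoD(1) [OF lim]) simp
    then show "\<forall>\<^sub>F n in sequentially. dist (average (V n) (\<lambda>v. average (V n) (\<lambda>w. (t n v w)\<^sup>2))) 0 < \<epsilon>"
    proof eventually_elim
      case (elim n)
      interpret prob_space "?M n" using MP by (rule Prob_prob_space)
      define S where "S = model_space G (V n) (\<sigma> n) (prod_topology X X) \<O>"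
      have pS: "1 - \<eta> < prob S" using elim by (simp add: S_def)
      \<comment> \<open>a set that is not measurable has measure \<open>0\<close> by convention\<close>
      have S: "S \<in> events"
      proof (rule ccontr)
        assume "S \<notin> events"
        then have "prob S = 0" by (rule measure_notin_sets)
        then show False using pS \<eta>(2) by simp
      qed
      have "(\<integral>z. (D n z)\<^sup>2 \<partial>?M n) \<le> (\<integral>z. \<delta>\<^sup>2 + B\<^sup>2 * indicator (space (?M n) - S) z \<partial>?M n)"
      proof (rule integral_mono [OF D2i])
        show "integrable (?M n) (\<lambda>z. \<delta>\<^sup>2 + B\<^sup>2 * indicator (space (?M n) - S) z)"
          using S by (intro Bochner_Integration.integrable_add integrable_mult_right integrable_real_indicator)
            (auto simp: emeasure_eq_measure)
        fix z assume z: "z \<in> space (?M n)"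
        then have zt: "z \<in> topspace (configs (V n) (prod_topology X X))" using Prob_space [OF MP] by simp
        show "(D n z)\<^sup>2 \<le> \<delta>\<^sup>2 + B\<^sup>2 * indicator (space (?M n) - S) z"
        proof (cases "z \<in> S")
          case True
          then have "\<bar>D n z\<bar> < \<delta>"
            using integral_empirical [OF zt Fc] by (simp add: S_def model_space_def \<O>_def D_def)
          then have "\<bar>D n z\<bar>\<^sup>2 \<le> \<delta>\<^sup>2" by (intro power_mono) auto
          then show ?thesis using True by simp
        next
          case False
          have "\<bar>D n z\<bar>\<^sup>2 \<le> B\<^sup>2" using D_le [OF zt] by (intro power_mono) auto
          then show ?thesis using False z by (simp add: add_increasing)
        qed
      qed
      also have "\<dots> = \<delta>\<^sup>2 + B\<^sup>2 * prob (space (?M n) - S)"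
      proof -
        have "integrable (?M n) (indicator (space (?M n) - S) :: _ \<Rightarrow> real)"
          using S by (intro integrable_real_indicator) (auto simp: emeasure_eq_measure)
        then show ?thesis using S by (simp add: prob_space)
      qed
      also have "\<dots> \<le> \<delta>\<^sup>2 + B\<^sup>2 * \<eta>"
        using pS prob_compl [OF S] by (intro add_left_mono mult_left_mono) auto
      also have "\<dots> < \<epsilon>" using \<delta>(2) \<eta>B \<epsilon> by linarith
      finally have "average (V n) (\<lambda>v. average (V n) (\<lambda>w. (t n v w)\<^sup>2)) < \<epsilon>" unfolding D2_int .
      moreover have "0 \<le> average (V n) (\<lambda>v. average (V n) (\<lambda>w. (t n v w)\<^sup>2))"
        by (intro average_nonneg) simp
      ultimately show ?case by (simp add: dist_real_def)
    qed
  qed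
  have "(\<lambda>n. average (V n) (\<lambda>v. average (V n) (\<lambda>w. \<bar>t n v w\<bar>))) \<longlonglongrightarrow> 0"
  proof (rule tendsto_sandwich [OF _ _ tendsto_const])
    show "\<forall>\<^sub>F n in sequentially. 0 \<le> average (V n) (\<lambda>v. average (V n) (\<lambda>w. \<bar>t n v w\<bar>))"
      by (intro always_eventually allI average_nonneg) simp
    show "\<forall>\<^sub>F n in sequentially. average (V n) (\<lambda>v. average (V n) (\<lambda>w. \<bar>t n v w\<bar>))
      \<le> sqrt (average (V n) (\<lambda>v. average (V n) (\<lambda>w. (t n v w)\<^sup>2)))"
    proof (intro always_eventually allI real_le_rsqrt)
      fix n
      have "(average (V n) (\<lambda>v. average (V n) (\<lambda>w. \<bar>t n v w\<bar>)))\<^sup>2 \<le> average (V n) (\<lambda>v. (average (V n) (\<lambda>w. \<bar>t n v w\<bar>))\<^sup>2)"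
        by (rule average_square_le)
      also have "\<dots> \<le> average (V n) (\<lambda>v. average (V n) (\<lambda>w. \<bar>t n v w\<bar>\<^sup>2))"
        by (intro average_mono average_square_le)
      finally show "(average (V n) (\<lambda>v. average (V n) (\<lambda>w. \<bar>t n v w\<bar>)))\<^sup>2 \<le> average (V n) (\<lambda>v. average (V n) (\<lambda>w. (t n v w)\<^sup>2))"
        by simp
    qed
    show "(\<lambda>n. sqrt (average (V n) (\<lambda>v. average (V n) (\<lambda>w. (t n v w)\<^sup>2)))) \<longlonglongrightarrow> 0"
      using tendsto_real_sqrt [OF lim2] by simp
  qed
  then show "(\<lambda>n. average (V n) (\<lambda>v. average (V n) (\<lambda>w.
        \<bar>\<integral>x. (monomial l (pullback G (\<sigma> n) v x) - (\<integral>z. monomial l z \<partial>\<mu>))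
            * (monomial l (pullback G (\<sigma> n) w x) - (\<integral>z. monomial l z \<partial>\<mu>)) \<partial>m n\<bar>))) \<longlonglongrightarrow> 0"
    by (simp add: t_def f_def c_def)
qed

end

section \<open>Factor maps\<close>

lemma factor_mapD:
  assumes "factor_map G M T N S \<Phi>"
  shows "\<Phi> \<in> M \<rightarrow>\<^sub>M N" "distr M N \<Phi> = N"
    "g \<in> carrier G \<Longrightarrow> AE x in M. \<Phi> (T g x) = S g (\<Phi> x)"
  using assms by (simp_all add: factor_map_def)

lemma factor_map_AE:
  assumes "factor_map G M T N S \<Phi>" "AE y in N. P y"
  shows "AE x in M. P (\<Phi> x)"
proof (rule AE_distrD [OF factor_mapD(1) [OF assms(1)]])
  show "AE y in distr M N \<Phi>. P y"
    unfolding factor_mapD(2) [OF assms(1)] by (rule assms(2))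
qed

lemma factor_map_comp:
  assumes \<Phi>: "factor_map G M T N S \<Phi>" and \<Psi>: "factor_map G N S P R \<Psi>"
  shows "factor_map G M T P R (\<lambda>x. \<Psi> (\<Phi> x))"
  unfolding factor_map_def
proof (intro conjI ballI)
  show "(\<lambda>x. \<Psi> (\<Phi> x)) \<in> M \<rightarrow>\<^sub>M P"
    by (rule measurable_compose [OF factor_mapD(1) [OF \<Phi>] factor_mapD(1) [OF \<Psi>]])
  show "distr M P (\<lambda>x. \<Psi> (\<Phi> x)) = P"
    using distr_distr [OF factor_mapD(1) [OF \<Psi>] factor_mapD(1) [OF \<Phi>]]
    by (simp add: factor_mapD(2) [OF \<Phi>] factor_mapD(2) [OF \<Psi>] comp_def)
  fix g assume g: "g \<in> carrier G"
  from factor_mapD(3) [OF \<Phi> g] factor_map_AE [OF \<Phi> factor_mapD(3) [OF \<Psi> g]]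
  show "AE x in M. \<Psi> (\<Phi> (T g x)) = R g (\<Psi> (\<Phi> x))"
    by eventually_elim simp
qed

text \<open>Equivariance of \<open>\<Psi>\<close> at \<open>y\<close> is read off at \<open>y = \<Phi> (\<Psi> y)\<close>; the identity \<open>\<Psi> (\<Phi> x) = x\<close> is then needed
  at \<open>T g (\<Psi> y)\<close>, which is why \<open>T\<close> must preserve \<open>M\<close>.\<close>

lemma factor_map_inverse:
  assumes iso: "system_iso G M T N S \<Phi>"
    and T: "\<And>g. g \<in> carrier G \<Longrightarrow> T g \<in> M \<rightarrow>\<^sub>M M" "\<And>g. g \<in> carrier G \<Longrightarrow> distr M M (T g) = M"
  obtains \<Psi> where "factor_map G N S M T \<Psi>" "AE y in N. \<Phi> (\<Psi> y) = y"
proof -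
  have \<Phi>: "factor_map G M T N S \<Phi>" using iso by (simp add: system_iso_def)
  obtain \<Psi> where \<Psi>: "\<Psi> \<in> N \<rightarrow>\<^sub>M M" "AE x in M. \<Psi> (\<Phi> x) = x" "AE y in N. \<Phi> (\<Psi> y) = y"
    using iso unfolding system_iso_def by blast
  have d: "distr N M \<Psi> = M"
  proof -
    have "distr N M \<Psi> = distr (distr M N \<Phi>) M \<Psi>" by (simp only: factor_mapD(2) [OF \<Phi>])
    also have "\<dots> = distr M M (\<Psi> \<circ> \<Phi>)" by (rule distr_distr [OF \<Psi>(1) factor_mapD(1) [OF \<Phi>]])
    also have "\<dots> = distr M M (\<lambda>x. x)"
      using \<Psi>(2) measurable_comp [OF factor_mapD(1) [OF \<Phi>] \<Psi>(1)]
      by (intro distr_cong_AE) (auto simp: comp_def)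
    finally show ?thesis by (simp add: distr_id)
  qed
  have pull: "AE y in N. P (\<Psi> y)" if "AE x in M. P x" for P
  proof (rule AE_distrD [OF \<Psi>(1)])
    show "AE x in distr N M \<Psi>. P x" unfolding d by (rule that)
  qed
  have "AE y in N. \<Psi> (S g y) = T g (\<Psi> y)" if g: "g \<in> carrier G" for g
  proof -
    have "AE x in M. \<Psi> (\<Phi> (T g x)) = T g x"
    proof (rule AE_distrD [OF T(1) [OF g]])
      show "AE x in distr M M (T g). \<Psi> (\<Phi> x) = x" unfolding T(2) [OF g] by (rule \<Psi>(2))
    qed
    from \<Psi>(3) pull [OF factor_mapD(3) [OF \<Phi> g]] pull [OF this] show ?thesis
      by eventually_elim simp
  qed
  then have "factor_map G N S M T \<Psi>"
    using \<Psi>(1) d by (simp add: factor_map_def)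
  then show ?thesis using \<Psi>(3) that by blast
qed

lemma factor_map_fst:
  assumes "prob_space M" "prob_space N"
  shows "factor_map G (M \<Otimes>\<^sub>M N) (\<lambda>g. map_prod (T g) (S g)) M T fst"
  using prob_space.distr_pair_fst [OF assms(2)] by (simp add: factor_map_def)

lemma factor_map_swap:
  assumes "prob_space M" "prob_space N"
  shows "factor_map G (M \<Otimes>\<^sub>M N) (\<lambda>g. map_prod (T g) (S g)) (N \<Otimes>\<^sub>M M) (\<lambda>g. map_prod (S g) (T g)) (\<lambda>(x, y). (y, x))"
proof -
  interpret M: prob_space M by fact
  interpret N: prob_space N by fact
  interpret pair_prob_space N M ..
  show ?thesis
    using distr_pair_swap measurable_pair_swap' [of M N] by (simp add: factor_map_def case_prod_beta)
qed

lemma factor_map_snd: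
  assumes "prob_space M" "prob_space N"
  shows "factor_map G (M \<Otimes>\<^sub>M N) (\<lambda>g. map_prod (T g) (S g)) N S snd"
  using factor_map_comp [OF factor_map_swap [OF assms] factor_map_fst [OF assms(2,1)], of G T S]
  by (simp add: case_prod_beta)

lemma factor_map_prod:
  assumes \<Phi>: "factor_map G M T N S \<Phi>" and \<Psi>: "factor_map G M' T' N' S' \<Psi>"
    and prob: "prob_space M" "prob_space M'"
  shows "factor_map G (M \<Otimes>\<^sub>M M') (\<lambda>g. map_prod (T g) (T' g)) (N \<Otimes>\<^sub>M N') (\<lambda>g. map_prod (S g) (S' g)) (map_prod \<Phi> \<Psi>)"
  unfolding factor_map_def
proof (intro conjI ballI)
  note m = factor_mapD(1) [OF \<Phi>] factor_mapD(1) [OF \<Psi>]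
  have mp: "map_prod \<Phi> \<Psi> = (\<lambda>(x, y). (\<Phi> x, \<Psi> y))" by (auto simp: fun_eq_iff)
  have "prob_space (distr M' N' \<Psi>)" by (rule prob_space.prob_space_distr [OF prob(2) m(2)])
  then have sf: "sigma_finite_measure (distr M' N' \<Psi>)"
    by (simp add: prob_space_def prob_space_axioms_def finite_measure_def)
  show "map_prod \<Phi> \<Psi> \<in> M \<Otimes>\<^sub>M M' \<rightarrow>\<^sub>M N \<Otimes>\<^sub>M N'"
    unfolding mp using m by measurable
  show "distr (M \<Otimes>\<^sub>M M') (N \<Otimes>\<^sub>M N') (map_prod \<Phi> \<Psi>) = N \<Otimes>\<^sub>M N'"
    using pair_measure_distr [OF m sf] by (simp add: mp factor_mapD(2) [OF \<Phi>] factor_mapD(2) [OF \<Psi>])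
  fix g assume g: "g \<in> carrier G"
  from factor_map_AE [OF factor_map_fst [OF prob, of G T T'] factor_mapD(3) [OF \<Phi> g]]
    factor_map_AE [OF factor_map_snd [OF prob, of G T T'] factor_mapD(3) [OF \<Psi> g]]
  show "AE z in M \<Otimes>\<^sub>M M'. map_prod \<Phi> \<Psi> (map_prod (T g) (T' g) z) = map_prod (S g) (S' g) (map_prod \<Phi> \<Psi> z)"
    by eventually_elim (simp add: map_prod_def case_prod_beta)
qed

lemma compact_metrizable_mtopology_of:
  "compact_space (mtopology_of d) \<Longrightarrow> compact_metrizable (mtopology_of d)"
  by (simp add: mtopology_of_def Metric_space.metrizable_space_mtopology)

lemma factor_map_unzip:
  assumes G: "group G" "countable (carrier G)" and X: "compact_metrizable X" and Y: "compact_metrizable Y"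
    and \<mu>: "\<mu> \<in> Prob (configs (carrier G) X)" and \<nu>: "\<nu> \<in> Prob (configs (carrier G) Y)"
  shows "factor_map G (prod_config_measure (carrier G) X Y \<mu> \<nu>) (right_shift G)
    (\<mu> \<Otimes>\<^sub>M \<nu>) (\<lambda>g. map_prod (right_shift G g) (right_shift G g))
    (\<lambda>z. (\<lambda>g\<in>carrier G. fst (z g), \<lambda>g\<in>carrier G. snd (z g)))"
proof -
  interpret group G by fact
  let ?\<rho> = "prod_config_measure (carrier G) X Y \<mu> \<nu>"
  let ?u = "\<lambda>z. (\<lambda>g\<in>carrier G. fst (z g), \<lambda>g\<in>carrier G. snd (z g))"
  let ?L = "configs (carrier G) (prod_topology X Y)"
  have \<rho>: "?\<rho> \<in> Prob ?L" by (intro prod_config_measure_in_Prob X Y G \<mu> \<nu>)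
  have u: "?u \<in> borel_of ?L \<rightarrow>\<^sub>M \<mu> \<Otimes>\<^sub>M \<nu>"
  proof (rule measurable_Pair)
    show "(\<lambda>z. \<lambda>g\<in>carrier G. fst (z g)) \<in> borel_of ?L \<rightarrow>\<^sub>M \<mu>"
      unfolding measurable_Prob_cod [OF \<mu>]
      by (intro continuous_map_measurable_borel_of continuous_map_configs_map continuous_map_fst)
    show "(\<lambda>z. \<lambda>g\<in>carrier G. snd (z g)) \<in> borel_of ?L \<rightarrow>\<^sub>M \<nu>"
      unfolding measurable_Prob_cod [OF \<nu>]
      by (intro continuous_map_measurable_borel_of continuous_map_configs_map continuous_map_snd)
  qed
  have z: "(\<lambda>(x, y). zip_on (carrier G) x y) \<in> \<mu> \<Otimes>\<^sub>M \<nu> \<rightarrow>\<^sub>M borel_of ?L"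
    by (intro measurable_zip_pair X Y G \<mu> \<nu>)
  have "distr ?\<rho> (\<mu> \<Otimes>\<^sub>M \<nu>) ?u = distr (\<mu> \<Otimes>\<^sub>M \<nu>) (\<mu> \<Otimes>\<^sub>M \<nu>) (?u \<circ> (\<lambda>(x, y). zip_on (carrier G) x y))"
    unfolding prod_config_measure_def by (rule distr_distr [OF u z])
  also have "\<dots> = distr (\<mu> \<Otimes>\<^sub>M \<nu>) (\<mu> \<Otimes>\<^sub>M \<nu>) (\<lambda>p. p)"
  proof (rule distr_cong [OF refl refl])
    fix p assume "p \<in> space (\<mu> \<Otimes>\<^sub>M \<nu>)"
    then obtain x y where p: "p = (x, y)" "x \<in> extensional (carrier G)" "y \<in> extensional (carrier G)"
      using Prob_space [OF \<mu>] Prob_space [OF \<nu>] by (auto simp: space_pair_measure PiE_iff)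
    have "restrict x (carrier G) = x" "restrict y (carrier G) = y"
      using p by (simp_all add: extensional_restrict)
    then show "(?u \<circ> (\<lambda>(x, y). zip_on (carrier G) x y)) p = p"
      by (simp add: p(1) zip_on_def cong: restrict_cong)
  qed
  finally have "distr ?\<rho> (\<mu> \<Otimes>\<^sub>M \<nu>) ?u = \<mu> \<Otimes>\<^sub>M \<nu>" by (simp add: distr_id)
  moreover have "?u (right_shift G g z) = map_prod (right_shift G g) (right_shift G g) (?u z)" if "g \<in> carrier G" for g z
    using that by (auto simp: right_shift_def fun_eq_iff)
  ultimately show ?thesis
    unfolding factor_map_def measurable_Prob_dom [OF \<rho>] using u by (intro conjI ballI AE_I2)
qed

lemma right_shift_measurable:
  assumes "group G" "h \<in> carrier G" "\<mu> \<in> Prob (configs (carrier G) X)"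
  shows "right_shift G h \<in> \<mu> \<rightarrow>\<^sub>M \<mu>"
  using continuous_map_measurable_borel_of [OF continuous_map_right_shift [OF assms(1,2), of X]]
  unfolding measurable_Prob_dom [OF assms(3)] measurable_Prob_cod [OF assms(3)] .

lemma prod_config_measure_shift_invariant:
  assumes G: "group G" "countable (carrier G)" and X: "compact_metrizable X" and Y: "compact_metrizable Y"
    and \<mu>: "\<mu> \<in> Prob (configs (carrier G) X)" and \<nu>: "\<nu> \<in> Prob (configs (carrier G) Y)"
    and h: "h \<in> carrier G" and inv: "distr \<mu> \<mu> (right_shift G h) = \<mu>" "distr \<nu> \<nu> (right_shift G h) = \<nu>"
  shows "distr (prod_config_measure (carrier G) X Y \<mu> \<nu>) (prod_config_measure (carrier G) X Y \<mu> \<nu>) (right_shift G h)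
    = prod_config_measure (carrier G) X Y \<mu> \<nu>"
proof -
  let ?\<rho> = "prod_config_measure (carrier G) X Y \<mu> \<nu>"
  let ?L = "configs (carrier G) (prod_topology X Y)"
  let ?z = "\<lambda>(x, y). zip_on (carrier G) x y"
  let ?S = "\<lambda>(x, y). (right_shift G h x, right_shift G h y)"
  interpret N: prob_space \<nu> using \<nu> by (rule Prob_prob_space)
  have \<rho>: "?\<rho> \<in> Prob ?L" by (intro prod_config_measure_in_Prob X Y G \<mu> \<nu>)
  note m = right_shift_measurable [OF G(1) h \<mu>] right_shift_measurable [OF G(1) h \<nu>]
  have S: "?S \<in> \<mu> \<Otimes>\<^sub>M \<nu> \<rightarrow>\<^sub>M \<mu> \<Otimes>\<^sub>M \<nu>" using m by measurable
  have z: "?z \<in> \<mu> \<Otimes>\<^sub>M \<nu> \<rightarrow>\<^sub>M borel_of ?L" by (intro measurable_zip_pair X Y G \<mu> \<nu>)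
  have s: "right_shift G h \<in> borel_of ?L \<rightarrow>\<^sub>M borel_of ?L"
    by (intro continuous_map_measurable_borel_of continuous_map_right_shift G h)
  have PP: "distr (\<mu> \<Otimes>\<^sub>M \<nu>) (\<mu> \<Otimes>\<^sub>M \<nu>) ?S = \<mu> \<Otimes>\<^sub>M \<nu>"
    using pair_measure_distr [OF m] by (simp add: inv N.sigma_finite_measure_axioms)
  have "distr ?\<rho> ?\<rho> (right_shift G h) = distr ?\<rho> (borel_of ?L) (right_shift G h)"
    using Prob_sets [OF \<rho>] by (intro distr_cong) auto
  also have "\<dots> = distr (\<mu> \<Otimes>\<^sub>M \<nu>) (borel_of ?L) (right_shift G h \<circ> ?z)"
    unfolding prod_config_measure_def by (rule distr_distr [OF s z])
  also have "right_shift G h \<circ> ?z = ?z \<circ> ?S"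
    using right_shift_zip_on [OF G(1) h] by (auto simp: fun_eq_iff)
  also have "distr (\<mu> \<Otimes>\<^sub>M \<nu>) (borel_of ?L) (?z \<circ> ?S) = distr (distr (\<mu> \<Otimes>\<^sub>M \<nu>) (\<mu> \<Otimes>\<^sub>M \<nu>) ?S) (borel_of ?L) ?z"
    by (rule distr_distr [OF z S, symmetric])
  also have "\<dots> = ?\<rho>" by (simp add: PP prod_config_measure_def)
  finally show ?thesis .
qed

context sofic_group begin

text \<open>The source of models is a process \<open>\<mu>\<close> of which \<open>M\<close> is a factor via \<open>\<gamma>\<close>. Only \<open>\<Psi> (\<gamma> x) \<in> Z\<close> is taken from
  \<open>x\<close>; together with the point \<open>\<beta>' y \<in> N\<close> it is sent by \<open>N \<times> Z \<cong> M\<close> to a point of \<open>M\<close>, and by \<open>\<alpha>\<close> on to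
  the process \<open>\<mu>'\<close>. The composite \<open>\<theta>\<close> is a factor map of \<open>\<mu> \<times> \<nu>'\<close>, it satisfies \<open>\<Phi>' (\<theta> (x, y)) = y\<close>
  almost everywhere, and models of \<open>\<mu> \<times> \<nu>'\<close> above \<open>y\<close> can be pushed forward along it.\<close>

theorem complemented_factor_model_surjective:
  fixes X :: "'x topology" and \<mu> :: "('g \<Rightarrow> 'x) measure" and M :: "'s measure" and N :: "'y measure"
  assumes X: "compact_metrizable X" and \<F>: "countable_separating X \<F>"
    and \<mu>: "\<mu> \<in> Prob (configs (carrier G) X)"
    and \<mu>_inv: "\<And>g. g \<in> carrier G \<Longrightarrow> distr \<mu> \<mu> (right_shift G g) = \<mu>"
    and m: "\<And>n. m n \<in> Prob (configs (V n) X)" and dec: "decorrelates X \<F> m \<mu>"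
    and \<gamma>: "factor_map G \<mu> (right_shift G) M T \<gamma>"
    and T: "\<And>g. g \<in> carrier G \<Longrightarrow> T g \<in> M \<rightarrow>\<^sub>M M" "\<And>g. g \<in> carrier G \<Longrightarrow> distr M M (T g) = M"
    and N: "g_system G N S"
    and compl: "complemented TYPE('z) G M T N S \<Phi>"
  shows "model_surjective TYPE('a) TYPE('b) G V \<sigma> M T N S \<Phi>"
  unfolding model_surjective_def
proof (intro allI impI, elim conjE)
  fix d :: "'a metric" and \<mu>' and e :: "'b metric" and \<nu>' \<alpha> \<beta> \<Phi>'
  assume pd: "metric_process G d \<mu>'" and pe: "metric_process G e \<nu>'"
    and \<alpha>: "system_iso G M T \<mu>' (right_shift G) \<alpha>" and \<beta>: "system_iso G N S \<nu>' (right_shift G) \<beta>"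
    and \<Phi>': "factor_map G \<mu>' (right_shift G) \<nu>' (right_shift G) \<Phi>'"
    and comm: "AE x in M. \<Phi>' (\<alpha> x) = \<beta> (\<Phi> x)"
  define A where "A = mtopology_of d"
  define B where "B = mtopology_of e"
  note I = countable_carrier
  have A: "compact_metrizable A" and B: "compact_metrizable B"
    using pd pe compact_metrizable_mtopology_of by (auto simp: metric_process_def A_def B_def)
  have \<mu>': "\<mu>' \<in> Prob (configs (carrier G) A)" and \<nu>': "\<nu>' \<in> Prob (configs (carrier G) B)"
    using pd pe by (auto simp: metric_process_def A_def B_def)
  have \<nu>'_inv: "\<And>g. g \<in> carrier G \<Longrightarrow> distr \<nu>' \<nu>' (right_shift G g) = \<nu>'"
    using pe by (simp add: metric_process_def)
  obtain Z :: "'z measure" and R \<Psi> where Z: "g_system G Z R" and \<Psi>: "factor_map G M T Z R \<Psi>"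
    and iso: "system_iso G M T (N \<Otimes>\<^sub>M Z) (\<lambda>g. map_prod (S g) (R g)) (\<lambda>x. (\<Phi> x, \<Psi> x))"
    using compl unfolding complemented_def by blast
  have pr: "prob_space \<mu>" "prob_space \<nu>'" using \<mu> \<nu>' Prob_prob_space by auto
  obtain \<Xi> where \<Xi>: "factor_map G (N \<Otimes>\<^sub>M Z) (\<lambda>g. map_prod (S g) (R g)) M T \<Xi>"
    and \<Xi>_inv: "AE p in N \<Otimes>\<^sub>M Z. (\<Phi> (\<Xi> p), \<Psi> (\<Xi> p)) = p"
    by (rule factor_map_inverse [OF iso T]) auto
  have S: "\<And>g. g \<in> carrier G \<Longrightarrow> S g \<in> N \<rightarrow>\<^sub>M N" "\<And>g. g \<in> carrier G \<Longrightarrow> distr N N (S g) = N"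
    using N by (simp_all add: g_system_def)
  obtain \<beta>' where \<beta>': "factor_map G \<nu>' (right_shift G) N S \<beta>'" and \<beta>'_inv: "AE y in \<nu>'. \<beta> (\<beta>' y) = y"
    by (rule factor_map_inverse [OF \<beta> S]) auto
  define \<rho> where "\<rho> = prod_config_measure (carrier G) X B \<mu> \<nu>'"
  have \<rho>: "\<rho> \<in> Prob (configs (carrier G) (prod_topology X B))"
    unfolding \<rho>_def by (intro prod_config_measure_in_Prob X B I \<mu> \<nu>')
  define fstc where "fstc z = (\<lambda>g\<in>carrier G. fst (z g))" for z :: "'g \<Rightarrow> 'x \<times> 'b"
  define sndc where "sndc z = (\<lambda>g\<in>carrier G. snd (z g))" for z :: "'g \<Rightarrow> 'x \<times> 'b"
  define \<tau> where "\<tau> z = (\<beta>' (sndc z), \<Psi> (\<gamma> (fstc z)))" for z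
  have unzip: "factor_map G \<rho> (right_shift G) (\<mu> \<Otimes>\<^sub>M \<nu>') (\<lambda>g. map_prod (right_shift G g) (right_shift G g)) (\<lambda>z. (fstc z, sndc z))"
    unfolding \<rho>_def fstc_def sndc_def by (intro factor_map_unzip X B I \<mu> \<nu>' is_group)
  have sndf: "factor_map G \<rho> (right_shift G) \<nu>' (right_shift G) sndc"
    using factor_map_comp [OF unzip factor_map_snd [OF pr]] by simp
  have \<tau>: "factor_map G \<rho> (right_shift G) (N \<Otimes>\<^sub>M Z) (\<lambda>g. map_prod (S g) (R g)) \<tau>"
    using factor_map_comp [OF factor_map_comp [OF unzip factor_map_swap [OF pr]]
        factor_map_prod [OF \<beta>' factor_map_comp [OF \<gamma> \<Psi>] pr(2,1)]]
    by (simp add: \<tau>_def [abs_def])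
  have \<Xi>\<tau>: "factor_map G \<rho> (right_shift G) M T (\<lambda>z. \<Xi> (\<tau> z))"
    by (rule factor_map_comp [OF \<tau> \<Xi>])
  define \<theta> where "\<theta> z = \<alpha> (\<Xi> (\<tau> z))" for z
  have \<alpha>f: "factor_map G M T \<mu>' (right_shift G) \<alpha>" using \<alpha> by (simp add: system_iso_def)
  have \<theta>: "factor_map G \<rho> (right_shift G) \<mu>' (right_shift G) \<theta>"
    unfolding \<theta>_def by (rule factor_map_comp [OF \<Xi>\<tau> \<alpha>f])
  have graph: "AE z in \<rho>. \<Phi>' (\<theta> z) = sndc z"
    using factor_map_AE [OF \<tau> \<Xi>_inv] factor_map_AE [OF \<Xi>\<tau> comm] factor_map_AE [OF sndf \<beta>'_inv]
  proof eventually_elim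
    case (elim z)
    then have "\<Phi> (\<Xi> (\<tau> z)) = \<beta>' (sndc z)" by (simp add: \<tau>_def)
    then show ?case using elim by (simp add: \<theta>_def)
  qed
  let ?AB = "configs (carrier G) (prod_topology A B)"
  have \<theta>m: "\<theta> \<in> \<rho> \<rightarrow>\<^sub>M borel_of (configs (carrier G) A)"
    using factor_mapD(1) [OF \<theta>] by (simp add: measurable_Prob_cod [OF \<mu>'])
  have sm: "sndc \<in> \<rho> \<rightarrow>\<^sub>M borel_of (configs (carrier G) B)"
    using factor_mapD(1) [OF sndf] by (simp add: measurable_Prob_cod [OF \<nu>'])
  have \<Phi>'m: "(\<lambda>z. \<Phi>' (\<theta> z)) \<in> \<rho> \<rightarrow>\<^sub>M borel_of (configs (carrier G) B)"
    using measurable_compose [OF factor_mapD(1) [OF \<theta>] factor_mapD(1) [OF \<Phi>']] by (simp add: measurable_Prob_cod [OF \<nu>'])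
  have \<theta>s: "(\<lambda>z. zip_on (carrier G) (\<theta> z) (sndc z)) \<in> \<rho> \<rightarrow>\<^sub>M borel_of ?AB"
    by (rule measurable_zip_on [OF A B I \<theta>m sm])
  \<comment> \<open>the law of \<open>(\<theta>, y)\<close> is that of \<open>(\<theta>, \<Phi>' \<theta>)\<close>, and \<open>\<theta>\<close> has law \<open>\<mu>'\<close>\<close>
  have joining: "graphical_joining G A B \<mu>' \<Phi>' = distr \<rho> (borel_of ?AB) (\<lambda>z. zip_on (carrier G) (\<theta> z) (sndc z))"
  proof -
    have id: "(\<lambda>x. x) \<in> \<mu>' \<rightarrow>\<^sub>M borel_of (configs (carrier G) A)"
      by (rule measurable_ident_sets [OF Prob_sets [OF \<mu>']])
    have "\<Phi>' \<in> \<mu>' \<rightarrow>\<^sub>M borel_of (configs (carrier G) B)"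
      using factor_mapD(1) [OF \<Phi>'] by (simp add: measurable_Prob_cod [OF \<nu>'])
    from measurable_zip_on [OF A B I id this]
    have z: "(\<lambda>x. zip_on (carrier G) x (\<Phi>' x)) \<in> \<mu>' \<rightarrow>\<^sub>M borel_of ?AB" .
    have "graphical_joining G A B \<mu>' \<Phi>' = distr (distr \<rho> \<mu>' \<theta>) (borel_of ?AB) (\<lambda>x. zip_on (carrier G) x (\<Phi>' x))"
      by (simp add: graphical_joining_def factor_mapD(2) [OF \<theta>])
    also have "\<dots> = distr \<rho> (borel_of ?AB) (\<lambda>z. zip_on (carrier G) (\<theta> z) (\<Phi>' (\<theta> z)))"
      by (subst distr_distr [OF z factor_mapD(1) [OF \<theta>]]) (simp add: comp_def)
    also have "\<dots> = distr \<rho> (borel_of ?AB) (\<lambda>z. zip_on (carrier G) (\<theta> z) (sndc z))"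
    proof (rule distr_cong_AE [OF refl refl])
      show "AE z in \<rho>. zip_on (carrier G) (\<theta> z) (\<Phi>' (\<theta> z)) = zip_on (carrier G) (\<theta> z) (sndc z)"
        using graph by eventually_elim simp
      show "(\<lambda>z. zip_on (carrier G) (\<theta> z) (\<Phi>' (\<theta> z))) \<in> \<rho> \<rightarrow>\<^sub>M borel_of ?AB"
        by (rule measurable_zip_on [OF A B I \<theta>m \<Phi>'m])
    qed (rule \<theta>s)
    finally show ?thesis .
  qed
  show "process_model_surjective G V \<sigma> d \<mu>' e \<nu>' \<Phi>'"
    unfolding process_model_surjective_def Let_def A_def [symmetric] B_def [symmetric]
  proof (intro allI impI, elim conjE)
    fix r :: "nat \<Rightarrow> nat" and y
    assume r: "strict_mono r" and y: "\<forall>i. y i \<in> topspace (configs (V (r i)) B)"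
      and lim: "limitin (weak_star (configs (carrier G) B)) (\<lambda>i. empirical G (V (r i)) (\<sigma> (r i)) B (y i)) \<nu>' sequentially"
    interpret sub: sofic_group G "\<lambda>i. V (r i)" "\<lambda>i. \<sigma> (r i)"
      by (rule sofic_group_subseq [OF r])
    obtain \<G> where \<G>: "countable_separating B \<G>"
      using compact_metrizable_countable_separating [OF B] by blast
    have "sub.decorrelates X \<F> (\<lambda>i. m (r i)) \<mu>"
      unfolding sub.decorrelates_def
    proof
      fix l assume "l \<in> lists (coordinate_functions (carrier G) \<F>)"
      with dec have "(\<lambda>n. average (V n) (\<lambda>v. average (V n) (\<lambda>w.
        \<bar>\<integral>x. (monomial l (pullback G (\<sigma> n) v x) - (\<integral>z. monomial l z \<partial>\<mu>))
            * (monomial l (pullback G (\<sigma> n) w x) - (\<integral>z. monomial l z \<partial>\<mu>)) \<partial>m n\<bar>))) \<longlonglongrightarrow> 0"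
        unfolding decorrelates_def by blast
      from filterlim_compose [OF this filterlim_subseq [OF r]]
      show "(\<lambda>n. average (V (r n)) (\<lambda>v. average (V (r n)) (\<lambda>w.
        \<bar>\<integral>x. (monomial l (pullback G (\<sigma> (r n)) v x) - (\<integral>z. monomial l z \<partial>\<mu>))
            * (monomial l (pullback G (\<sigma> (r n)) w x) - (\<integral>z. monomial l z \<partial>\<mu>)) \<partial>m (r n)\<bar>))) \<longlonglongrightarrow> 0" .
    qed
    then obtain x where x: "\<And>i. x i \<in> topspace (configs (V (r i)) X)"
      and xlim: "limitin (weak_star (configs (carrier G) (prod_topology X B)))
        (\<lambda>i. empirical G (V (r i)) (\<sigma> (r i)) (prod_topology X B) (zip_on (V (r i)) (x i) (y i))) \<rho> sequentially"
      using sub.exists_independent_models [OF X B \<F> \<G> \<mu> m(1) _ y [rule_format] lim] unfolding \<rho>_def by blast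
    define w where "w i = zip_on (V (r i)) (x i) (y i)" for i
    interpret mod: model_sequence G "\<lambda>i. V (r i)" "\<lambda>i. \<sigma> (r i)" "prod_topology X B" \<rho> w
    proof
      show "w i \<in> topspace (configs (V (r i)) (prod_topology X B))" for i
        unfolding w_def using x y by (intro zip_on_in_configs) auto
      show "limitin (weak_star (configs (carrier G) (prod_topology X B)))
        (\<lambda>i. empirical G (V (r i)) (\<sigma> (r i)) (prod_topology X B) (w i)) \<rho> sequentially"
        using xlim by (simp add: w_def)
    qed (use compact_metrizable_prod [OF X B] in auto)
    have \<rho>_inv: "distr \<rho> \<rho> (right_shift G g) = \<rho>" if "g \<in> carrier G" for g
      unfolding \<rho>_def using that
      by (intro prod_config_measure_shift_invariant is_group I X B \<mu> \<nu>' \<mu>_inv \<nu>'_inv)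
    obtain a where a: "\<And>i. a i \<in> topspace (configs (V (r i)) A)"
      and alim: "limitin (weak_star (configs (carrier G) (prod_topology A (prod_topology X B))))
        (\<lambda>i. empirical G (V (r i)) (\<sigma> (r i)) (prod_topology A (prod_topology X B)) (zip_on (V (r i)) (a i) (w i)))
        (distr \<rho> (borel_of (configs (carrier G) (prod_topology A (prod_topology X B)))) (\<lambda>z. zip_on (carrier G) (\<theta> z) z))
        sequentially"
    proof (rule mod.factor_map_lifts_models [OF A, of \<theta>])
      show "distr \<rho> \<rho> (right_shift G g) = \<rho>" if "g \<in> carrier G" for g by (rule \<rho>_inv [OF that])
      show "\<theta> \<in> \<rho> \<rightarrow>\<^sub>M borel_of (configs (carrier G) A)" by (rule \<theta>m)
      show "AE z in \<rho>. \<theta> (right_shift G g z) = right_shift G g (\<theta> z)" if "g \<in> carrier G" for g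
        by (rule factor_mapD(3) [OF \<theta> that])
    qed blast
    let ?AXB = "configs (carrier G) (prod_topology A (prod_topology X B))"
    \<comment> \<open>the lift comes with the whole model \<open>w = (x, y)\<close>; \<open>\<pi>\<close> forgets \<open>x\<close>\<close>
    define \<pi> where "\<pi> z = (\<lambda>g\<in>carrier G. (fst (z g), snd (snd (z g))))" for z :: "'g \<Rightarrow> 'a \<times> 'x \<times> 'b"
    have \<pi>: "continuous_map ?AXB ?AB \<pi>"
      unfolding \<pi>_def
      by (intro continuous_map_configs_map continuous_map_pairedI continuous_map_fst
          continuous_map_compose [OF continuous_map_snd continuous_map_snd, unfolded comp_def])
    have zipa: "zip_on (V (r i)) (a i) (y i) \<in> topspace (configs (V (r i)) (prod_topology A B))" for i
      using y by (intro zip_on_in_configs a) auto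
    have zipw: "zip_on (V (r i)) (a i) (w i) \<in> topspace (configs (V (r i)) (prod_topology A (prod_topology X B)))" for i
      by (intro zip_on_in_configs a mod.w)
    have id: "(\<lambda>z. z) \<in> \<rho> \<rightarrow>\<^sub>M borel_of (configs (carrier G) (prod_topology X B))"
      by (rule measurable_ident_sets [OF Prob_sets [OF \<rho>]])
    have zm: "(\<lambda>z. zip_on (carrier G) (\<theta> z) z) \<in> \<rho> \<rightarrow>\<^sub>M borel_of ?AXB"
      by (rule measurable_zip_on [OF A compact_metrizable_prod [OF X B] I \<theta>m id])
    have "limitin (weak_star ?AB)
      (\<lambda>i. empirical G (V (r i)) (\<sigma> (r i)) (prod_topology A B) (zip_on (V (r i)) (a i) (y i)))
      (graphical_joining G A B \<mu>' \<Phi>') sequentially"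
    proof (rule weak_star_limitI)
      show "graphical_joining G A B \<mu>' \<Phi>' \<in> Prob ?AB"
        unfolding joining by (intro distr_in_Prob \<theta>s Prob_prob_space [OF \<rho>])
      show "\<forall>\<^sub>F i in sequentially. empirical G (V (r i)) (\<sigma> (r i)) (prod_topology A B) (zip_on (V (r i)) (a i) (y i)) \<in> Prob ?AB"
        using sub.eventually_nonempty by eventually_elim (rule sub.empirical_in_Prob [OF zipa])
      fix f assume f: "continuous_map ?AB euclideanreal f"
      have f\<pi>: "continuous_map ?AXB euclideanreal (\<lambda>z. f (\<pi> z))"
        using continuous_map_compose [OF \<pi> f] by (simp add: comp_def)
      have 1: "(\<integral>z. f z \<partial>empirical G (V (r i)) (\<sigma> (r i)) (prod_topology A B) (zip_on (V (r i)) (a i) (y i)))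
        = (\<integral>z. f (\<pi> z) \<partial>empirical G (V (r i)) (\<sigma> (r i)) (prod_topology A (prod_topology X B)) (zip_on (V (r i)) (a i) (w i)))" for i
        unfolding sub.integral_empirical [OF zipa f] sub.integral_empirical [OF zipw f\<pi>]
      proof (rule average_cong)
        fix v assume v: "v \<in> V (r i)"
        have "pullback G (\<sigma> (r i)) v (zip_on (V (r i)) (a i) (y i)) = \<pi> (pullback G (\<sigma> (r i)) v (zip_on (V (r i)) (a i) (w i)))"
          using sub.\<sigma>_in_V v by (auto simp: \<pi>_def pullback_def zip_on_def w_def fun_eq_iff)
        then show "f (pullback G (\<sigma> (r i)) v (zip_on (V (r i)) (a i) (y i))) = f (\<pi> (pullback G (\<sigma> (r i)) v (zip_on (V (r i)) (a i) (w i))))"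
          by simp
      qed
      have 2: "(\<integral>z. f z \<partial>graphical_joining G A B \<mu>' \<Phi>')
        = (\<integral>z. f (\<pi> z) \<partial>distr \<rho> (borel_of ?AXB) (\<lambda>z. zip_on (carrier G) (\<theta> z) z))"
      proof -
        have "\<pi> (zip_on (carrier G) (\<theta> z) z) = zip_on (carrier G) (\<theta> z) (sndc z)" for z
          by (auto simp: \<pi>_def zip_on_def sndc_def fun_eq_iff)
        then show ?thesis
          unfolding joining integral_distr [OF \<theta>s continuous_map_borel_measurable [OF f]]
            integral_distr [OF zm continuous_map_borel_measurable [OF f\<pi>]] by simp
      qed
      show "(\<lambda>i. \<integral>z. f z \<partial>empirical G (V (r i)) (\<sigma> (r i)) (prod_topology A B) (zip_on (V (r i)) (a i) (y i)))
        \<longlonglongrightarrow> (\<integral>z. f z \<partial>graphical_joining G A B \<mu>' \<Phi>')"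
        unfolding 1 2 by (rule weak_star_limitD(3) [OF alim f\<pi>])
    qed
    then show "\<exists>x. (\<forall>i. x i \<in> topspace (configs (V (r i)) A)) \<and>
      limitin (weak_star ?AB)
        (\<lambda>i. empirical G (V (r i)) (\<sigma> (r i)) (prod_topology A B) (zip_on (V (r i)) (x i) (y i)))
        (graphical_joining G A B \<mu>' \<Phi>') sequentially"
      using a by blast
  qed
qed

end

section \<open>Bernoulli shifts\<close>

text \<open>The identity is measurable in both directions: coordinates are continuous, and they
  determine measurability into the Borel sets of the product topology.\<close>

lemma sets_PiM_borel_of:
  assumes X: "compact_metrizable X" and I: "countable I" and \<kappa>: "sets \<kappa> = sets (borel_of X)"
  shows "sets (PiM I (\<lambda>_. \<kappa>)) = sets (borel_of (configs I X))"
proof -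
  have sp: "space \<kappa> = topspace X" using sets_eq_imp_space_eq [OF \<kappa>] by simp
  have space: "space (PiM I (\<lambda>_. \<kappa>)) = topspace (configs I X)"
    by (simp add: space_PiM sp)
  obtain \<F> where \<F>: "countable_separating X \<F>"
    using compact_metrizable_countable_separating [OF X] by blast
  have id1: "(\<lambda>x. x) \<in> PiM I (\<lambda>_. \<kappa>) \<rightarrow>\<^sub>M borel_of (configs I X)"
  proof (rule measurable_borel_ofI_separating)
    show "compact_metrizable (configs I X)" by (rule compact_metrizable_configs [OF X I])
    show "countable_separating (configs I X) (coordinate_functions I \<F>)"
      by (rule countable_separating_configs [OF \<F> I])
    show "(\<lambda>x. x) \<in> space (PiM I (\<lambda>_. \<kappa>)) \<rightarrow> topspace (configs I X)" by (simp add: space)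
    fix h assume "h \<in> coordinate_functions I \<F>"
    then obtain f i where fi: "f \<in> \<F>" "i \<in> I" "h = (\<lambda>z. f (z i))"
      by (auto simp: coordinate_functions_def)
    have "continuous_map X euclideanreal f" using \<F> fi(1) by (simp add: countable_separating_def)
    then have "f \<in> borel_measurable \<kappa>"
      using continuous_map_borel_measurable measurable_cong_sets [OF \<kappa> refl] by blast
    from measurable_compose [OF measurable_component_singleton [OF fi(2)] this]
    show "(\<lambda>x. h x) \<in> borel_measurable (PiM I (\<lambda>_. \<kappa>))" by (simp add: fi(3))
  qed
  have id2: "(\<lambda>x. x) \<in> borel_of (configs I X) \<rightarrow>\<^sub>M PiM I (\<lambda>_. \<kappa>)"
  proof (rule measurable_PiM_single')
    show "(\<lambda>x. x i) \<in> borel_of (configs I X) \<rightarrow>\<^sub>M \<kappa>" if "i \<in> I" for i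
      using continuous_map_measurable_borel_of [OF continuous_map_product_projection [OF that, of "\<lambda>_. X"]]
      by (simp add: measurable_cong_sets [OF refl \<kappa>])
    show "(\<lambda>x. x) \<in> space (borel_of (configs I X)) \<rightarrow> (\<Pi>\<^sub>E i\<in>I. space \<kappa>)" by (simp add: sp)
  qed
  show ?thesis
  proof (rule subset_antisym; rule subsetI)
    fix U assume U: "U \<in> sets (PiM I (\<lambda>_. \<kappa>))"
    from measurable_sets [OF id2 U] sets.sets_into_space [OF U]
    show "U \<in> sets (borel_of (configs I X))" unfolding space by (simp add: Int_absorb2)
  next
    fix U assume U: "U \<in> sets (borel_of (configs I X))"
    from measurable_sets [OF id1 U] sets.sets_into_space [OF U]
    show "U \<in> sets (PiM I (\<lambda>_. \<kappa>))" unfolding space by (simp add: Int_absorb2)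
  qed
qed

lemma PiM_in_Prob:
  assumes "compact_metrizable X" "countable I" "\<kappa> \<in> Prob X"
  shows "PiM I (\<lambda>_. \<kappa>) \<in> Prob (configs I X)"
  using sets_PiM_borel_of [OF assms(1,2) Prob_sets [OF assms(3)]] prob_space_PiM [of I "\<lambda>_. \<kappa>"]
    Prob_prob_space [OF assms(3)] by (simp add: Prob_def)

lemma monomial_eq_prod:
  assumes "l \<in> lists (coordinate_functions I \<F>)" and \<F>: "\<And>f. f \<in> \<F> \<Longrightarrow> continuous_map X euclideanreal f"
  obtains E \<phi> where "finite E" "E \<subseteq> I" "\<And>i. continuous_map X euclideanreal (\<phi> i)"
    "\<And>x. monomial l x = (\<Prod>i\<in>E. \<phi> i (x i))"
proof -
  have "\<exists>E \<phi>. finite E \<and> E \<subseteq> I \<and> (\<forall>i. continuous_map X euclideanreal (\<phi> i)) \<and> (\<forall>i. i \<notin> E \<longrightarrow> \<phi> i = (\<lambda>_. 1)) \<and>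
    (\<forall>x. monomial l x = (\<Prod>i\<in>E. \<phi> i (x i)))"
    using assms(1)
  proof (induction l)
    case Nil
    then show ?case by (intro exI [of _ "{}"] exI [of _ "\<lambda>_ _. 1"]) simp
  next
    case (Cons h l)
    then obtain E \<phi> where E: "finite E" "E \<subseteq> I" and \<phi>: "\<And>i. continuous_map X euclideanreal (\<phi> i)"
      "\<And>i. i \<notin> E \<Longrightarrow> \<phi> i = (\<lambda>_. 1)" and eq: "\<And>x. monomial l x = (\<Prod>i\<in>E. \<phi> i (x i))" by blast
    from Cons(1) obtain f j where fj: "f \<in> \<F>" "j \<in> I" "h = (\<lambda>z. f (z j))"
      by (auto simp: coordinate_functions_def)
    define \<psi> where "\<psi> = \<phi>(j := \<lambda>y. f y * \<phi> j y)"
    have "monomial (h # l) x = (\<Prod>i\<in>insert j E. \<psi> i (x i))" for x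
    proof -
      have "(\<Prod>i\<in>insert j E. \<psi> i (x i)) = \<psi> j (x j) * (\<Prod>i\<in>E - {j}. \<psi> i (x i))"
        using E(1) by (rule prod.insert_remove)
      also have "(\<Prod>i\<in>E - {j}. \<psi> i (x i)) = (\<Prod>i\<in>E - {j}. \<phi> i (x i))"
        by (intro prod.cong) (auto simp: \<psi>_def)
      also have "\<psi> j (x j) = f (x j) * \<phi> j (x j)" by (simp add: \<psi>_def)
      also have "f (x j) * \<phi> j (x j) * (\<Prod>i\<in>E - {j}. \<phi> i (x i)) = f (x j) * (\<Prod>i\<in>E. \<phi> i (x i))"
      proof (cases "j \<in> E")
        case True
        then show ?thesis using prod.remove [OF E(1), of j "\<lambda>i. \<phi> i (x i)"] by simp
      next
        case False
        then show ?thesis using \<phi>(2) [OF False] by simp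
      qed
      finally show ?thesis by (simp add: eq fj(3))
    qed
    moreover have "continuous_map X euclideanreal (\<psi> i)" for i
      using \<phi>(1) \<F> [OF fj(1)] by (simp add: \<psi>_def continuous_map_real_mult)
    moreover have "\<psi> i = (\<lambda>_. 1)" if "i \<notin> insert j E" for i
      using \<phi>(2) that by (simp add: \<psi>_def)
    ultimately show ?case
      using E fj(2) by (intro exI [of _ "insert j E"] exI [of _ \<psi>]) simp
  qed
  then show ?thesis using that by blast
qed

text \<open>Distinct coordinates of a product measure are independent and identically distributed.\<close>

lemma integral_PiM_prod_reindex:
  assumes \<kappa>: "prob_space \<kappa>" and J: "finite J" "inj_on \<tau> J" "\<tau> \<in> J \<rightarrow> I"
    and \<phi>: "\<And>j. j \<in> J \<Longrightarrow> integrable \<kappa> (\<phi> j :: 'x \<Rightarrow> real)"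
  shows "(\<integral>x. (\<Prod>j\<in>J. \<phi> j (x (\<tau> j))) \<partial>PiM I (\<lambda>_. \<kappa>)) = (\<Prod>j\<in>J. \<integral>y. \<phi> j y \<partial>\<kappa>)"
proof -
  interpret prob_space \<kappa> by fact
  interpret product_sigma_finite "\<lambda>_. \<kappa>" by unfold_locales
  have t: "(\<lambda>x. \<lambda>j\<in>J. x (\<tau> j)) \<in> PiM I (\<lambda>_. \<kappa>) \<rightarrow>\<^sub>M PiM J (\<lambda>_. \<kappa>)"
    using J(3) by (intro measurable_restrict measurable_component_singleton) auto
  have m: "(\<lambda>x. \<Prod>j\<in>J. \<phi> j (x j)) \<in> borel_measurable (PiM J (\<lambda>_. \<kappa>))"
    using \<phi> by (intro borel_measurable_prod measurable_compose [OF measurable_component_singleton]) auto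
  have "(\<integral>x. (\<Prod>j\<in>J. \<phi> j (x (\<tau> j))) \<partial>PiM I (\<lambda>_. \<kappa>))
    = (\<integral>x. (\<Prod>j\<in>J. \<phi> j ((\<lambda>j\<in>J. x (\<tau> j)) j)) \<partial>PiM I (\<lambda>_. \<kappa>))"
    by (intro Bochner_Integration.integral_cong refl prod.cong) simp
  also have "\<dots> = (\<integral>x. (\<Prod>j\<in>J. \<phi> j (x j)) \<partial>distr (PiM I (\<lambda>_. \<kappa>)) (PiM J (\<lambda>_. \<kappa>)) (\<lambda>x. \<lambda>j\<in>J. x (\<tau> j)))"
    by (rule integral_distr [OF t m, symmetric])
  also have "distr (PiM I (\<lambda>_. \<kappa>)) (PiM J (\<lambda>_. \<kappa>)) (\<lambda>x. \<lambda>j\<in>J. x (\<tau> j)) = PiM J (\<lambda>_. \<kappa>)"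
    using distr_PiM_reindex [of I "\<lambda>_. \<kappa>" \<tau> J] \<kappa> J(2,3) by simp
  also have "(\<integral>x. (\<Prod>j\<in>J. \<phi> j (x j)) \<partial>PiM J (\<lambda>_. \<kappa>)) = (\<Prod>j\<in>J. \<integral>y. \<phi> j y \<partial>\<kappa>)"
    by (rule product_integral_prod [OF J(1) \<phi>])
  finally show ?thesis .
qed

context sofic_group begin

text \<open>A monomial \<open>f\<close> depends on the coordinates in a finite set \<open>E\<close>, so \<open>f(\<Pi>\<^sub>v x)\<close> depends on \<open>x\<close> at the
  points \<open>\<sigma>\<^sup>g v\<close>, \<open>g \<in> E\<close>. If the points belonging to \<open>v\<close> and \<open>w\<close> are all distinct, the expectation is
  exactly \<open>0\<close>. The numbers \<open>b n v\<close> and \<open>e n v w\<close> count the coincidences for one vertex and between two.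
  The average of \<open>b n\<close> tends to \<open>0\<close> because \<open>\<Sigma>\<close> is asymptotically free; for given \<open>v\<close> the sum of \<open>e n v w\<close>
  over \<open>w\<close> is at most \<open>\<bar>E\<bar>\<^sup>2\<close>, which is negligible against \<open>\<bar>V\<^sub>n\<bar>\<close>.\<close>

lemma bernoulli_decorrelates:
  fixes X :: "'x topology"
  assumes X: "compact_metrizable X" and \<F>: "countable_separating X \<F>" and \<kappa>: "\<kappa> \<in> Prob X"
  shows "decorrelates X \<F> (\<lambda>n. PiM (V n) (\<lambda>_. \<kappa>)) (PiM (carrier G) (\<lambda>_. \<kappa>))"
  unfolding decorrelates_def
proof
  fix l assume l: "l \<in> lists (coordinate_functions (carrier G) \<F>)"
  have XK: "compact_space X" using X by simp
  have pk: "prob_space \<kappa>" using \<kappa> by (rule Prob_prob_space)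
  have \<F>c: "continuous_map X euclideanreal f" if "f \<in> \<F>" for f
    using \<F> that by (simp add: countable_separating_def)
  obtain E \<phi> where E: "finite E" "E \<subseteq> carrier G" and \<phi>: "\<And>i. continuous_map X euclideanreal (\<phi> i)"
    and l_eq: "\<And>x. monomial l x = (\<Prod>i\<in>E. \<phi> i (x i))"
    using monomial_eq_prod [OF l \<F>c] by blast
  define c where "c = (\<integral>z. monomial l z \<partial>PiM (carrier G) (\<lambda>_. \<kappa>))"
  have \<phi>i: "integrable \<kappa> (\<phi> i)" for i
    by (rule continuous_integrable [OF XK \<kappa> \<phi>])
  have c: "c = (\<Prod>i\<in>E. \<integral>y. \<phi> i y \<partial>\<kappa>)"
    unfolding c_def l_eq
    using integral_PiM_prod_reindex [of \<kappa> E "\<lambda>i. i" "carrier G" \<phi>] pk E \<phi>i by auto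
  have lc: "continuous_map (configs (carrier G) X) euclideanreal (monomial l)"
    using l coordinate_functions_continuous [OF \<F> countable_carrier] by (intro continuous_monomial) auto
  have K: "compact_space (configs (carrier G) X)" using compact_metrizable_process [OF X] by simp
  obtain C where C: "C > 0" "\<And>z. z \<in> topspace (configs (carrier G) X) \<Longrightarrow> \<bar>monomial l z\<bar> \<le> C"
    by (rule continuous_on_compact_bounded [OF K lc]) blast
  let ?P = "\<lambda>n. PiM (V n) (\<lambda>_. \<kappa>)"
  have P: "?P n \<in> Prob (configs (V n) X)" for n
    using finite_V by (intro PiM_in_Prob X \<kappa> countable_finite)
  have PG: "PiM (carrier G) (\<lambda>_. \<kappa>) \<in> Prob (configs (carrier G) X)"
    by (intro PiM_in_Prob X \<kappa> countable_carrier)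
  have KV: "compact_space (configs (V n) X)" for n using compact_metrizable_model [OF X] by blast
  define f where "f n v x = monomial l (pullback G (\<sigma> n) v x)" for n v and x :: "'v \<Rightarrow> 'x"
  have f_eq: "f n v x = (\<Prod>i\<in>E. \<phi> i (x (\<sigma> n i v)))" for n v x
    unfolding f_def l_eq using E(2) by (intro prod.cong) (auto simp: pullback_def)
  have fc: "continuous_map (configs (V n) X) euclideanreal (f n v)" if "v \<in> V n" for n v
    unfolding f_def [abs_def] by (rule continuous_pullback_function [OF lc that])
  have fi: "integrable (?P n) (f n v)" if "v \<in> V n" for n v
    by (rule continuous_integrable [OF KV P fc [OF that]])
  have ffi: "integrable (?P n) (\<lambda>x. f n v x * f n w x)" if "v \<in> V n" "w \<in> V n" for n v w
    by (rule continuous_integrable [OF KV P continuous_map_real_mult [OF fc [OF that(1)] fc [OF that(2)]]])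
  define t where "t n v w = (\<integral>x. (f n v x - c) * (f n w x - c) \<partial>?P n)" for n v w
  have t_le: "\<bar>t n v w\<bar> \<le> (2 * C) * (2 * C)" if v: "v \<in> V n" and w: "w \<in> V n" for n v w
  proof -
    interpret P: prob_space "?P n" using P by (rule Prob_prob_space)
    interpret PG: prob_space "PiM (carrier G) (\<lambda>_. \<kappa>)" using PG by (rule Prob_prob_space)
    have "\<bar>c\<bar> \<le> (\<integral>z. \<bar>monomial l z\<bar> \<partial>PiM (carrier G) (\<lambda>_. \<kappa>))"
      unfolding c_def by (rule integral_abs_bound)
    also have "\<dots> \<le> (\<integral>z. C \<partial>PiM (carrier G) (\<lambda>_. \<kappa>))"
      using continuous_integrable [OF K PG lc] C(2) Prob_space [OF PG] by (intro integral_mono) auto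
    finally have cC: "\<bar>c\<bar> \<le> C" by (simp add: PG.prob_space)
    have fC: "\<bar>f n u x - c\<bar> \<le> 2 * C" if "u \<in> V n" "x \<in> topspace (configs (V n) X)" for u x
      using C(2) [OF pullback_in_configs [OF that(2,1)]] cC unfolding f_def by linarith
    have "\<bar>t n v w\<bar> \<le> (\<integral>x. \<bar>(f n v x - c) * (f n w x - c)\<bar> \<partial>?P n)"
      unfolding t_def by (rule integral_abs_bound)
    also have "\<dots> \<le> (\<integral>x. (2 * C) * (2 * C) \<partial>?P n)"
    proof (rule integral_mono)
      have "continuous_map (configs (V n) X) euclideanreal (\<lambda>x. \<bar>(f n v x - c) * (f n w x - c)\<bar>)"
        using fc [OF v] fc [OF w] by (intro continuous_map_real_abs continuous_map_real_mult continuous_map_diff) auto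
      then show "integrable (?P n) (\<lambda>x. \<bar>(f n v x - c) * (f n w x - c)\<bar>)"
        by (rule continuous_integrable [OF KV P])
      fix x assume "x \<in> space (?P n)"
      then have x: "x \<in> topspace (configs (V n) X)" using Prob_space [OF P] by simp
      show "\<bar>(f n v x - c) * (f n w x - c)\<bar> \<le> (2 * C) * (2 * C)"
        unfolding abs_mult using fC [OF v x] fC [OF w x] C(1) by (intro mult_mono) auto
    qed simp
    finally show ?thesis by (simp add: P.prob_space)
  qed
  have t_zero: "t n v w = 0" if v: "v \<in> V n" and w: "w \<in> V n"
    and injv: "inj_on (\<lambda>g. \<sigma> n g v) E" and injw: "inj_on (\<lambda>g. \<sigma> n g w) E"
    and disj: "\<And>g h. g \<in> E \<Longrightarrow> h \<in> E \<Longrightarrow> \<sigma> n g v \<noteq> \<sigma> n h w" for n v w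
  proof -
    interpret P: prob_space "?P n" using P by (rule Prob_prob_space)
    have in_V: "\<sigma> n g u \<in> V n" if "g \<in> E" "u \<in> V n" for g u
      using \<sigma>_in_V that E(2) by blast
    have e1: "(\<integral>x. f n u x \<partial>?P n) = c" if "u \<in> V n" "inj_on (\<lambda>g. \<sigma> n g u) E" for u
      unfolding f_eq c using in_V that pk E(1) \<phi>i by (intro integral_PiM_prod_reindex) auto
    \<comment> \<open>the points for \<open>v\<close> and \<open>w\<close> as one family, indexed by two copies of \<open>E\<close>\<close>
    define \<tau> where "\<tau> = (\<lambda>(g, b). \<sigma> n g (if b then v else w))"
    have inj: "inj_on \<tau> (E \<times> UNIV)"
    proof (rule inj_onI)
      fix p q assume p: "p \<in> E \<times> UNIV" and q: "q \<in> E \<times> UNIV" and eq: "\<tau> p = \<tau> q"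
      obtain g a where ga: "p = (g, a)" by (cases p)
      obtain h b where hb: "q = (h, b)" by (cases q)
      have gh: "g \<in> E" "h \<in> E" using p q ga hb by auto
      show "p = q"
        using eq inj_onD [OF injv, of g h] inj_onD [OF injw, of g h] disj [of g h] disj [of h g] gh
        unfolding ga hb \<tau>_def by (cases a; cases b) auto
    qed
    have prod_split: "(\<Prod>p\<in>E \<times> (UNIV :: bool set). \<psi> p) = (\<Prod>g\<in>E. \<psi> (g, True)) * (\<Prod>g\<in>E. \<psi> (g, False))" for \<psi> :: "'g \<times> bool \<Rightarrow> real"
    proof -
      have "(\<Prod>p\<in>E \<times> (UNIV :: bool set). \<psi> p) = (\<Prod>g\<in>E. \<Prod>b\<in>UNIV. \<psi> (g, b))"
        by (simp add: prod.cartesian_product)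
      then show ?thesis by (simp add: UNIV_bool prod.distrib mult.commute)
    qed
    have "(\<integral>x. f n v x * f n w x \<partial>?P n) = (\<integral>x. (\<Prod>p\<in>E \<times> UNIV. \<phi> (fst p) (x (\<tau> p))) \<partial>?P n)"
      unfolding f_eq prod_split by (simp add: \<tau>_def)
    also have "\<dots> = (\<Prod>p\<in>E \<times> (UNIV :: bool set). \<integral>y. \<phi> (fst p) y \<partial>\<kappa>)"
    proof (rule integral_PiM_prod_reindex [OF pk _ inj])
      show "\<tau> \<in> E \<times> UNIV \<rightarrow> V n" using in_V v w by (auto simp: \<tau>_def)
    qed (use E(1) \<phi>i in auto)
    also have "\<dots> = c * c" unfolding prod_split c by simp
    finally have e2: "(\<integral>x. f n v x * f n w x \<partial>?P n) = c * c" .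
    have "t n v w = (\<integral>x. f n v x * f n w x - c * f n v x - c * f n w x + c * c \<partial>?P n)"
      unfolding t_def by (intro Bochner_Integration.integral_cong refl) (simp add: algebra_simps)
    also have "\<dots> = c * c - c * c - c * c + c * c"
      using fi [OF v] fi [OF w] ffi [OF v w] e1 [OF v injv] e1 [OF w injw] e2
      by (simp add: P.prob_space)
    finally show ?thesis by simp
  qed
  define b where "b n v = (\<Sum>p\<in>{p \<in> E \<times> E. fst p \<noteq> snd p}. of_bool (\<sigma> n (fst p) v = \<sigma> n (snd p) v) :: real)" for n v
  define e where "e n v w = (\<Sum>p\<in>E \<times> E. of_bool (\<sigma> n (fst p) v = \<sigma> n (snd p) w) :: real)" for n v w
  have b0: "0 \<le> b n v" and e0: "0 \<le> e n v w" for n v w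
    by (auto simp: b_def e_def intro!: sum_nonneg)
  have finE: "finite (E \<times> E)" "finite {p \<in> E \<times> E. fst p \<noteq> snd p}" using E(1) by auto
  have bound: "\<bar>t n v w\<bar> \<le> (2 * C) * (2 * C) * (b n v + b n w + e n v w)" if v: "v \<in> V n" and w: "w \<in> V n" for n v w
  proof (cases "t n v w = 0")
    case True
    then show ?thesis using b0 [of n v] b0 [of n w] e0 [of n v w] C(1) by simp
  next
    case False
    have b1: "1 \<le> b n u" if notinj: "\<not> inj_on (\<lambda>g. \<sigma> n g u) E" for u
    proof -
      obtain g h where gh: "g \<in> E" "h \<in> E" "g \<noteq> h" "\<sigma> n g u = \<sigma> n h u"
        using notinj unfolding inj_on_def by blast
      have "of_bool (\<sigma> n (fst (g, h)) u = \<sigma> n (snd (g, h)) u) \<le> b n u"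
        unfolding b_def by (rule member_le_sum) (use gh finE in auto)
      then show ?thesis using gh by simp
    qed
    have e1: "1 \<le> e n v w" if "g \<in> E" "h \<in> E" "\<sigma> n g v = \<sigma> n h w" for g h
    proof -
      have "of_bool (\<sigma> n (fst (g, h)) v = \<sigma> n (snd (g, h)) w) \<le> e n v w"
        unfolding e_def by (rule member_le_sum) (use that finE in auto)
      then show ?thesis using that by simp
    qed
    have "1 \<le> b n v + b n w + e n v w"
    proof (rule ccontr)
      assume less: "\<not> ?thesis"
      have "inj_on (\<lambda>g. \<sigma> n g v) E" using b1 [of v] less b0 [of n w] e0 [of n v w] by fastforce
      moreover have "inj_on (\<lambda>g. \<sigma> n g w) E" using b1 [of w] less b0 [of n v] e0 [of n v w] by fastforce
      moreover have "\<And>g h. g \<in> E \<Longrightarrow> h \<in> E \<Longrightarrow> \<sigma> n g v \<noteq> \<sigma> n h w"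
        using e1 less b0 [of n v] b0 [of n w] by fastforce
      ultimately have "t n v w = 0" by (rule t_zero [OF v w])
      then show False using False by simp
    qed
    then have "(2 * C) * (2 * C) * 1 \<le> (2 * C) * (2 * C) * (b n v + b n w + e n v w)"
      using C(1) by (intro mult_left_mono) auto
    then show ?thesis using t_le [OF v w] by linarith
  qed
  have b_lim: "(\<lambda>n. average (V n) (b n)) \<longlonglongrightarrow> 0"
  proof -
    have "average (V n) (b n) = (\<Sum>p\<in>{p \<in> E \<times> E. fst p \<noteq> snd p}.
      real (card {v \<in> V n. \<sigma> n (fst p) v = \<sigma> n (snd p) v}) / real (card (V n)))" for n
      unfolding b_def average_sum using finite_V [of n]
      by (intro sum.cong refl) (simp add: average_def sum_of_bool_eq Collect_conj_eq [symmetric] Int_def conj_commute)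
    moreover have "(\<lambda>n. \<Sum>p\<in>{p \<in> E \<times> E. fst p \<noteq> snd p}.
      real (card {v \<in> V n. \<sigma> n (fst p) v = \<sigma> n (snd p) v}) / real (card (V n))) \<longlonglongrightarrow> (\<Sum>p\<in>{p \<in> E \<times> E. fst p \<noteq> snd p}. 0)"
      using E(2) by (intro tendsto_sum nonfree_fraction_tendsto_0) auto
    ultimately show ?thesis by simp
  qed
  have e_le: "average (V n) (\<lambda>w. e n v w) \<le> real (card (E \<times> E)) / real (card (V n))" for n v
  proof -
    have "average (V n) (\<lambda>w. e n v w) = (\<Sum>p\<in>E \<times> E. average (V n) (\<lambda>w. of_bool (\<sigma> n (fst p) v = \<sigma> n (snd p) w)))"
      unfolding e_def by (rule average_sum)
    also have "\<dots> \<le> (\<Sum>p\<in>E \<times> E. 1 / real (card (V n)))"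
    proof (rule sum_mono)
      fix p assume "p \<in> E \<times> E"
      then have "\<sigma> n (snd p) permutes V n" using permutes_V E(2) by auto
      then have "inj (\<sigma> n (snd p))" by (rule permutes_inj)
      then have sub: "card {w \<in> V n. \<sigma> n (fst p) v = \<sigma> n (snd p) w} \<le> 1"
        using finite_V [of n] by (auto simp: card_le_Suc0_iff_eq inj_def)
      have "(\<Sum>w\<in>V n. of_bool (\<sigma> n (fst p) v = \<sigma> n (snd p) w)) = real (card {w \<in> V n. \<sigma> n (fst p) v = \<sigma> n (snd p) w})"
        using finite_V [of n] by (simp add: sum_of_bool_eq Int_def)
      then show "average (V n) (\<lambda>w. of_bool (\<sigma> n (fst p) v = \<sigma> n (snd p) w)) \<le> 1 / real (card (V n))"
        unfolding average_def using sub by (intro divide_right_mono) auto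
    qed
    also have "\<dots> = real (card (E \<times> E)) / real (card (V n))" by simp
    finally show ?thesis .
  qed
  have "(\<lambda>n. average (V n) (\<lambda>v. average (V n) (\<lambda>w. \<bar>t n v w\<bar>))) \<longlonglongrightarrow> 0"
  proof (rule tendsto_sandwich [OF _ _ tendsto_const])
    show "\<forall>\<^sub>F n in sequentially. 0 \<le> average (V n) (\<lambda>v. average (V n) (\<lambda>w. \<bar>t n v w\<bar>))"
      by (intro always_eventually allI average_nonneg) simp
    show "\<forall>\<^sub>F n in sequentially. average (V n) (\<lambda>v. average (V n) (\<lambda>w. \<bar>t n v w\<bar>))
      \<le> (2 * C) * (2 * C) * (average (V n) (b n) + average (V n) (b n) + real (card (E \<times> E)) / real (card (V n)))"
      using eventually_nonempty
    proof eventually_elim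
      case (elim n)
      have inner: "average (V n) (\<lambda>w. \<bar>t n v w\<bar>) \<le> (2 * C) * (2 * C) * (b n v + average (V n) (b n) + real (card (E \<times> E)) / real (card (V n)))" if v: "v \<in> V n" for v
      proof -
        have "average (V n) (\<lambda>w. \<bar>t n v w\<bar>) \<le> average (V n) (\<lambda>w. (2 * C) * (2 * C) * (b n v + b n w + e n v w))"
          by (intro average_mono bound v)
        also have "\<dots> = (2 * C) * (2 * C) * (b n v + average (V n) (b n) + average (V n) (\<lambda>w. e n v w))"
          unfolding average_cmult average_add average_const [OF finite_V elim] ..
        also have "\<dots> \<le> (2 * C) * (2 * C) * (b n v + average (V n) (b n) + real (card (E \<times> E)) / real (card (V n)))"
          using e_le C(1) by (intro mult_left_mono add_left_mono) auto
        finally show ?thesis .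
      qed
      have "average (V n) (\<lambda>v. average (V n) (\<lambda>w. \<bar>t n v w\<bar>))
        \<le> average (V n) (\<lambda>v. (2 * C) * (2 * C) * (b n v + average (V n) (b n) + real (card (E \<times> E)) / real (card (V n))))"
        by (intro average_mono inner)
      also have "\<dots> = (2 * C) * (2 * C) * (average (V n) (b n) + average (V n) (b n) + real (card (E \<times> E)) / real (card (V n)))"
        unfolding average_cmult average_add average_const [OF finite_V elim] ..
      finally show ?case .
    qed
    have "filterlim (\<lambda>n. real (card (V n))) at_top sequentially"
      by (rule filterlim_compose [OF filterlim_real_sequentially card_V])
    then have "(\<lambda>n. real (card (E \<times> E)) / real (card (V n))) \<longlonglongrightarrow> 0"
      by (rule real_tendsto_divide_at_top [OF tendsto_const])
    then have "(\<lambda>n. (2 * C) * (2 * C) * (average (V n) (b n) + average (V n) (b n) + real (card (E \<times> E)) / real (card (V n)))) \<longlonglongrightarrow> (2 * C) * (2 * C) * (0 + 0 + 0)"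
      by (intro tendsto_mult_left tendsto_add b_lim)
    then show "(\<lambda>n. (2 * C) * (2 * C) * (average (V n) (b n) + average (V n) (b n) + real (card (E \<times> E)) / real (card (V n)))) \<longlonglongrightarrow> 0"
      by simp
  qed
  then show "(\<lambda>n. average (V n) (\<lambda>v. average (V n) (\<lambda>w.
        \<bar>\<integral>x. (monomial l (pullback G (\<sigma> n) v x) - (\<integral>z. monomial l z \<partial>PiM (carrier G) (\<lambda>_. \<kappa>)))
            * (monomial l (pullback G (\<sigma> n) w x) - (\<integral>z. monomial l z \<partial>PiM (carrier G) (\<lambda>_. \<kappa>))) \<partial>?P n\<bar>))) \<longlonglongrightarrow> 0"
    by (simp add: t_def f_def c_def)
qed

end

lemma bernoulli_shift_invariant:
  assumes "group G" "prob_space \<kappa>" and h: "h \<in> carrier G"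
  shows "right_shift G h \<in> bernoulli G \<kappa> \<rightarrow>\<^sub>M bernoulli G \<kappa>"
    "distr (bernoulli G \<kappa>) (bernoulli G \<kappa>) (right_shift G h) = bernoulli G \<kappa>"
proof -
  interpret group G by fact
  show "right_shift G h \<in> bernoulli G \<kappa> \<rightarrow>\<^sub>M bernoulli G \<kappa>"
    unfolding bernoulli_def right_shift_def [abs_def] using h
    by (intro measurable_restrict measurable_component_singleton) auto
  have "inj_on (\<lambda>g. g \<otimes>\<^bsub>G\<^esub> h) (carrier G)" using h by (auto intro: inj_onI)
  then show "distr (bernoulli G \<kappa>) (bernoulli G \<kappa>) (right_shift G h) = bernoulli G \<kappa>"
    unfolding bernoulli_def right_shift_def [abs_def]
    using assms(2) h by (intro distr_PiM_reindex) auto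
qed

lemma factor_map_bernoulli:
  assumes G: "group G" and \<kappa>: "prob_space \<kappa>" and \<eta>: "prob_space \<eta>"
    and c: "c \<in> \<kappa> \<rightarrow>\<^sub>M \<eta>" "distr \<kappa> \<eta> c = \<eta>"
  shows "factor_map G (bernoulli G \<kappa>) (right_shift G) (bernoulli G \<eta>) (right_shift G)
    (\<lambda>x. \<lambda>g\<in>carrier G. c (x g))"
proof -
  interpret group G by fact
  let ?c = "\<lambda>x. \<lambda>g\<in>carrier G. c (x g)"
  let ?P = "PiM (carrier G) (\<lambda>_. \<kappa>)" and ?Q = "PiM (carrier G) (\<lambda>_. \<eta>)"
  have m: "?c \<in> ?P \<rightarrow>\<^sub>M ?Q"
    by (intro measurable_restrict measurable_compose [OF _ c(1)] measurable_component_singleton)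
  have "distr ?P ?Q ?c = ?Q"
  proof (rule measure_eqI_PiM_infinite [symmetric, OF refl])
    interpret prob_space ?Q using \<eta> by (intro prob_space_PiM)
    show "finite_measure ?Q" by unfold_locales
    fix J A assume J: "finite J" "J \<subseteq> carrier G" and A: "\<And>i. i \<in> J \<Longrightarrow> A i \<in> sets \<eta>"
    have cA: "c -` A i \<inter> space \<kappa> \<in> sets \<kappa>" if "i \<in> J" for i
      by (rule measurable_sets [OF c(1) A [OF that]])
    have "emeasure ?Q (prod_emb (carrier G) (\<lambda>_. \<eta>) J (Pi\<^sub>E J A)) = (\<Prod>i\<in>J. emeasure \<eta> (A i))"
      using J A \<eta> by (intro emeasure_PiM_emb) auto
    also have "\<dots> = (\<Prod>i\<in>J. emeasure \<kappa> (c -` A i \<inter> space \<kappa>))"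
    proof (rule prod.cong [OF refl])
      fix i assume "i \<in> J"
      have "emeasure \<eta> (A i) = emeasure (distr \<kappa> \<eta> c) (A i)" by (simp only: c(2))
      also have "\<dots> = emeasure \<kappa> (c -` A i \<inter> space \<kappa>)" by (rule emeasure_distr [OF c(1) A [OF \<open>i \<in> J\<close>]])
      finally show "emeasure \<eta> (A i) = emeasure \<kappa> (c -` A i \<inter> space \<kappa>)" .
    qed
    also have "\<dots> = emeasure ?P (prod_emb (carrier G) (\<lambda>_. \<kappa>) J (\<Pi>\<^sub>E i\<in>J. c -` A i \<inter> space \<kappa>))"
      using J cA \<kappa> by (intro emeasure_PiM_emb [symmetric]) auto
    also have "prod_emb (carrier G) (\<lambda>_. \<kappa>) J (\<Pi>\<^sub>E i\<in>J. c -` A i \<inter> space \<kappa>)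
      = ?c -` prod_emb (carrier G) (\<lambda>_. \<eta>) J (Pi\<^sub>E J A) \<inter> space ?P"
    proof -
      have JG: "i \<in> carrier G" if "i \<in> J" for i using J(2) that by blast
      show ?thesis
        using measurable_space [OF c(1)] by (auto simp: prod_emb_def space_PiM PiE_iff JG cong: ball_cong_simp)
    qed
    also have "emeasure ?P \<dots> = emeasure (distr ?P ?Q ?c) (prod_emb (carrier G) (\<lambda>_. \<eta>) J (Pi\<^sub>E J A))"
      using J A by (intro emeasure_distr [symmetric] m sets_PiM_I) auto
    finally show "emeasure ?Q (prod_emb (carrier G) (\<lambda>_. \<eta>) J (Pi\<^sub>E J A))
      = emeasure (distr ?P ?Q ?c) (prod_emb (carrier G) (\<lambda>_. \<eta>) J (Pi\<^sub>E J A))" .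
  qed simp
  moreover have "?c (right_shift G h x) = right_shift G h (?c x)" if "h \<in> carrier G" for h x
    using that by (auto simp: right_shift_def fun_eq_iff)
  ultimately show ?thesis
    using m by (simp add: factor_map_def bernoulli_def)
qed

section \<open>Standard Borel spaces as images of the Hilbert cube\<close>

abbreviation hilbert_cube :: "(nat \<Rightarrow> real) topology" where
  "hilbert_cube \<equiv> configs UNIV (top_of_set {0..1})"

lemma compact_metrizable_hilbert_cube: "compact_metrizable hilbert_cube"
proof (rule compact_metrizable_configs)
  show "compact_metrizable (top_of_set {0..1 :: real})"
    by (simp add: compact_space_subtopology metrizable_space_subtopology metrizable_space_euclidean compactin_euclidean_iff)
qed simp

text \<open>Urysohn's embedding by the truncated distances to a dense sequence \<open>p\<close>. If \<open>d x (p n) < r / 3\<close>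
  and \<open>e y n < 2 r / 3\<close>, then \<open>d x y < r\<close>; this gives injectivity and openness onto the image.\<close>

lemma hilbert_cube_embedding:
  fixes K :: "'k topology"
  assumes "metrizable_space K" "second_countable K" "topspace K \<noteq> {}"
  obtains e where "embedding_map K hilbert_cube e"
proof -
  obtain M d where M: "Metric_space M d" and K: "K = Metric_space.mtopology M d"
    using assms(1) unfolding metrizable_space_def by blast
  interpret Metric_space M d by (rule M)
  have top: "topspace K = M" by (simp add: K)
  obtain D where D: "countable D" "D \<subseteq> M" "K closure_of D = M"
    using second_countable_imp_separable_space [OF assms(2)] unfolding separable_space_def top by blast
  have "D \<noteq> {}" using D(3) assms(3) top by auto
  define p where "p = from_nat_into D"
  have p: "p n \<in> M" for n using from_nat_into [OF \<open>D \<noteq> {}\<close>] D(2) by (auto simp: p_def)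
  have near: "\<exists>n. d x (p n) < r" if x: "x \<in> M" and r: "r > 0" for x r
  proof -
    have "x \<in> K closure_of D" using D(3) x by simp
    moreover have "openin K (mball x r)" by (simp add: K)
    moreover have "x \<in> mball x r" using x r by simp
    ultimately obtain q where "q \<in> D" "q \<in> mball x r" unfolding in_closure_of by blast
    then show ?thesis using from_nat_into_surj [OF D(1)] by (auto simp: p_def in_mball)
  qed
  define e where "e x n = min 1 (d x (p n))" for x n
  have c: "continuous_map K hilbert_cube e"
    unfolding continuous_map_componentwise_UNIV continuous_map_in_subtopology
  proof (intro allI conjI)
    fix n
    have "continuous_map K euclideanreal (\<lambda>x. mdist (metric (M, d)) x (p n))"
      using M p K by (intro continuous_map_mdist) (auto simp: mtopology_of_def)
    then have "continuous_map K euclideanreal (\<lambda>x. d x (p n))" using M by simp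
    then show "continuous_map K euclidean (\<lambda>x. e x n)"
      unfolding e_def by (intro continuous_map_real_min) auto
    show "(\<lambda>x. e x n) \<in> topspace K \<rightarrow> {0..1}" by (auto simp: e_def)
  qed
  have close: "d x y < r" if "x \<in> M" "y \<in> M" "d x (p n) < r / 3" "e y n < 2 * r / 3" "r < 1" for x y n r
  proof -
    have "d y (p n) < 2 * r / 3" using that(4,5) that(3) nonneg [of x "p n"] by (auto simp: e_def min_def split: if_splits)
    moreover have "d x y \<le> d x (p n) + d (p n) y" using triangle that p by blast
    ultimately show ?thesis using that(3) commute [of y "p n"] by linarith
  qed
  have inj: "inj_on e (topspace K)"
  proof (rule inj_onI, rule ccontr)
    fix x y assume xy: "x \<in> topspace K" "y \<in> topspace K" "e x = e y" "x \<noteq> y"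
    \<comment> \<open>below \<open>1\<close> the truncation at \<open>1\<close> has no effect\<close>
    define r where "r = min (d x y) (1/2)"
    have r: "r > 0" "r < 1" "r \<le> d x y" using xy top by (auto simp: r_def)
    then obtain n where n: "d x (p n) < r / 3" using near [of x "r / 3"] xy top by auto
    have "e x n < 2 * r / 3" using n r by (simp add: e_def min_def)
    then have "e y n < 2 * r / 3" using xy(3) by simp
    moreover have "x \<in> M" "y \<in> M" using xy top by auto
    ultimately have "d x y < r" using close n r(2) by blast
    then show False using r by simp
  qed
  have "open_map K (subtopology hilbert_cube (e ` topspace K)) e"
    unfolding open_map_def
  proof (intro allI impI)
    fix U assume U: "openin K U"
    define C where "C = {(n, r). 0 < r \<and> r < (1::real) \<and> (\<exists>x\<in>U. d x (p n) < r / 3 \<and> mball x r \<subseteq> U)}"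
    define O' where "O' = (\<Union>(n, r)\<in>C. {z \<in> topspace hilbert_cube. z n < 2 * r / 3})"
    have "openin hilbert_cube {z \<in> topspace hilbert_cube. z n < 2 * r / 3}" for n r
    proof -
      have "continuous_map hilbert_cube (top_of_set {0..1}) (\<lambda>z. z n)"
        by (rule continuous_map_product_projection) simp
      then have "continuous_map hilbert_cube euclideanreal (\<lambda>z. z n)"
        by (simp add: continuous_map_in_subtopology)
      from openin_continuous_map_preimage [OF this, of "{..<2 * r / 3}"] show ?thesis by simp
    qed
    then have O': "openin hilbert_cube O'" unfolding O'_def by (intro openin_Union) auto
    have "e ` U = O' \<inter> e ` topspace K"
    proof (rule subset_antisym; rule subsetI)
      fix z assume "z \<in> e ` U"
      then obtain x where x: "x \<in> U" "z = e x" by blast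
      have xM: "x \<in> M" using x openin_subset [OF U] top by auto
      obtain r0 where r0: "r0 > 0" "mball x r0 \<subseteq> U"
        using U x(1) unfolding K openin_mtopology by blast
      define r where "r = min r0 (1/2)"
      have r: "0 < r" "r < 1" "mball x r \<subseteq> U" using r0 mball_subset_concentric [of r r0 x] by (auto simp: r_def)
      obtain n where n: "d x (p n) < r / 3" using near [OF xM, of "r / 3"] r by auto
      have "(n, r) \<in> C" using r n x by (auto simp: C_def)
      moreover have "e x n < 2 * r / 3" using n r by (simp add: e_def min_def)
      moreover have "e x \<in> topspace hilbert_cube" using c xM top by (auto simp: continuous_map_def)
      ultimately have "z \<in> O'" unfolding O'_def x(2) by blast
      then show "z \<in> O' \<inter> e ` topspace K" using x openin_subset [OF U] by blast
    next
      fix z assume "z \<in> O' \<inter> e ` topspace K"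
      then obtain n r y where y: "(n, r) \<in> C" "e y n < 2 * r / 3" "y \<in> topspace K" "z = e y"
        unfolding O'_def by blast
      then obtain x where x: "0 < r" "r < 1" "x \<in> U" "d x (p n) < r / 3" "mball x r \<subseteq> U"
        unfolding C_def by blast
      have xM: "x \<in> M" using x openin_subset [OF U] top by auto
      have yM: "y \<in> M" using y(3) top by simp
      have "d x y < r" by (rule close [OF xM yM x(4) y(2) x(2)])
      then have "y \<in> mball x r" using xM yM by (simp add: in_mball)
      then show "z \<in> e ` U" using x(5) y(4) by blast
    qed
    then show "openin (subtopology hilbert_cube (e ` topspace K)) (e ` U)"
      using O' unfolding openin_subtopology by blast
  qed
  moreover have "continuous_map K (subtopology hilbert_cube (e ` topspace K)) e"
    using c by (simp add: continuous_map_in_subtopology)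
  moreover have "topspace (subtopology hilbert_cube (e ` topspace K)) = e ` topspace K"
    using c by (auto simp: continuous_map_def)
  ultimately have "embedding_map K hilbert_cube e"
    unfolding embedding_map_def using inj by (intro bijective_open_imp_homeomorphic_map) auto
  then show ?thesis by (rule that)
qed

text \<open>Embed a Polish topology of \<open>\<kappa>\<close> into the cube. A completely metrizable subspace is a \<open>G\<^sub>\<delta>\<close>
  set, hence Borel, so the inverse of the embedding extends to a Borel map \<open>c\<close> on the cube by a
  constant; \<open>\<kappa>'\<close> is the image of \<open>\<kappa>\<close> under the embedding.\<close>

lemma standard_borel_image_of_hilbert_cube:
  fixes \<kappa> :: "'k measure"
  assumes \<kappa>: "prob_space \<kappa>" "standard_borel \<kappa>"
  obtains \<kappa>' c where "\<kappa>' \<in> Prob hilbert_cube" "c \<in> \<kappa>' \<rightarrow>\<^sub>M \<kappa>" "distr \<kappa>' \<kappa> c = \<kappa>"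
proof -
  interpret prob_space \<kappa> by fact
  obtain K where K: "completely_metrizable_space K" "second_countable K" and sK: "sets \<kappa> = sets (borel_of K)"
    using \<kappa>(2) unfolding standard_borel_def by blast
  have spK: "space \<kappa> = topspace K" using sets_eq_imp_space_eq [OF sK] by simp
  obtain x0 where x0: "x0 \<in> topspace K" using not_empty spK by blast
  obtain e where e: "embedding_map K hilbert_cube e"
    using hilbert_cube_embedding [OF completely_metrizable_imp_metrizable_space [OF K(1)] K(2)] x0 by blast
  define S where "S = e ` topspace K"
  have hom: "homeomorphic_map K (subtopology hilbert_cube S) e"
    using e by (simp add: embedding_map_def S_def)
  have ce: "continuous_map K hilbert_cube e"
    using homeomorphic_imp_continuous_map [OF hom] by (simp add: continuous_map_in_subtopology)
  have Ssub: "S \<subseteq> topspace hilbert_cube" using ce unfolding S_def continuous_map_def by blast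
  have inj: "inj_on e (topspace K)" by (rule homeomorphic_imp_injective_map [OF hom])
  have "completely_metrizable_space (subtopology hilbert_cube S)"
    using homeomorphic_completely_metrizable_space [OF homeomorphic_map_imp_homeomorphic_space [OF hom]] K(1) by blast
  then have "gdelta_in hilbert_cube S"
    using completely_metrizable_space_imp_gdelta_in compact_metrizable_hilbert_cube Ssub by blast
  then obtain \<U> where \<U>: "countable \<U>" "\<And>U. U \<in> \<U> \<Longrightarrow> openin hilbert_cube U" "S = topspace hilbert_cube \<inter> \<Inter>\<U>"
    unfolding gdelta_in_alt intersection_of_def using Ssub by (auto simp: subset_eq)
  have Sm: "S \<in> sets (borel_of hilbert_cube)"
  proof (cases "\<U> = {}")
    case True
    then have "S = topspace hilbert_cube" using \<U>(3) by simp
    then show ?thesis using borel_of_openin [OF openin_topspace, of hilbert_cube] by (simp only:)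
  next
    case False
    have "topspace hilbert_cube \<inter> \<Inter>\<U> = \<Inter>\<U>" using \<U>(2) openin_subset False by blast
    moreover have "\<Inter>\<U> \<in> sets (borel_of hilbert_cube)"
      using sets.countable_INT' [OF \<U>(1) False, of "\<lambda>U. U" "borel_of hilbert_cube"] \<U>(2) borel_of_openin by auto
    ultimately show ?thesis using \<U>(3) by simp
  qed
  define c where "c z = (if z \<in> S then the_inv_into (topspace K) e z else x0)" for z
  have ce_id: "c (e x) = x" if "x \<in> topspace K" for x
    using the_inv_into_f_f [OF inj that] that by (simp add: c_def S_def)
  have cS: "c z \<in> topspace K" for z
    using x0 the_inv_into_into [OF inj, of z "topspace K"] by (auto simp: c_def S_def)
  have cm: "c \<in> borel_of hilbert_cube \<rightarrow>\<^sub>M borel_of K"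
    unfolding borel_of_def [of K]
  proof (rule measurable_measure_of)
    show "c \<in> space (borel_of hilbert_cube) \<rightarrow> topspace K" using cS by blast
    fix U assume "U \<in> {U. openin K U}"
    then have U: "openin K U" by simp
    then have "openin (subtopology hilbert_cube S) (e ` U)"
      using homeomorphic_map_openness_eq [OF hom] by blast
    then obtain O' where O': "openin hilbert_cube O'" "e ` U = O' \<inter> S" by (auto simp: openin_subtopology)
    have eq: "c -` U \<inter> space (borel_of hilbert_cube) = e ` U \<union> (if x0 \<in> U then topspace hilbert_cube - S else {})"
    proof (rule Set.set_eqI)
      fix z
      show "z \<in> c -` U \<inter> space (borel_of hilbert_cube) \<longleftrightarrow> z \<in> e ` U \<union> (if x0 \<in> U then topspace hilbert_cube - S else {})"
      proof (cases "z \<in> S")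
        case True
        then obtain x where x: "x \<in> topspace K" "z = e x" by (auto simp: S_def)
        have "e x \<in> e ` U \<longleftrightarrow> x \<in> U"
          using inj_on_image_mem_iff [OF inj x(1) openin_subset [OF U]] .
        then show ?thesis using True x ce_id [OF x(1)] Ssub by auto
      next
        case False
        then have "z \<notin> e ` U" using O'(2) by blast
        moreover have "c z = x0" using False by (simp add: c_def)
        ultimately show ?thesis using False by auto
      qed
    qed
    have "e ` U \<in> sets (borel_of hilbert_cube)"
      unfolding O'(2) using borel_of_openin [OF O'(1)] Sm by blast
    moreover have "topspace hilbert_cube - S \<in> sets (borel_of hilbert_cube)"
      using sets.compl_sets [OF Sm] by simp
    ultimately show "c -` U \<inter> space (borel_of hilbert_cube) \<in> sets (borel_of hilbert_cube)"
      unfolding eq by auto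
  qed (auto dest: openin_subset)
  have em: "e \<in> \<kappa> \<rightarrow>\<^sub>M borel_of hilbert_cube"
    using continuous_map_measurable_borel_of [OF ce] measurable_cong_sets [OF sK refl] by blast
  have cm': "c \<in> borel_of hilbert_cube \<rightarrow>\<^sub>M \<kappa>"
    using cm measurable_cong_sets [OF refl sK] by blast
  show ?thesis
  proof (rule that [of "distr \<kappa> (borel_of hilbert_cube) e" c])
    show "distr \<kappa> (borel_of hilbert_cube) e \<in> Prob hilbert_cube" by (rule distr_in_Prob [OF \<kappa>(1) em])
    show "c \<in> distr \<kappa> (borel_of hilbert_cube) e \<rightarrow>\<^sub>M \<kappa>" using cm' by simp
    have "distr (distr \<kappa> (borel_of hilbert_cube) e) \<kappa> c = distr \<kappa> \<kappa> (c \<circ> e)"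
      by (rule distr_distr [OF cm' em])
    also have "\<dots> = distr \<kappa> \<kappa> (\<lambda>x. x)"
      using ce_id spK by (intro distr_cong) auto
    finally show "distr (distr \<kappa> (borel_of hilbert_cube) e) \<kappa> c = \<kappa>" by (simp add: distr_id)
  qed
qed

section \<open>Complemented factor maps\<close>

theorem theorem6p8:
  fixes G :: "('g, 'm) monoid_scheme"
    and V :: "nat \<Rightarrow> 'v set"
    and \<sigma> :: "nat \<Rightarrow> 'g \<Rightarrow> 'v \<Rightarrow> 'v"
  assumes "group G" and "countable (carrier G)"
    and "sofic_approximation G V \<sigma>"
  shows
    "(\<forall>(d :: 'x metric) \<mu> (N :: 'y measure) S \<Phi>.
        metric_process G d \<mu> \<and>
        (\<exists>m. (\<forall>n. m n \<in> Prob (configs (V n) (mtopology_of d))) \<and>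
             doubly_quenched_converges G V \<sigma> (mtopology_of d) m \<mu>) \<and>
        g_system G N S \<and> factor_map G \<mu> (right_shift G) N S \<Phi> \<and>
        complemented TYPE('z) G \<mu> (right_shift G) N S \<Phi> \<longrightarrow>
        model_surjective TYPE('a) TYPE('b) G V \<sigma> \<mu> (right_shift G) N S \<Phi>)
     \<and>
     (\<forall>(\<kappa> :: 'k measure) (N :: 'y measure) S \<Phi>.
        prob_space \<kappa> \<and> standard_borel \<kappa> \<and>
        g_system G N S \<and> factor_map G (bernoulli G \<kappa>) (right_shift G) N S \<Phi> \<and>
        complemented TYPE('z) G (bernoulli G \<kappa>) (right_shift G) N S \<Phi> \<longrightarrow>
        model_surjective TYPE('a) TYPE('b) G V \<sigma> (bernoulli G \<kappa>) (right_shift G) N S \<Phi>)"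
proof (intro conjI allI impI; (elim conjE exE)?)
  interpret sofic_group G V \<sigma>
    using assms by (simp add: sofic_group_def sofic_group_axioms_def)
  {
    fix d :: "'x metric" and \<mu> and N :: "'y measure" and S \<Phi> m
    assume d: "metric_process G d \<mu>" and m: "\<forall>n. m n \<in> Prob (configs (V n) (mtopology_of d))"
      and dq: "doubly_quenched_converges G V \<sigma> (mtopology_of d) m \<mu>"
      and N: "g_system G N S" and compl: "complemented TYPE('z) G \<mu> (right_shift G) N S \<Phi>"
    define X where "X = mtopology_of d"
    have X: "compact_metrizable X"
      unfolding X_def by (rule compact_metrizable_mtopology_of) (use d in \<open>simp add: metric_process_def\<close>)
    have \<mu>: "\<mu> \<in> Prob (configs (carrier G) X)"
      and inv: "\<And>g. g \<in> carrier G \<Longrightarrow> distr \<mu> \<mu> (right_shift G g) = \<mu>"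
      using d by (simp_all add: metric_process_def X_def)
    obtain \<F> where \<F>: "countable_separating X \<F>"
      using compact_metrizable_countable_separating [OF X] by blast
    have id: "factor_map G \<mu> (right_shift G) \<mu> (right_shift G) (\<lambda>x. x)"
      by (simp add: factor_map_def distr_id)
    have mX: "\<And>n. m n \<in> Prob (configs (V n) X)" using m by (simp add: X_def)
    show "model_surjective TYPE('a) TYPE('b) G V \<sigma> \<mu> (right_shift G) N S \<Phi>"
      by (rule complemented_factor_model_surjective [OF X \<F> \<mu> inv mX
            doubly_quenched_decorrelates [OF X \<F> \<mu> mX dq [folded X_def]] id
            right_shift_measurable [OF is_group _ \<mu>] inv N compl])
  next
    fix \<kappa> :: "'k measure" and N :: "'y measure" and S \<Phi>
    assume \<kappa>: "prob_space \<kappa>" "standard_borel \<kappa>"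
      and N: "g_system G N S" and compl: "complemented TYPE('z) G (bernoulli G \<kappa>) (right_shift G) N S \<Phi>"
    obtain \<kappa>' c where \<kappa>': "\<kappa>' \<in> Prob hilbert_cube" and c: "c \<in> \<kappa>' \<rightarrow>\<^sub>M \<kappa>" "distr \<kappa>' \<kappa> c = \<kappa>"
      by (rule standard_borel_image_of_hilbert_cube [OF \<kappa>])
    note X = compact_metrizable_hilbert_cube
    obtain \<F> where \<F>: "countable_separating hilbert_cube \<F>"
      using compact_metrizable_countable_separating [OF X] by blast
    have pk': "prob_space \<kappa>'" by (rule Prob_prob_space [OF \<kappa>'])
    have m: "PiM (V n) (\<lambda>_. \<kappa>') \<in> Prob (configs (V n) hilbert_cube)" for n
      using finite_V by (intro PiM_in_Prob X \<kappa>' countable_finite)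
    have \<mu>: "bernoulli G \<kappa>' \<in> Prob (configs (carrier G) hilbert_cube)"
      unfolding bernoulli_def by (intro PiM_in_Prob X \<kappa>' countable_carrier)
    show "model_surjective TYPE('a) TYPE('b) G V \<sigma> (bernoulli G \<kappa>) (right_shift G) N S \<Phi>"
      by (rule complemented_factor_model_surjective [OF X \<F> \<mu>
            bernoulli_shift_invariant(2) [OF is_group pk'] m
            bernoulli_decorrelates [OF X \<F> \<kappa>', folded bernoulli_def]
            factor_map_bernoulli [OF is_group pk' \<kappa>(1) c]
            bernoulli_shift_invariant [OF is_group \<kappa>(1)] N compl])
  }
qed

end
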